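(* Let $m\geq 2$, let $\mathfrak{k}\subset\mathfrak{sp}(2m,\mathbb{C})$ be a (complex Lie) subalgebra, and let $\mathfrak{g}_k$, $k\geq 1$, be the Tanaka prolongations of the graded Lie algebra $\mathfrak{g}_{-2}\oplus\mathfrak{g}_{-1}\oplus\mathfrak{g}_0=\mathbb{C}F\oplus\mathbb{C}^{2m}\oplus(\mathfrak{k}\oplus\mathbb{C}H)$. Then: (1) Under the identification of $u\in\mathfrak{g}_1$ with its component $\varphi=u|_{\mathfrak{g}_{-1}}$, $$\mathfrak{g}_1=\{\varphi\in\mathfrak{g}_{-1}^*\otimes\mathfrak{g}_0\mid \exists A\in\mathfrak{g}_{-1}\ \text{such that}\ \varphi(X)Y-\varphi(Y)X=\Omega(X,Y)A\ \text{ for all } X,Y\in\mathfrak{g}_{-1}\},$$ where $\varphi(X)Y=[\varphi(X),Y]$ denotes the action of $\varphi(X)\in\mathfrak{g}_0$ on $Y\in\mathfrak{g}_{-1}$. (2) If $\mathfrak{k}\subsetneq\mathfrak{sp}(2m,\mathbb{C})$ is a proper irreducible subalgebra and $\mathfrak{g}_1\neq 0$, then $\mathfrak{g}_1\simeq\mathbb{C}^{2m}$, $\mathfrak{g}_2\simeq\mathbb{C}$ and $\mathfrak{g}_3=0$, and the Lie algebra $$\mathfrak{g}_{-2}\oplus\mathfrak{g}_{-1}\oplus\mathfrak{g}_0\oplus\mathfrak{g}_1\oplus\mathfrak{g}_2$$ is simple.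
   Context: Let $\Omega$ be the symplectic form on $\mathbb{C}^{2m}$ defining $\mathfrak{sp}(2m,\mathbb{C})$. The graded Lie algebra has $\mathfrak{g}_{-2}=\mathbb{C}F$ (one-dimensional), $\mathfrak{g}_{-1}=\mathbb{C}^{2m}$, $\mathfrak{g}_0=\mathfrak{k}\oplus\mathbb{C}H$, with non-zero Lie brackets $$[X,Y]=\Omega(X,Y)F,\quad [A,X]=AX,\quad [A,B]=[A,B]_{\mathfrak{k}},\quad [H,X]=-X,\quad [H,F]=-2F,$$ for $X,Y\in\mathbb{C}^{2m}$, $A,B\in\mathfrak{k}$. Irreducible means acting irreducibly on $\mathbb{C}^{2m}$. For $k\geq 1$ the $k$-th Tanaka prolongation is defined inductively by $$\mathfrak{g}_k=\{u\in(\mathfrak{g}_{-2}^*\otimes\mathfrak{g}_{k-2})\oplus(\mathfrak{g}_{-1}^*\otimes\mathfrak{g}_{k-1})\mid u([X,Y])=[u(X),Y]+[X,u(Y)]\ \text{ for all } X,Y\in\mathfrak{g}_{-2}\oplus\mathfrak{g}_{-1}\}.$$ The Lie brackets of $u\in\mathfrak{g}_k$ ($k\geq1$) and $X\in\mathfrak{g}_{-2}\oplus\mathfrak{g}_{-1}$ are $[u,X]=u(X)$, and for $u\in\mathfrak{g}_k$, $v\in\mathfrak{g}_l$ with $k\geq 1$, $l\geq 0$, the bracket $[u,v]\in\mathfrak{g}_{k+l}$ is defined by $$[u,v]X=[[u,X],v]+[u,[v,X]],\quad X\in\mathfrak{g}_{-2}\oplus\mathfrak{g}_{-1}.$$ This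 makes $\bigoplus_{k\geq -2}\mathfrak{g}_k$ a Lie algebra. The isomorphisms $\mathfrak{g}_1\simeq\mathbb{C}^{2m}$ and $\mathfrak{g}_2\simeq\mathbb{C}$ are isomorphisms of $\mathfrak{k}$-modules ($\mathbb{C}^{2m}$ the standard representation, $\mathbb{C}$ the trivial one); in particular $\dim\mathfrak{g}_1=2m$ and $\dim\mathfrak{g}_2=1$. *)

theory Defs
  imports "HOL-Analysis.Analysis" "HOL-Library.Function_Algebras"
begin

section \<open>Lie algebras on a subset of an ambient vector space\<close>

definition lie_subalgebra ::
  "(complex \<Rightarrow> 'a \<Rightarrow> 'a) \<Rightarrow> ('a \<Rightarrow> 'a \<Rightarrow> 'a) \<Rightarrow> 'a::ab_group_add set \<Rightarrow> bool" where
  "lie_subalgebra s br L \<longleftrightarrow> module.subspace s L \<and> (\<forall>x\<in>L. \<forall>y\<in>L. br x y \<in> L)"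

definition lie_algebra_on ::
  "(complex \<Rightarrow> 'a \<Rightarrow> 'a) \<Rightarrow> ('a \<Rightarrow> 'a \<Rightarrow> 'a) \<Rightarrow> 'a::ab_group_add set \<Rightarrow> bool" where
  "lie_algebra_on s br L \<longleftrightarrow>
     vector_space s \<and> lie_subalgebra s br L \<and>
     (\<forall>x\<in>L. \<forall>y\<in>L. \<forall>z\<in>L. br (x + y) z = br x z + br y z \<and> br z (x + y) = br z x + br z y) \<and>
     (\<forall>c. \<forall>x\<in>L. \<forall>y\<in>L. br (s c x) y = s c (br x y) \<and> br x (s c y) = s c (br x y)) \<and>
     (\<forall>x\<in>L. br x x = 0) \<and>
     (\<forall>x\<in>L. \<forall>y\<in>L. \<forall>z\<in>L. br x (br y z) + br y (br z x) + br z (br x y) = 0)"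

definition lie_ideal ::
  "(complex \<Rightarrow> 'a \<Rightarrow> 'a) \<Rightarrow> ('a \<Rightarrow> 'a \<Rightarrow> 'a) \<Rightarrow> 'a::ab_group_add set \<Rightarrow> 'a set \<Rightarrow> bool" where
  "lie_ideal s br I L \<longleftrightarrow>
     I \<subseteq> L \<and> module.subspace s I \<and> (\<forall>x\<in>L. \<forall>y\<in>I. br x y \<in> I)"

definition simple_lie_algebra ::
  "(complex \<Rightarrow> 'a \<Rightarrow> 'a) \<Rightarrow> ('a \<Rightarrow> 'a \<Rightarrow> 'a) \<Rightarrow> 'a::ab_group_add set \<Rightarrow> bool" where
  "simple_lie_algebra s br L \<longleftrightarrow>
     lie_algebra_on s br L \<and> (\<exists>x\<in>L. \<exists>y\<in>L. br x y \<noteq> 0) \<and>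
     (\<forall>I. lie_ideal s br I L \<longrightarrow> I = {0} \<or> I = L)"


section \<open>Symplectic forms and the symplectic Lie algebra\<close>

definition symplectic_form :: "(complex^'n \<Rightarrow> complex^'n \<Rightarrow> complex) \<Rightarrow> bool" where
  "symplectic_form \<Omega> \<longleftrightarrow>
     (\<forall>x. Vector_Spaces.linear (*s) (*) (\<lambda>y. \<Omega> x y)) \<and>
     (\<forall>y. Vector_Spaces.linear (*s) (*) (\<lambda>x. \<Omega> x y)) \<and>
     (\<forall>x. \<Omega> x x = 0) \<and>
     (\<forall>x. (\<forall>y. \<Omega> x y = 0) \<longrightarrow> x = 0)"

definition mat_scale :: "complex \<Rightarrow> complex^'n^'n \<Rightarrow> complex^'n^'n" where
  "mat_scale c A = (\<chi> i j. c * A $ i $ j)"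

definition commutator :: "complex^'n^'n \<Rightarrow> complex^'n^'n \<Rightarrow> complex^'n^'n" where
  "commutator A B = A ** B - B ** A"

definition sp :: "(complex^'n \<Rightarrow> complex^'n \<Rightarrow> complex) \<Rightarrow> (complex^'n^'n) set" where
  "sp \<Omega> = {A. \<forall>x y. \<Omega> (A *v x) y + \<Omega> x (A *v y) = 0}"

definition acts_irreducibly :: "(complex^'n^'n) set \<Rightarrow> bool" where
  "acts_irreducibly K \<longleftrightarrow>
     (\<forall>W. vec.subspace W \<and> (\<forall>A\<in>K. \<forall>x\<in>W. A *v x \<in> W) \<longrightarrow> W = {0} \<or> W = UNIV)"


section \<open>The ambient space of the prolongation\<close>

text \<open>
  A pair \<open>(a, x)\<close> of type \<open>neg\<close> stands for \<open>a F + x\<close> in \<open>g_{-2} \<oplus> g_{-1}\<close>, and a pair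
  \<open>(A, h)\<close> of type \<open>zer\<close> for \<open>A + h H\<close> in \<open>gl(V) \<oplus> \<complex>H\<close>, where \<open>V = g_{-1}\<close>.

  All \<open>g_k\<close> have to live in one type.  That type \<open>T\<close> should consist of a component in
  \<open>g_{-2} \<oplus> g_{-1}\<close>, a component in \<open>gl(V) \<oplus> \<complex>H\<close>, and, for the part of positive degree, a map
  from \<open>g_{-2} \<oplus> g_{-1}\<close> to \<open>T\<close> again.  Currying this map repeatedly gives functions on words
  over \<open>g_{-2} \<oplus> g_{-1}\<close>: the value of \<open>u\<close> at the empty word is its component of degree at most
  0, and \<open>\<lambda>w. u (X # w)\<close> is the value at \<open>X\<close> of the map which is its part of positive degree.
  Addition and zero are pointwise.
\<close>

type_synonym 'n neg = "complex \<times> (complex^'n)"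
type_synonym 'n zer = "(complex^'n^'n) \<times> complex"
type_synonym 'n prol = "'n neg list \<Rightarrow> 'n neg \<times> 'n zer"

definition neg_scale :: "complex \<Rightarrow> ('n::finite) neg \<Rightarrow> 'n neg" where
  "neg_scale c X = (c * fst X, c *s snd X)"

definition prol_scale :: "complex \<Rightarrow> ('n::finite) prol \<Rightarrow> 'n prol" where
  "prol_scale c u =
     (\<lambda>w. (neg_scale c (fst (u w)), (mat_scale c (fst (snd (u w))), c * snd (snd (u w)))))"

definition of_neg :: "('n::finite) neg \<Rightarrow> 'n prol" where
  "of_neg X = (\<lambda>w. if w = [] then (X, 0) else 0)"

definition of_zer :: "('n::finite) zer \<Rightarrow> 'n prol" where
  "of_zer a = (\<lambda>w. if w = [] then (0, a) else 0)"

abbreviation elF :: "complex \<Rightarrow> ('n::finite) prol" where "elF a \<equiv> of_neg (a, 0)"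
abbreviation elV :: "complex^('n::finite) \<Rightarrow> 'n prol" where "elV x \<equiv> of_neg (0, x)"
abbreviation elK :: "complex^('n::finite)^'n \<Rightarrow> 'n prol" where "elK A \<equiv> of_zer (A, 0)"

definition neg_part :: "('n::finite) prol \<Rightarrow> 'n neg" where "neg_part u = fst (u [])"
definition zer_part :: "('n::finite) prol \<Rightarrow> 'n zer" where "zer_part u = snd (u [])"
definition pos_part :: "('n::finite) prol \<Rightarrow> 'n prol" where
  "pos_part u = (\<lambda>w. if w = [] then 0 else u w)"

definition ev :: "('n::finite) prol \<Rightarrow> 'n neg \<Rightarrow> 'n prol" where
  "ev u X = (\<lambda>w. u (X # w))"


section \<open>The bracket\<close>

definition neg_bracket ::
  "(complex^'n \<Rightarrow> complex^'n \<Rightarrow> complex) \<Rightarrow> 'n neg \<Rightarrow> 'n neg \<Rightarrow> 'n neg" where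
  "neg_bracket \<Omega> X Y = (\<Omega> (snd X) (snd Y), 0)"

definition zer_act :: "('n::finite) zer \<Rightarrow> 'n neg \<Rightarrow> 'n neg" where
  "zer_act a X = (- 2 * snd a * fst X, fst a *v snd X - snd a *s snd X)"

definition zer_bracket :: "('n::finite) zer \<Rightarrow> 'n zer \<Rightarrow> 'n zer" where
  "zer_bracket a b = (commutator (fst a) (fst b), 0)"

definition nonneg_act :: "('n::finite) prol \<Rightarrow> 'n neg \<Rightarrow> 'n prol" where
  "nonneg_act v X = of_neg (zer_act (zer_part v) X) + ev v X"

text \<open>
  With \<open>u = u_- + u_0 + u_+\<close> and \<open>v = v_- + v_0 + v_+\<close>, the bracket is
  \<open>[u_-, v_-] + [u_0, v_-] - [v_0, u_-] + [u_0, v_0] + u_+(v_-) - v_+(u_-)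
    + [u_+, v_0 + v_+] - [v_+, u_0]\<close>.
  The last two terms have positive degree.  They are given by the rule
  \<open>[u, v] X = [[u, X], v] + [u, [v, X]]\<close> for \<open>u\<close> of positive and \<open>v\<close> of nonnegative degree,
  which produces the last four terms of the second equation.  The recursion is on the word at which
  the bracket is evaluated.
\<close>

primrec bracket_at ::
  "(complex^'n \<Rightarrow> complex^'n \<Rightarrow> complex) \<Rightarrow> 'n neg list \<Rightarrow> 'n prol \<Rightarrow> 'n prol
     \<Rightarrow> 'n neg \<times> 'n zer" where
  "bracket_at \<Omega> [] u v =
     (neg_bracket \<Omega> (neg_part u) (neg_part v)
        + zer_act (zer_part u) (neg_part v) - zer_act (zer_part v) (neg_part u),
      zer_bracket (zer_part u) (zer_part v))
     + ev u (neg_part v) [] - ev v (neg_part u) []"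
| "bracket_at \<Omega> (X # w) u v =
     ev u (neg_part v) (X # w) - ev v (neg_part u) (X # w)
     + bracket_at \<Omega> w (ev u X) (of_zer (zer_part v) + pos_part v)
     + bracket_at \<Omega> w (pos_part u) (nonneg_act v X)
     - bracket_at \<Omega> w (ev v X) (of_zer (zer_part u))
     - bracket_at \<Omega> w (pos_part v) (of_neg (zer_act (zer_part u) X))"

definition bracket ::
  "(complex^'n \<Rightarrow> complex^'n \<Rightarrow> complex) \<Rightarrow> 'n prol \<Rightarrow> 'n prol \<Rightarrow> 'n prol" where
  "bracket \<Omega> u v = (\<lambda>w. bracket_at \<Omega> w u v)"


section \<open>The Tanaka prolongation\<close>

text \<open>The index is shifted by 2: \<open>grade \<Omega> K n\<close> is the component of degree \<open>n - 2\<close>.\<close>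

fun grade ::
  "(complex^'n \<Rightarrow> complex^'n \<Rightarrow> complex) \<Rightarrow> (complex^'n^'n) set \<Rightarrow> nat \<Rightarrow> 'n prol set" where
  "grade \<Omega> K 0 = range elF"
| "grade \<Omega> K (Suc 0) = range elV"
| "grade \<Omega> K (Suc (Suc 0)) = {of_zer (A, h) | A h. A \<in> K}"
| "grade \<Omega> K (Suc (Suc (Suc n))) =
     {u. u [] = 0 \<and>
         Vector_Spaces.linear neg_scale prol_scale (ev u) \<and>
         (\<forall>a. ev u (a, 0) \<in> grade \<Omega> K (Suc n)) \<and>
         (\<forall>x. ev u (0, x) \<in> grade \<Omega> K (Suc (Suc n))) \<and>
         (\<forall>X Y. ev u (neg_bracket \<Omega> X Y)
                  = bracket \<Omega> (ev u X) (of_neg Y) + bracket \<Omega> (of_neg X) (ev u Y))}"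

definition tanaka ::
  "(complex^'n \<Rightarrow> complex^'n \<Rightarrow> complex) \<Rightarrow> (complex^'n^'n) set \<Rightarrow> int \<Rightarrow> 'n prol set" where
  "tanaka \<Omega> K k = (if k < - 2 then {0} else grade \<Omega> K (nat (k + 2)))"

text \<open>The sum \<open>g_{-2} + \<dots> + g_2\<close>, formed inside the ambient type; it is direct by
  \<open>tanaka_total_direct\<close> below.\<close>

definition tanaka_total ::
  "(complex^'n \<Rightarrow> complex^'n \<Rightarrow> complex) \<Rightarrow> (complex^'n^'n) set \<Rightarrow> 'n prol set" where
  "tanaka_total \<Omega> K = {\<Sum>k\<in>{-2..2}. u k | u. \<forall>k\<in>{-2..2}. u k \<in> tanaka \<Omega> K k}"


section \<open>Consistency of the encoding\<close>

lemma mat_scale_vector_space: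
  "vector_space (mat_scale :: complex \<Rightarrow> complex^'n^'n \<Rightarrow> complex^'n^'n)"
  by unfold_locales (simp_all add: mat_scale_def vec_eq_iff algebra_simps)

lemma neg_scale_vector_space: "vector_space (neg_scale :: complex \<Rightarrow> ('n::finite) neg \<Rightarrow> 'n neg)"
  by unfold_locales (simp_all add: neg_scale_def vec_eq_iff prod_eq_iff algebra_simps)

lemma prol_scale_vector_space: "vector_space (prol_scale :: complex \<Rightarrow> ('n::finite) prol \<Rightarrow> 'n prol)"
  by unfold_locales
    (simp_all add: prol_scale_def neg_scale_def mat_scale_def vec_eq_iff prod_eq_iff fun_eq_iff
       algebra_simps)

lemma ev_zero [simp]: "ev 0 X = 0"
  by (simp add: ev_def fun_eq_iff)

lemma part_zero [simp]: "neg_part 0 = 0" "zer_part 0 = 0" "pos_part 0 = 0"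
  by (simp_all add: neg_part_def zer_part_def pos_part_def fun_eq_iff)

lemma of_zero [simp]: "of_neg 0 = 0" "of_zer 0 = 0"
  by (simp_all add: of_neg_def of_zer_def fun_eq_iff zero_prod_def)

lemma part_of [simp]:
  "neg_part (of_neg X) = X" "zer_part (of_neg X) = 0" "pos_part (of_neg X) = 0" "ev (of_neg X) Y = 0"
  "neg_part (of_zer a) = 0" "zer_part (of_zer a) = a" "pos_part (of_zer a) = 0" "ev (of_zer a) Y = 0"
  by (auto simp: neg_part_def zer_part_def pos_part_def of_neg_def of_zer_def ev_def fun_eq_iff)

lemma zer_act_zero [simp]: "zer_act 0 X = 0" "zer_act a 0 = 0"
  by (simp_all add: zer_act_def zero_prod_def)

lemma zer_bracket_zero [simp]: "zer_bracket 0 a = 0" "zer_bracket a 0 = 0"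
  by (simp_all add: zer_bracket_def commutator_def zero_prod_def matrix_matrix_mult_def vec_eq_iff)

lemma neg_bracket_zero [simp]:
  assumes "symplectic_form \<Omega>"
  shows "neg_bracket \<Omega> 0 X = 0" "neg_bracket \<Omega> X 0 = 0"
proof -
  have "\<Omega> 0 y = 0" "\<Omega> y 0 = 0" for y
  proof -
    interpret l: Vector_Spaces.linear "(*s)" "(*)" "\<lambda>x. \<Omega> x y"
      using assms by (simp add: symplectic_form_def)
    interpret r: Vector_Spaces.linear "(*s)" "(*)" "\<lambda>x. \<Omega> y x"
      using assms by (simp add: symplectic_form_def)
    show "\<Omega> 0 y = 0" "\<Omega> y 0 = 0" using l.zero r.zero by auto
  qed
  then show "neg_bracket \<Omega> 0 X = 0" "neg_bracket \<Omega> X 0 = 0"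
    by (simp_all add: neg_bracket_def zero_prod_def)
qed

text \<open>Maps in the prolongation are linear, so words containing the letter 0 are sent to 0.\<close>

definition zero_letter :: "('n::finite) prol \<Rightarrow> bool" where
  "zero_letter u \<longleftrightarrow> (\<forall>w. 0 \<in> set w \<longrightarrow> u w = 0)"

lemma zero_letter_intros:
  "zero_letter (of_neg X)" "zero_letter (of_zer a)" "zero_letter 0"
  "zero_letter u \<Longrightarrow> zero_letter (pos_part u)" "zero_letter u \<Longrightarrow> zero_letter (ev u X)"
  "zero_letter u \<Longrightarrow> zero_letter v \<Longrightarrow> zero_letter (u + v)"
  by (auto simp: zero_letter_def of_neg_def of_zer_def pos_part_def ev_def)

lemma zero_letter_nonneg_act: "zero_letter v \<Longrightarrow> zero_letter (nonneg_act v X)"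
  by (simp add: nonneg_act_def zero_letter_intros)

lemma zero_letter_ev: "zero_letter u \<Longrightarrow> ev u 0 = 0"
  by (simp add: zero_letter_def ev_def fun_eq_iff)

lemma zero_letter_grade: "u \<in> grade \<Omega> K n \<Longrightarrow> zero_letter u"
proof (induction \<Omega> K n arbitrary: u rule: grade.induct)
  case (4 \<Omega> K n)
  interpret Vector_Spaces.linear neg_scale prol_scale "ev u"
    using 4(3) by simp
  have "ev u X w = 0" if "0 \<in> set (X # w)" for X w
  proof (cases "X = 0")
    case True
    then show ?thesis using zero by simp
  next
    case False
    with that have w: "0 \<in> set w" by simp
    have "ev u (fst X, 0) \<in> grade \<Omega> K (Suc n)" "ev u (0, snd X) \<in> grade \<Omega> K (Suc (Suc n))"
      using 4(3) by auto
    then have "ev u (fst X, 0) w = 0" "ev u (0, snd X) w = 0"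
      using 4(1,2) w unfolding zero_letter_def by blast+
    then show ?thesis using add[of "(fst X, 0)" "(0, snd X)"] by simp
  qed
  then have "u w = 0" if "0 \<in> set w" for w
    using that by (cases w) (auto simp: ev_def)
  then show ?case by (simp add: zero_letter_def)
qed (auto simp: zero_letter_intros)

lemma bracket_at_zero:
  fixes v :: "('n::finite) prol"
  assumes "symplectic_form \<Omega>" "zero_letter v"
  shows "bracket_at \<Omega> w 0 v = 0" "bracket_at \<Omega> w v 0 = 0"
proof -
  have "zero_letter v \<Longrightarrow> bracket_at \<Omega> w 0 v = 0 \<and> bracket_at \<Omega> w v 0 = 0" for v :: "'n prol"
  proof (induction w arbitrary: v)
    case Nil
    then show ?case
      by (simp only: bracket_at.simps part_zero zero_letter_ev zer_act_zero ev_zero zer_bracket_zero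
          neg_bracket_zero[OF assms(1)]) (simp add: zero_prod_def)
  next
    case (Cons X w)
    have act: "nonneg_act (0 :: 'n prol) X = 0"
      by (simp add: nonneg_act_def)
    have IH: "bracket_at \<Omega> w 0 u = 0" "bracket_at \<Omega> w u 0 = 0" if "zero_letter u" for u :: "'n prol"
      using Cons.IH[OF that] by (rule conjunct1, rule conjunct2)
    show ?case
      using Cons.prems
      by (simp only: bracket_at.simps part_zero zer_act_zero ev_zero of_zero act zero_letter_ev
          IH zero_letter_intros zero_letter_nonneg_act add_0_left) simp
  qed
  then show "bracket_at \<Omega> w 0 v = 0" "bracket_at \<Omega> w v 0 = 0" using assms(2) by auto
qed

text \<open>The bracket satisfies the defining equations.\<close>

lemma bracket_nonpos:
  assumes "symplectic_form \<Omega>"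
  shows "bracket \<Omega> (of_neg X) (of_neg Y) = of_neg (neg_bracket \<Omega> X Y)"
    and "bracket \<Omega> (of_zer a) (of_neg X) = of_neg (zer_act a X)"
    and "bracket \<Omega> (of_neg X) (of_zer a) = - of_neg (zer_act a X)"
    and "bracket \<Omega> (of_zer a) (of_zer b) = of_zer (zer_bracket a b)"
proof -
  have zero: "bracket_at \<Omega> w 0 (of_neg Z) = 0" "bracket_at \<Omega> w (of_neg Z) 0 = 0"
    "bracket_at \<Omega> w 0 (of_zer b) = 0" "bracket_at \<Omega> w (of_zer b) 0 = 0" for w Z b
    by (simp_all add: assms bracket_at_zero zero_letter_intros)
  have zero2: "bracket_at \<Omega> w 0 0 = 0" for w
    using zero(1)[of w 0] by simp
  have "bracket_at \<Omega> w (of_neg X) (of_neg Y) = of_neg (neg_bracket \<Omega> X Y) w"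
    "bracket_at \<Omega> w (of_zer a) (of_neg X) = of_neg (zer_act a X) w"
    "bracket_at \<Omega> w (of_neg X) (of_zer a) = - of_neg (zer_act a X) w"
    "bracket_at \<Omega> w (of_zer a) (of_zer b) = of_zer (zer_bracket a b) w" for w
    by (cases w; simp add: assms nonneg_act_def zero zero2;
        simp add: of_neg_def of_zer_def zero_prod_def)+
  note * = this
  show "bracket \<Omega> (of_neg X) (of_neg Y) = of_neg (neg_bracket \<Omega> X Y)"
    "bracket \<Omega> (of_zer a) (of_neg X) = of_neg (zer_act a X)"
    "bracket \<Omega> (of_neg X) (of_zer a) = - of_neg (zer_act a X)"
    "bracket \<Omega> (of_zer a) (of_zer b) = of_zer (zer_bracket a b)"
    by (simp_all add: bracket_def fun_eq_iff *)
qed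

lemma pos_parts:
  assumes "u [] = 0"
  shows "neg_part u = 0" "zer_part u = 0" "pos_part u = u"
  using assms by (auto simp: neg_part_def zer_part_def pos_part_def fun_eq_iff)

lemma nonneg_parts: "neg_part v = 0 \<Longrightarrow> of_zer (zer_part v) + pos_part v = v"
  by (auto simp: neg_part_def zer_part_def pos_part_def of_zer_def fun_eq_iff prod_eq_iff)

lemma bracket_nonneg_neg:
  assumes "symplectic_form \<Omega>" "neg_part v = 0" "zero_letter v"
  shows "bracket \<Omega> v (of_neg X) = nonneg_act v X"
proof -
  have "bracket_at \<Omega> w v (of_neg X) = nonneg_act v X w" for w
    using assms
    by (cases w)
      (simp_all add: nonneg_act_def bracket_at_zero zero_letter_intros,
        simp_all add: of_neg_def zero_prod_def prod_eq_iff)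
  then show ?thesis by (simp add: bracket_def fun_eq_iff)
qed

lemma bracket_pos_neg:
  assumes "symplectic_form \<Omega>" "u [] = 0" "zero_letter u"
  shows "bracket \<Omega> u (of_neg X) = ev u X"
  using assms by (simp add: bracket_nonneg_neg pos_parts nonneg_act_def)

lemma grade_nil:
  "u \<in> grade \<Omega> K (Suc (Suc (Suc n))) \<Longrightarrow> u [] = 0"
  "v \<in> grade \<Omega> K (Suc (Suc n)) \<Longrightarrow> neg_part v = 0"
  by simp (cases n; auto simp: pos_parts)

lemma tanaka_grade:
  "1 \<le> k \<Longrightarrow> tanaka \<Omega> K k = grade \<Omega> K (Suc (Suc (Suc (nat (k - 1)))))"
  "0 \<le> k \<Longrightarrow> tanaka \<Omega> K k = grade \<Omega> K (Suc (Suc (nat k)))"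
proof -
  have "1 \<le> k \<Longrightarrow> nat (k + 2) = Suc (Suc (Suc (nat (k - 1))))"
    "0 \<le> k \<Longrightarrow> nat (k + 2) = Suc (Suc (nat k))" by linarith+
  then show "1 \<le> k \<Longrightarrow> tanaka \<Omega> K k = grade \<Omega> K (Suc (Suc (Suc (nat (k - 1)))))"
    "0 \<le> k \<Longrightarrow> tanaka \<Omega> K k = grade \<Omega> K (Suc (Suc (nat k)))"
    unfolding tanaka_def by simp_all
qed

lemma bracket_tanaka_neg:
  assumes "symplectic_form \<Omega>" "u \<in> tanaka \<Omega> K k" "k \<ge> 1"
  shows "bracket \<Omega> u (of_neg X) = ev u X"
  using assms bracket_pos_neg grade_nil(1) zero_letter_grade unfolding tanaka_grade(1)[OF assms(3)]
  by blast

lemma bracket_tanaka: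
  assumes \<Omega>: "symplectic_form \<Omega>"
    and u: "u \<in> tanaka \<Omega> K k" "k \<ge> 1" and v: "v \<in> tanaka \<Omega> K l" "l \<ge> 0"
  shows "ev (bracket \<Omega> u v) X
           = bracket \<Omega> (bracket \<Omega> u (of_neg X)) v + bracket \<Omega> u (bracket \<Omega> v (of_neg X))"
    and "l = 0 \<Longrightarrow> bracket \<Omega> v u = - bracket \<Omega> u v"
proof -
  have u': "u [] = 0" "zero_letter u"
    using u grade_nil(1) zero_letter_grade unfolding tanaka_grade(1)[OF u(2)] by blast+
  have v': "neg_part v = 0" "zero_letter v"
    using v grade_nil(2) zero_letter_grade unfolding tanaka_grade(2)[OF v(2)] by blast+
  have "ev (bracket \<Omega> u v) X = bracket \<Omega> (ev u X) v + bracket \<Omega> u (nonneg_act v X)"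
    using \<Omega> u' v'
    by (simp add: fun_eq_iff ev_def[of "\<lambda>w. bracket_at \<Omega> w u v"] bracket_def pos_parts nonneg_parts
        zero_letter_ev bracket_at_zero zero_letter_intros)
  then show "ev (bracket \<Omega> u v) X
      = bracket \<Omega> (bracket \<Omega> u (of_neg X)) v + bracket \<Omega> u (bracket \<Omega> v (of_neg X))"
    using \<Omega> u' v' by (simp add: bracket_pos_neg bracket_nonneg_neg)
  show "bracket \<Omega> v u = - bracket \<Omega> u v" if l: "l = 0"
  proof -
    obtain a where a: "v = of_zer a" using v(1) l by (auto simp: tanaka_def eval_nat_numeral)
    have "bracket_at \<Omega> w v u = - bracket_at \<Omega> w u v" for w
      using \<Omega> u' v'
      by (cases w)
        (simp_all add: a pos_parts zero_letter_ev bracket_at_zero zero_letter_intros nonneg_act_def)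
    then show ?thesis by (simp add: bracket_def fun_eq_iff)
  qed
qed

lemma of_nil_indep:
  "of_zer a [] = 0 \<Longrightarrow> a = 0" "of_neg X [] + of_zer a [] = 0 \<Longrightarrow> X = 0"
  by (simp_all add: of_neg_def of_zer_def zero_prod_def)

lemma tanaka_total_direct:
  fixes \<Omega> :: "complex^'n \<Rightarrow> complex^'n \<Rightarrow> complex"
  assumes "\<forall>k\<in>{-2..2}. u k \<in> tanaka \<Omega> K k" "(\<Sum>k\<in>{-2..2}. u k) = 0" "k \<in> {-2..2}"
  shows "u k = 0"
proof -
  have ints: "{-2..2} = {-2, -1, 0, 1, 2 :: int}" by auto
  have mem: "u (-2) \<in> tanaka \<Omega> K (-2)" "u (-1) \<in> tanaka \<Omega> K (-1)" "u 0 \<in> tanaka \<Omega> K 0"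
      "u 1 \<in> tanaka \<Omega> K 1" "u 2 \<in> tanaka \<Omega> K 2"
    using assms(1) by (auto simp: ints)
  have nums: "nat 1 = Suc 0" "nat 2 = Suc (Suc 0)" "nat 3 = Suc (Suc (Suc 0))"
      "nat 4 = Suc (Suc (Suc (Suc 0)))" by simp_all
  obtain a where a: "u (-2) = elF a" using mem(1) by (auto simp: tanaka_def)
  obtain x where x: "u (-1) = elV x" using mem(2) by (auto simp: tanaka_def nums eval_nat_numeral)
  obtain A h where A: "u 0 = of_zer (A, h)" using mem(3) by (auto simp: tanaka_def nums eval_nat_numeral)
  have u1: "u 1 [] = 0" "Vector_Spaces.linear neg_scale prol_scale (ev (u 1))"
      "\<And>b. ev (u 1) (b, 0) \<in> range elV" "\<And>y. ev (u 1) (0, y) \<in> {of_zer (B, h) | B h. B \<in> K}"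
    using mem(4) by (auto simp: tanaka_def nums eval_nat_numeral)
  have u2: "u 2 [] = 0" "Vector_Spaces.linear neg_scale prol_scale (ev (u 2))"
      "\<And>b. ev (u 2) (b, 0) \<in> {of_zer (B, h) | B h. B \<in> K}" "\<And>y. ev (u 2) (0, y) \<in> grade \<Omega> K 3"
    using mem(5) by (auto simp: tanaka_def nums eval_nat_numeral)
  have u2': "ev (u 2) (0, y) [] = 0" for y
    using u2(4)[of y] by (simp add: eval_nat_numeral)
  have sum: "u (-2) w + u (-1) w + u 0 w + u 1 w + u 2 w = 0" for w
    using fun_cong[OF assms(2), of w] by (simp add: ints add.assoc)
  have z: "u (-2) = 0" "u (-1) = 0" "u 0 = 0"
    using sum[of "[]"]
    by (auto simp: a x A u1 u2 of_neg_def of_zer_def zero_prod_def fun_eq_iff)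
  have e: "ev (u 1) X w + ev (u 2) X w = 0" for X w
    using sum[of "X # w"] by (simp add: z ev_def)
  have V: "ev (u 1) (0, y) = 0" for y
  proof -
    obtain B h where B: "ev (u 1) (0, y) = of_zer (B, h)" using u1(4)[of y] by auto
    have "of_zer (B, h) [] = 0" using e[of "(0, y)" "[]"] unfolding B u2' by simp
    then have "(B, h) = 0" by (rule of_nil_indep(1))
    then show ?thesis unfolding B by (simp only: of_zero)
  qed
  have F: "ev (u 1) (b, 0) = 0" for b
  proof -
    obtain y where y: "ev (u 1) (b, 0) = elV y" using u1(3)[of b] by (elim rangeE)
    obtain B h where B: "ev (u 2) (b, 0) = of_zer (B, h)" using u2(3)[of b] by auto
    have "elV y [] + of_zer (B, h) [] = 0" using e[of "(b, 0)" "[]"] unfolding y B .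
    then have "(0, y) = (0 :: 'n neg)" by (rule of_nil_indep(2))
    then show ?thesis unfolding y by (simp only: of_zero)
  qed
  have E: "ev (u 1) X = 0" for X
  proof -
    interpret Vector_Spaces.linear neg_scale prol_scale "ev (u 1)" by (fact u1(2))
    show ?thesis using add[of "(fst X, 0)" "(0, snd X)"] by (simp add: V F)
  qed
  have z1: "u 1 w = 0" for w
    by (cases w) (use u1(1) E in \<open>auto simp: ev_def fun_eq_iff\<close>)
  have z2: "u 2 w = 0" for w
    using sum[of w] by (simp add: z z1)
  show ?thesis using assms(3) z z1 z2 by (auto simp: ints fun_eq_iff)
qed

end

theory Submission
  imports Defs "HOL-Computational_Algebra.Fundamental_Theorem_Algebra"
begin

text \<open>
  Let \<open>\<phi>(x) = Q x + h(x) H\<close> be the component of an element of \<open>g_1\<close> on \<open>g_{-1}\<close>. A cyclic summation shows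
  that \<open>h(x) = - \<Omega> A x / 2\<close>, so \<open>\<phi>\<close> is determined by \<open>A\<close> up to the classical first prolongation
  \<open>{Q : V \<rightarrow> K. Q x y = Q y x}\<close>.

  That prolongation vanishes if \<open>K\<close> is irreducible and different from \<open>sp\<close>: otherwise a trace computation with a
  real semisimple element shows that all iterated classical prolongations are nonzero, so \<open>K\<close> contains
  an element of rank one. It is \<open>z \<mapsto> \<Omega> x z x\<close> up to a factor. The set of all \<open>x\<close> for which this
  operator lies in \<open>K\<close> is \<open>K\<close>-invariant, hence spans \<open>V\<close>, and the commutators of these operators span \<open>sp\<close>.

  Consequently evaluation at \<open>F\<close> is injective on \<open>g_k\<close> for \<open>k \<ge> 1\<close>. The image of \<open>g_1\<close> is
  \<open>K\<close>-invariant, hence \<open>g_1 = V\<close>. If \<open>g_3\<close> were nonzero, then the brackets with \<open>g_{-1}\<close> would represent a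
  Heisenberg algebra on the finite-dimensional space \<open>g_2 + g_3\<close>, which the trace forbids. Now
  \<open>g_3 = 0\<close> forces \<open>g_2 = \<complex>\<close>. A nonzero ideal contains \<open>F\<close>, hence \<open>g_{-1}\<close>, \<open>H\<close>, \<open>g_1\<close>, \<open>g_2\<close> and the ideal of
  \<open>K\<close> spanned by the operators \<open>Q x\<close>; the centralizer of the latter in \<open>K\<close> is abelian, hence zero, so
  it is all of \<open>K\<close>.
\<close>

subsection \<open>Generalized eigenvectors\<close>

text \<open>The hard point is the vanishing of the classical prolongation, which is commonly read
  off the classification of irreducible linear Lie algebras of infinite type. Here traces and the
  theorem of Engel replace the classification. The trace form of the defining representation is
  nondegenerate on every ideal \<open>I\<close> of \<open>K\<close>, so a functional on
  \<open>I\<close> that vanishes on \<open>[I, K]\<close> is zero; this kills the trace of every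
  element of \<open>I\<close> on each level. Traces of products are reached because the commutator
  of a directional derivative with the bracket by a quadratic field is the bracket by a linear
  field: they telescope over the levels, and real eigenvalues turn the sum into a sum of squares.
  Nonvanishing in all degrees then yields a rank one element by linear algebra with commuting
  derivatives. Evaluation at \<open>F\<close> is the right map because \<open>F\<close> commutes
  with \<open>K\<close> and has degree -2: it is \<open>K\<close>-equivariant and lowers the degree
  by two, so the same irreducibility argument serves for g_1 and for g_3. The bound on
  \<open>m\<close> enters where a linear form whose wedge product with \<Omega> is zero has to
  vanish.\<close>

locale complex_space = vector_space scale
  for scale :: "complex \<Rightarrow> 'b::ab_group_add \<Rightarrow> 'b" (infixr \<open>*c\<close> 75)
begin

abbreviation endo :: "('b \<Rightarrow> 'b) \<Rightarrow> bool" where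
  "endo \<equiv> Vector_Spaces.linear scale scale"

lemma endoD:
  assumes "endo T"
  shows "T (x + y) = T x + T y" "T (c *c x) = c *c T x" "T 0 = 0" "T (- x) = - T x"
    "T (x - y) = T x - T y" "T (sum f A) = (\<Sum>a\<in>A. T (f a))"
proof -
  interpret Vector_Spaces.linear scale scale T by fact
  show "T (x + y) = T x + T y" "T (c *c x) = c *c T x" "T 0 = 0" "T (- x) = - T x"
    "T (x - y) = T x - T y" "T (sum f A) = (\<Sum>a\<in>A. T (f a))"
    by (fact add scale zero neg diff sum)+
qed

lemma endoI:
  assumes "\<And>x y. T (x + y) = T x + T y" "\<And>c x. T (c *c x) = c *c T x"
  shows "endo T"
  using assms by (simp add: Vector_Spaces.linear_iff vector_space_axioms)

definition shift :: "('b \<Rightarrow> 'b) \<Rightarrow> complex \<Rightarrow> 'b \<Rightarrow> 'b" where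
  "shift T a v = T v - a *c v"

lemma endo_shift: "endo T \<Longrightarrow> endo (shift T a)"
  by (intro endoI) (simp_all add: shift_def endoD algebra_simps)

lemma endo_funpow: "endo T \<Longrightarrow> endo (T ^^ n)"
  by (induction n) (auto intro!: endoI simp: endoD)

lemma shift_commute: "endo T \<Longrightarrow> shift T a (shift T b v) = shift T b (shift T a v)"
  by (simp add: shift_def endoD algebra_simps)

lemma shift_funpow_commute: "endo T \<Longrightarrow> shift T a ((shift T b ^^ n) v) = (shift T b ^^ n) (shift T a v)"
  by (induction n) (simp_all add: shift_commute[of T a b])

lemma shift_zero [simp]: "shift T 0 v = T v"
  by (simp add: shift_def)

lemma shift_in_subspace:
  assumes "subspace W" "\<And>w. w \<in> W \<Longrightarrow> T w \<in> W" "v \<in> W"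
  shows "shift T a v \<in> W"
  unfolding shift_def using assms by (simp add: subspace_diff subspace_scale)

lemma foldr_shift_in_subspace:
  assumes "subspace W" "\<And>w. w \<in> W \<Longrightarrow> T w \<in> W" "v \<in> W"
  shows "foldr (shift T) as v \<in> W"
  by (induction as) (simp_all add: assms shift_in_subspace[OF assms(1,2)])

definition poly_act :: "('b \<Rightarrow> 'b) \<Rightarrow> complex poly \<Rightarrow> 'b \<Rightarrow> 'b" where
  "poly_act T q v = (\<Sum>i\<le>degree q. coeff q i *c (T ^^ i) v)"

lemma poly_act_bound:
  "degree q \<le> n \<Longrightarrow> poly_act T q v = (\<Sum>i\<le>n. coeff q i *c (T ^^ i) v)"
  unfolding poly_act_def by (rule sum.mono_neutral_left) (auto simp: coeff_eq_0)

lemma poly_act_linear_factor: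
  assumes "endo T"
  shows "poly_act T ([:- a, 1:] * q) v = poly_act T q (shift T a v)"
proof -
  let ?n = "degree q"
  have d: "degree ([:- a, 1:] * q) \<le> Suc ?n"
    by (rule order.trans[OF degree_mult_le]) simp
  have c: "coeff ([:- a, 1:] * q) i = - a * coeff q i + coeff (pCons 0 q) i" for i
    by (simp add: mult_pCons_left)
  have 1: "(\<Sum>i\<le>Suc ?n. (- a * coeff q i) *c (T ^^ i) v)
      = (\<Sum>i\<le>?n. (- a * coeff q i) *c (T ^^ i) v)"
    by (simp add: coeff_eq_0)
  have 2: "(\<Sum>i\<le>Suc ?n. coeff (pCons 0 q) i *c (T ^^ i) v)
      = (\<Sum>i\<le>?n. coeff q i *c (T ^^ i) (T v))"
    by (simp only: sum.atMost_Suc_shift) (simp add: funpow_Suc_right del: funpow.simps)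
  have 3: "(T ^^ i) (shift T a v) = (T ^^ i) (T v) - a *c (T ^^ i) v" for i
    using endo_funpow[OF assms, of i] by (simp add: shift_def endoD)
  show ?thesis
    unfolding poly_act_bound[OF d] c scale_left_distrib sum.distrib 1 2
    by (simp add: poly_act_def 3 algebra_simps flip: sum_subtractf sum.distrib sum_negf)
qed

text \<open>Over the complex numbers a polynomial splits, so an annihilating polynomial becomes a
  list of shifts; multiplicities are not recorded because only successive application
  matters.\<close>

lemma poly_act_roots:
  assumes "endo T" "q \<noteq> 0" "poly_act T q v = 0"
  shows "\<exists>as. foldr (shift T) as v = 0"
  using assms(2,3)
proof (induction "degree q" arbitrary: q v)
  case 0
  then obtain c where "q = [:c:]" "c \<noteq> 0" by (metis degree_eq_zeroE pCons_0_0)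
  with 0 have "v = 0" by (simp add: poly_act_def)
  then show ?case by (intro exI[of _ "[]"]) simp
next
  case (Suc n)
  then have "\<not> constant (poly q)" by (simp add: constant_degree)
  then obtain a where "poly q a = 0" using fundamental_theorem_of_algebra by blast
  then obtain r where r: "q = [:- a, 1:] * r" by (metis poly_eq_0_iff_dvd dvdE)
  with Suc.prems have "r \<noteq> 0" by auto
  moreover have "n = degree r"
    using Suc.hyps(2) \<open>r \<noteq> 0\<close> unfolding r by (subst (asm) degree_mult_eq) auto
  moreover have "poly_act T r (shift T a v) = 0"
    using Suc.prems by (simp only: r poly_act_linear_factor[OF assms(1)])
  ultimately obtain as where "foldr (shift T) as (shift T a v) = 0"
    using Suc.hyps(1) by blast
  then show ?case by (intro exI[of _ "as @ [a]"]) simp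
qed

text \<open>One more iterate than \<open>card F\<close> must be linearly dependent; the relation is
  an annihilating polynomial of \<open>v\<close>.\<close>

lemma annihilating_shifts:
  assumes T: "endo T" and F: "finite F" "\<And>i. (T ^^ i) v \<in> span F"
  shows "\<exists>as. foldr (shift T) as v = 0"
proof -
  let ?f = "\<lambda>i. (T ^^ i) v" and ?I = "{..card F}"
  have "\<exists>c. (\<exists>i\<in>?I. c i \<noteq> 0) \<and> (\<Sum>i\<in>?I. c i *c ?f i) = 0"
  proof (cases "inj_on ?f ?I")
    case True
    have "dependent (?f ` ?I)"
    proof (rule ccontr)
      assume "\<not> dependent (?f ` ?I)"
      then have "card (?f ` ?I) \<le> card F"
        using independent_span_bound[OF F(1)] F(2) by blast
      then show False using True by (simp add: card_image)
    qed
    then obtain u where u: "\<exists>x\<in>?f ` ?I. u x \<noteq> 0" "(\<Sum>x\<in>?f ` ?I. u x *c x) = 0"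
      using dependent_finite[of "?f ` ?I"] by auto
    then show ?thesis
      by (intro exI[of _ "\<lambda>i. u (?f i)"]) (auto simp: sum.reindex[OF True])
  next
    \<comment> \<open>Dependence is a property of sets, so coinciding iterates are not covered by
      the first case; they give the relation with coefficients 1 and -1.\<close>
    case False
    then obtain i j where ij: "i \<in> ?I" "j \<in> ?I" "i \<noteq> j" "?f i = ?f j"
      unfolding inj_on_def by auto
    let ?c = "\<lambda>k. (if k = i then 1 else if k = j then - 1 else 0) :: complex"
    have "(\<Sum>k\<in>?I. ?c k *c ?f k) = (\<Sum>k\<in>{i, j}. ?c k *c ?f k)"
      using ij by (intro sum.mono_neutral_right) auto
    also have "\<dots> = 0" using ij by simp
    finally show ?thesis using ij by (intro exI[of _ ?c]) auto
  qed
  then obtain c k where c: "k \<in> ?I" "c k \<noteq> 0" "(\<Sum>i\<in>?I. c i *c ?f i) = 0" by blast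
  let ?q = "\<Sum>i\<in>?I. monom (c i) i"
  have co: "coeff ?q i = (if i \<in> ?I then c i else 0)" for i
    by (simp add: coeff_sum)
  have "degree ?q \<le> card F"
    by (rule degree_le) (simp add: co)
  then have "poly_act T ?q v = 0"
    using c(3) by (simp add: poly_act_bound co)
  moreover have "?q \<noteq> 0" using c(1,2) co[of k] by auto
  ultimately show ?thesis using poly_act_roots[OF T] by blast
qed

text \<open>In a list of shifts that kills \<open>v\<close>, the last nonzero vector before zero is
  reached is an eigenvector.\<close>

lemma eigenvector_exists:
  assumes T: "endo T" and W: "subspace W" "\<And>w. w \<in> W \<Longrightarrow> T w \<in> W"
    and F: "finite F" "W \<subseteq> span F" and v: "v \<in> W" "v \<noteq> 0"
  obtains w a where "w \<in> W" "w \<noteq> 0" "T w = a *c w"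
proof -
  have "(T ^^ i) v \<in> W" for i by (induction i) (simp_all add: v W)
  then obtain as where "foldr (shift T) as v = 0"
    using annihilating_shifts[OF T F(1)] F(2) by blast
  then have "\<exists>w a. w \<in> W \<and> w \<noteq> 0 \<and> shift T a w = 0"
  proof (induction as)
    case (Cons a as)
    have "foldr (shift T) as v \<in> W" by (rule foldr_shift_in_subspace) (use W v in auto)
    then show ?case using Cons by (cases "foldr (shift T) as v = 0") auto
  qed (use v in auto)
  then show thesis using that by (auto simp: shift_def)
qed

definition gen_eigen :: "('b \<Rightarrow> 'b) \<Rightarrow> complex \<Rightarrow> 'b set" where
  "gen_eigen T a = {v. \<exists>n. (shift T a ^^ n) v = 0}"

lemma shift_funpow_mono:
  assumes "endo T" "(shift T a ^^ n) v = 0" "n \<le> m"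
  shows "(shift T a ^^ m) v = 0"
proof -
  have "(shift T a ^^ (m - n)) ((shift T a ^^ n) v) = (shift T a ^^ m) v"
    using assms(3) by (simp flip: funpow_add comp_apply[of "shift T a ^^ (m - n)"])
  then show ?thesis
    using assms(2) endoD(3)[OF endo_funpow[OF endo_shift[OF assms(1)]]] by simp
qed

lemma subspace_gen_eigen: "endo T \<Longrightarrow> subspace (gen_eigen T a)"
proof (rule subspaceI)
  assume T: "endo T"
  note D = endoD[OF endo_funpow[OF endo_shift[OF T]]]
  show "0 \<in> gen_eigen T a" by (auto simp: gen_eigen_def D)
  fix x y assume "x \<in> gen_eigen T a" "y \<in> gen_eigen T a"
  then obtain n m where "(shift T a ^^ n) x = 0" "(shift T a ^^ m) y = 0"
    by (auto simp: gen_eigen_def)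
  then have "(shift T a ^^ (max n m)) (x + y) = 0"
    using shift_funpow_mono[OF T] by (simp add: D)
  then show "x + y \<in> gen_eigen T a" by (auto simp: gen_eigen_def)
next
  fix c x assume T: "endo T" and "x \<in> gen_eigen T a"
  note D = endoD[OF endo_funpow[OF endo_shift[OF T]]]
  show "c *c x \<in> gen_eigen T a" using \<open>x \<in> _\<close> by (auto simp: gen_eigen_def D)
qed

lemma shift_gen_eigen:
  assumes "endo T" "v \<in> gen_eigen T a" shows "shift T b v \<in> gen_eigen T a"
proof -
  obtain n where n: "(shift T a ^^ n) v = 0" using assms(2) by (auto simp: gen_eigen_def)
  have "(shift T a ^^ n) (shift T b v) = shift T b 0"
    by (simp only: n flip: shift_funpow_commute[OF assms(1)])
  then show ?thesis using endoD(3)[OF endo_shift[OF assms(1)]] by (auto simp: gen_eigen_def)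
qed

text \<open>\<open>T - c\<close> is invertible on the generalized eigenspace for \<open>d\<close>,
  being \<open>d - c\<close> plus a nilpotent operator. The inverse is not formed:
  \<open>shift T c w - shift T d w\<close> is \<open>(d - c) w\<close>, and
  \<open>shift T d w\<close> is handled by induction on the exponent.\<close>

lemma gen_eigen_in_subspace:
  assumes T: "endo T" and W: "subspace W" "\<And>w. w \<in> W \<Longrightarrow> T w \<in> W"
    and w: "w \<in> gen_eigen T d" "shift T c w \<in> W" "c \<noteq> d"
  shows "w \<in> W"
proof -
  obtain n where "(shift T d ^^ n) w = 0" using w(1) by (auto simp: gen_eigen_def)
  then show ?thesis using w(2)
  proof (induction n arbitrary: w)
    case 0 then show ?case by (simp add: subspace_0 W)
  next
    case (Suc n)
    have "shift T c (shift T d w) \<in> W"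
      unfolding shift_commute[OF T, of c d w] by (rule shift_in_subspace[OF W Suc.prems(2)])
    then have "shift T d w \<in> W"
      using Suc by (simp add: funpow_Suc_right del: funpow.simps)
    then have "shift T c w - shift T d w \<in> W" using Suc.prems W(1) by (simp add: subspace_diff)
    moreover have "shift T c w - shift T d w = (d - c) *c w"
      by (simp add: shift_def algebra_simps)
    ultimately have "inverse (d - c) *c (d - c) *c w \<in> W"
      using W(1) by (metis subspace_scale)
    then show ?case using w(3) by simp
  qed
qed

text \<open>A power of \<open>T - c\<close> removes the component for \<open>c\<close>. The
  induction hypothesis applies to the rest, and on the other components the shifts can be undone by
  \<open>gen_eigen_in_subspace\<close>.\<close>

lemma gen_eigen_sum_in_subspace:
  assumes T: "endo T" and W: "subspace W" "\<And>w. w \<in> W \<Longrightarrow> T w \<in> W"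
    and F: "finite F" "\<And>a. a \<in> F \<Longrightarrow> v a \<in> gen_eigen T a" "(\<Sum>a\<in>F. v a) \<in> W" "a \<in> F"
  shows "v a \<in> W"
  using F
proof (induction F arbitrary: v a)
  case (insert c F)
  obtain n where n: "(shift T c ^^ n) (v c) = 0" using insert.prems(1) by (auto simp: gen_eigen_def)
  note D = endoD[OF endo_funpow[OF endo_shift[OF T]]]
  have pow: "(shift T c ^^ k) x \<in> W" if "x \<in> W" for k x
    by (induction k) (simp_all add: that shift_in_subspace[OF W])
  have "(\<Sum>a\<in>F. (shift T c ^^ n) (v a)) = (shift T c ^^ n) (\<Sum>a\<in>insert c F. v a)"
    using insert.hyps n by (simp add: D)
  then have *: "(\<Sum>a\<in>F. (shift T c ^^ n) (v a)) \<in> W" using pow insert.prems(2) by simp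
  have ge: "(shift T c ^^ k) (v b) \<in> gen_eigen T b" if "b \<in> F" for b k
    by (induction k) (use that insert.prems(1) shift_gen_eigen[OF T] in auto)
  have F: "v b \<in> W" if b: "b \<in> F" for b
  proof -
    have "(shift T c ^^ n) (v b) \<in> W"
      using insert.IH[of "\<lambda>a. (shift T c ^^ n) (v a)" b] ge * b by simp
    then show ?thesis
    proof (induction n)
      case (Suc k)
      show ?case
        by (rule Suc.IH, rule gen_eigen_in_subspace[OF T W ge[OF b, of k], where c = c])
          (use Suc.prems b insert.hyps in auto)
    qed simp
  qed
  have "v c = (\<Sum>a\<in>insert c F. v a) - (\<Sum>a\<in>F. v a)" using insert.hyps by simp
  also have "\<dots> \<in> W" by (intro subspace_diff subspace_sum W insert.prems F)
  finally show ?case using F insert.prems(3) by auto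
qed simp

text \<open>It suffices to go back through one shift of an annihilating list: if
  \<open>(T - c) v\<close> is a sum of generalized eigenvectors, so is \<open>v\<close>.\<close>

lemma gen_eigen_span:
  assumes T: "endo T" and W: "subspace W" "\<And>w. w \<in> W \<Longrightarrow> T w \<in> W"
    and F: "finite F" "W \<subseteq> span F" and v: "v \<in> W"
  shows "v \<in> span (W \<inter> (\<Union>a. gen_eigen T a))"
proof -
  let ?G = "span (W \<inter> (\<Union>a. gen_eigen T a))"
  have step: "v \<in> ?G" if v: "v \<in> W" and s: "shift T c v \<in> ?G" for v c
  proof -
    \<comment> \<open>Modulo the image of \<open>T - c\<close> on the span, every vector is a
      generalized eigenvector for \<open>c\<close>, since \<open>T - c\<close> is onto the
      generalized eigenspaces for the other eigenvalues. Correcting \<open>v\<close> by the preimage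
      makes it one for \<open>c\<close> as well.\<close>
    let ?P = "\<lambda>x. \<exists>y\<in>?G. x - shift T c y \<in> W \<inter> gen_eigen T c"
    have prep: "?P w" if w: "w \<in> W" "w \<in> gen_eigen T d" for w d
    proof (cases "d = c")
      case True
      then show ?thesis using w endoD(3)[OF endo_shift[OF T]] by (intro bexI[of _ 0]) (auto simp: span_zero)
    next
      case False
      obtain n where "(shift T d ^^ n) w = 0" using w(2) by (auto simp: gen_eigen_def)
      then have "\<exists>y\<in>?G. shift T c y = w" using w
      proof (induction n arbitrary: w)
        case 0 then show ?case using endoD(3)[OF endo_shift[OF T]] by (intro bexI[of _ 0]) (auto simp: span_zero)
      next
        case (Suc n)
        have "\<exists>y\<in>?G. shift T c y = shift T d w"
          using Suc shift_gen_eigen[OF T] shift_in_subspace[OF W]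
          by (simp add: funpow_Suc_right del: funpow.simps)
        then obtain y where y: "y \<in> ?G" "shift T c y = shift T d w" by blast
        have eq: "shift T c (inverse (d - c) *c (w - y)) = w"
        proof -
          have "shift T c (w - y) = (d - c) *c w"
            using y(2) by (simp add: endoD[OF endo_shift[OF T]]) (simp add: shift_def algebra_simps)
          then show ?thesis using False by (simp add: endoD[OF endo_shift[OF T]])
        qed
        have "inverse (d - c) *c (w - y) \<in> ?G"
          using Suc.prems y by (intro span_scale span_diff) (auto intro: span_base)
        with eq show ?case by blast
      qed
      then obtain y where "y \<in> ?G" "shift T c y = w" by blast
      then show ?thesis using W(1) subspace_gen_eigen[OF T]
        by (intro bexI[of _ y]) (auto simp: subspace_0)
    qed
    have "?P (shift T c v)" using s
    proof (induction rule: span_induct_alt)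
      case base
      show ?case using W(1) subspace_gen_eigen[OF T] endoD(3)[OF endo_shift[OF T]]
        by (intro bexI[of _ 0]) (auto simp: subspace_0 span_zero)
    next
      case (step k x z)
      obtain y1 y2 where y: "y1 \<in> ?G" "x - shift T c y1 \<in> W \<inter> gen_eigen T c"
        "y2 \<in> ?G" "z - shift T c y2 \<in> W \<inter> gen_eigen T c"
        using step prep by blast
      have "k *c (x - shift T c y1) + (z - shift T c y2) \<in> W \<inter> gen_eigen T c"
        using y W(1) subspace_gen_eigen[OF T]
        by (intro subspace_add subspace_scale subspace_inter) auto
      then show ?case using y
        by (intro bexI[of _ "k *c y1 + y2"])
          (auto simp: endoD[OF endo_shift[OF T]] span_add span_scale algebra_simps)
    qed
    then obtain y where y: "y \<in> ?G" "shift T c v - shift T c y \<in> gen_eigen T c" by blast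
    have "shift T c (v - y) \<in> gen_eigen T c" using y(2) by (simp add: endoD[OF endo_shift[OF T]])
    then obtain n where "(shift T c ^^ n) (shift T c (v - y)) = 0" by (auto simp: gen_eigen_def)
    then have "(shift T c ^^ Suc n) (v - y) = 0" by (simp add: funpow_Suc_right del: funpow.simps)
    then have "v - y \<in> gen_eigen T c" unfolding gen_eigen_def by blast
    moreover have "?G \<subseteq> W" by (rule span_minimal) (use W in auto)
    ultimately have "v - y \<in> ?G" using v y(1) W(1)
      by (intro span_base) (auto simp: subspace_diff)
    then have "(v - y) + y \<in> ?G" using y(1) by (rule span_add)
    then show ?thesis by simp
  qed
  have "(T ^^ i) v \<in> W" for i by (induction i) (simp_all add: v W)
  then obtain as where "foldr (shift T) as v = 0"
    using annihilating_shifts[OF T F(1)] F(2) by blast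
  then have "foldr (shift T) as v \<in> ?G" by (simp add: span_zero)
  then show ?thesis
  proof (induction as)
    case (Cons a as)
    show ?case
      by (rule Cons.IH, rule step[of _ a])
        (use Cons.prems foldr_shift_in_subspace[OF W v] in auto)
  qed simp
qed

lemma gen_eigen_decomp:
  assumes T: "endo T" and G: "v \<in> span (W \<inter> (\<Union>a. gen_eigen T a))" and W: "subspace W"
  shows "\<exists>F u. finite F \<and> (\<forall>a. u a \<in> W \<inter> gen_eigen T a) \<and> v = (\<Sum>a\<in>F. u a)"
  using G
proof (induction rule: span_induct_alt)
  case base
  show ?case
    using W subspace_gen_eigen[OF T] by (intro exI[of _ "{}"] exI[of _ "\<lambda>_. 0"]) (auto simp: subspace_0)
next
  case (step c x y)
  then obtain a where a: "x \<in> W" "x \<in> gen_eigen T a" by auto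
  obtain F u where Fu: "finite F" "\<forall>a. u a \<in> W \<inter> gen_eigen T a" "y = (\<Sum>a\<in>F. u a)"
    using step by blast
  let ?u = "\<lambda>b. (if b = a then c *c x else 0) + (if b \<in> F then u b else 0)"
  have "?u b \<in> W \<inter> gen_eigen T b" for b
    using a Fu W subspace_gen_eigen[OF T]
    by (intro subspace_add subspace_inter) (auto simp: subspace_0 subspace_scale)
  moreover have "(\<Sum>b\<in>insert a F. ?u b) = c *c x + y"
    using Fu by (auto simp: sum.distrib Fu(3) sum.If_cases Int_absorb1 subset_insertI intro: sum.cong)
  ultimately show ?case using Fu(1) by (intro exI[of _ "insert a F"] exI[of _ ?u]) auto
qed

end

subsection \<open>Traces\<close>

context complex_space
begin

sublocale pair: vector_space_pair scale scale ..

lemma finite_basis: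
  assumes "finite F" "W \<subseteq> span F" "E \<subseteq> W" "W \<subseteq> span E" "subspace W"
  obtains B where "finite B" "independent B" "B \<subseteq> E" "span B = W"
proof -
  obtain B where B: "B \<subseteq> E" "independent B" "E \<subseteq> span B"
    using maximal_independent_subset[of E] by blast
  have "span B \<subseteq> W" using B(1) assms(3,5) by (intro span_minimal) auto
  moreover have "W \<subseteq> span B" using assms(4) B(3) span_minimal[OF B(3)] by auto
  moreover have "finite B"
    using independent_span_bound[OF assms(1) B(2)] B(1) assms(2,3) by blast
  ultimately show thesis using that B by blast
qed

text \<open>Jets and elements of the prolongation live in infinite-dimensional function spaces, so
  finite dimension has to be a property of a subset.\<close>

definition fin_dim :: "'b set \<Rightarrow> bool" where
  "fin_dim W \<longleftrightarrow> (\<exists>F. finite F \<and> W \<subseteq> span F)"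

lemma fin_dim_subset: "fin_dim W \<Longrightarrow> U \<subseteq> W \<Longrightarrow> fin_dim U"
  unfolding fin_dim_def by blast

lemma fin_dim_basis:
  assumes "fin_dim W" "subspace W"
  obtains B where "finite B" "independent B" "span B = W"
proof -
  obtain F where "finite F" "W \<subseteq> span F" using assms(1) unfolding fin_dim_def by blast
  from finite_basis[OF this order.refl span_superset assms(2)] show thesis using that by metis
qed

text \<open>Induction on the number of separating functionals: the kernel of one of them has
  codimension at most one in \<open>W\<close>.\<close>

lemma fin_dim_functionals:
  assumes "finite I" "subspace W"
    and "\<And>i. i \<in> I \<Longrightarrow> Vector_Spaces.linear scale (*) (\<phi> i)"
    and "\<And>w. w \<in> W \<Longrightarrow> (\<And>i. i \<in> I \<Longrightarrow> \<phi> i w = 0) \<Longrightarrow> w = 0"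
  shows "fin_dim W"
  using assms
proof (induction I arbitrary: W)
  case empty
  then have "W \<subseteq> span {}" by auto
  then show ?case unfolding fin_dim_def by blast
next
  case (insert i I)
  interpret f: Vector_Spaces.linear scale "(*)" "\<phi> i" using insert.prems by simp
  let ?K = "{w \<in> W. \<phi> i w = 0}"
  have K: "subspace ?K" using insert.prems(1)
    by (auto intro!: subspaceI simp: subspace_0 subspace_add subspace_scale f.add f.scale f.zero)
  have "fin_dim ?K"
    by (rule insert.IH[OF K]) (use insert.prems in auto)
  then obtain F where F: "finite F" "?K \<subseteq> span F" unfolding fin_dim_def by blast
  show ?case
  proof (cases "\<exists>w\<in>W. \<phi> i w \<noteq> 0")
    case True
    then obtain w where w: "w \<in> W" "\<phi> i w \<noteq> 0" by blast
    have "v \<in> span (insert w F)" if "v \<in> W" for v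
    proof -
      have "v - (\<phi> i v / \<phi> i w) *c w \<in> ?K"
        using w that insert.prems(1)
        by (auto simp: f.diff f.scale subspace_diff subspace_scale)
      then show ?thesis using F(2) by (auto simp: span_insert)
    qed
    then show ?thesis using F(1) unfolding fin_dim_def by (intro exI[of _ "insert w F"]) auto
  next
    case False
    then have "W = ?K" by auto
    then show ?thesis using F unfolding fin_dim_def by metis
  qed
qed

text \<open>The trace on \<open>span B\<close> in the basis \<open>B\<close>; for maps that preserve
  a finite-dimensional subspace of a larger space.\<close>

definition tr :: "'b set \<Rightarrow> ('b \<Rightarrow> 'b) \<Rightarrow> complex" where
  "tr B f = (\<Sum>b\<in>B. representation B (f b) b)"

lemma tr_cong: "(\<And>b. b \<in> B \<Longrightarrow> f b = g b) \<Longrightarrow> tr B f = tr B g"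
  by (simp add: tr_def)

lemma tr_add:
  assumes "independent B" "\<And>b. b \<in> B \<Longrightarrow> f b \<in> span B" "\<And>b. b \<in> B \<Longrightarrow> g b \<in> span B"
  shows "tr B (\<lambda>x. f x + g x) = tr B f + tr B g"
  using assms by (simp add: tr_def representation_add sum.distrib)

lemma tr_diff:
  assumes "independent B" "\<And>b. b \<in> B \<Longrightarrow> f b \<in> span B" "\<And>b. b \<in> B \<Longrightarrow> g b \<in> span B"
  shows "tr B (\<lambda>x. f x - g x) = tr B f - tr B g"
  using assms by (simp add: tr_def representation_diff sum_subtractf)

lemma tr_scale:
  assumes "independent B" "\<And>b. b \<in> B \<Longrightarrow> f b \<in> span B"
  shows "tr B (\<lambda>x. c *c f x) = c * tr B f"
  using assms by (simp add: tr_def representation_scale sum_distrib_left)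

lemma tr_zero [simp]: "tr B (\<lambda>x. 0) = 0"
  by (simp add: tr_def representation_zero)

lemma tr_eigen:
  assumes "independent B" "\<And>b. b \<in> B \<Longrightarrow> f b = d b *c b"
  shows "tr B f = (\<Sum>b\<in>B. d b)"
  using assms by (simp add: tr_def representation_scale span_base representation_basis)

text \<open>The two spaces may differ. This is what later moves a trace from one degree of a graded
  space to the next.\<close>

lemma tr_comm:
  assumes B: "independent B" "finite B" and C: "independent C" "finite C"
    and f: "endo f" "\<And>x. x \<in> span B \<Longrightarrow> f x \<in> span C"
    and g: "endo g" "\<And>x. x \<in> span C \<Longrightarrow> g x \<in> span B"
  shows "tr B (\<lambda>x. g (f x)) = tr C (\<lambda>x. f (g x))"
proof -
  have expand: "representation D (k x) d = (\<Sum>e\<in>E. representation E x e * representation D (k e) d)"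
    if "independent D" "independent E" "finite E" "endo k" "\<And>x. x \<in> span E \<Longrightarrow> k x \<in> span D"
      "x \<in> span E" for D E k x d
  proof -
    have "k x = k (\<Sum>e\<in>E. representation E x e *c e)"
      using sum_representation_eq[of E x E] that by simp
    also have "\<dots> = (\<Sum>e\<in>E. representation E x e *c k e)"
      using that by (simp add: endoD)
    also have "representation D \<dots> d = (\<Sum>e\<in>E. representation E x e * representation D (k e) d)"
      using that by (simp add: representation_sum representation_scale span_base span_scale)
    finally show ?thesis .
  qed
  have "tr B (\<lambda>x. g (f x)) = (\<Sum>b\<in>B. \<Sum>c\<in>C. representation C (f b) c * representation B (g c) b)"
    unfolding tr_def using B C f g by (intro sum.cong refl expand) (auto intro: span_base)
  also have "\<dots> = (\<Sum>c\<in>C. \<Sum>b\<in>B. representation B (g c) b * representation C (f b) c)"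
    by (subst sum.swap) (simp add: mult.commute)
  also have "\<dots> = tr C (\<lambda>x. f (g x))"
    unfolding tr_def using B C f g by (intro sum.cong refl expand[symmetric]) (auto intro: span_base)
  finally show ?thesis .
qed

lemma endo_id: "endo (\<lambda>x. x)"
  by (rule endoI) simp_all

lemma tr_basis_change:
  assumes "independent B" "finite B" "independent C" "finite C" "span B = span C"
    and "endo f" "\<And>x. x \<in> span B \<Longrightarrow> f x \<in> span B"
  shows "tr B f = tr C f"
proof -
  have "tr B (\<lambda>x. f x) = tr C (\<lambda>x. f x)"
    by (rule tr_comm[OF assms(1-4) endo_id _ assms(6)]) (simp_all only: assms(5)[symmetric] assms(7))
  then show ?thesis by simp
qed

text \<open>By \<open>tr_comm\<close> with the inclusion, the trace may be taken on the image of
  \<open>f\<close>, where the exponent of nilpotency is smaller by one.\<close>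

lemma tr_nilpotent:
  assumes "independent B" "finite B" "endo f" "\<And>x. x \<in> span B \<Longrightarrow> f x \<in> span B"
    and "\<And>x. x \<in> span B \<Longrightarrow> (f ^^ n) x = 0"
  shows "tr B f = 0"
  using assms
proof (induction n arbitrary: B)
  case 0
  have "b = 0" if "b \<in> B" for b using 0 span_base[OF that] by fastforce
  then have "B = {}" using 0(1) dependent_zero by auto
  then show ?case by (simp add: tr_def)
next
  case (Suc n)
  let ?W = "f ` span B"
  interpret Vector_Spaces.linear scale scale f by fact
  have W: "subspace ?W" "?W \<subseteq> span B"
    using Suc.prems(4) by (auto intro: subspace_image)
  then obtain C where C: "finite C" "independent C" "span C = ?W"
    using fin_dim_basis[of ?W] Suc.prems(2) unfolding fin_dim_def by blast
  have "tr B f = tr C f"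
    by (rule tr_comm[where f = f and g = "\<lambda>x. x"])
      (use Suc.prems C W endo_id in auto)
  also have "\<dots> = 0"
  proof (rule Suc.IH)
    fix x assume "x \<in> span C"
    then obtain y where y: "x = f y" "y \<in> span B" unfolding C(3) by blast
    then have "(f ^^ Suc n) y = 0" using Suc.prems(5) by blast
    then show "(f ^^ n) x = 0" by (simp only: y funpow_Suc_right comp_apply)
  next
    fix x assume "x \<in> span C"
    then show "f x \<in> span C" unfolding C(3) using W(2) by blast
  qed (use C Suc.prems in auto)
  finally show ?case .
qed

lemma injective_on_span:
  assumes "finite B" "independent B" "finite C" "endo f" "\<And>x. x \<in> span B \<Longrightarrow> f x \<in> span C"
    and "\<And>x. x \<in> span B \<Longrightarrow> f x = 0 \<Longrightarrow> x = 0"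
  shows "card B \<le> card C" "card B = card C \<Longrightarrow> y \<in> span C \<Longrightarrow> \<exists>x\<in>span B. f x = y"
proof -
  interpret Vector_Spaces.linear scale scale f by fact
  have inj: "inj_on f (span B)"
  proof (rule inj_onI)
    fix x y assume "x \<in> span B" "y \<in> span B" "f x = f y"
    then have "x - y = 0" using assms(6)[of "x - y"] by (simp add: diff span_diff)
    then show "x = y" by simp
  qed
  have ind: "independent (f ` B)" using assms(2) inj by (rule independent_injective_image)
  have sub: "f ` B \<subseteq> span C" using assms(5) span_base by blast
  have cB: "card (f ` B) = card B"
    by (rule card_image[OF inj_on_subset[OF inj span_superset]])
  show "card B \<le> card C" using independent_span_bound[OF assms(3) ind sub] cB by simp
  show "\<exists>x\<in>span B. f x = y" if eq: "card B = card C" and y: "y \<in> span C"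
  proof -
    have "y \<in> span (f ` B)"
    proof (rule ccontr)
      assume n: "y \<notin> span (f ` B)"
      then have "independent (insert y (f ` B))" using ind by (rule independent_insertI)
      then have "card (insert y (f ` B)) \<le> card C"
        using independent_span_bound[OF assms(3)] sub y by blast
      moreover have "y \<notin> f ` B" using n span_base by blast
      ultimately show False using cB eq assms(1) by simp
    qed
    then show ?thesis unfolding span_image by blast
  qed
qed

text \<open>The endomorphism \<open>?f\<close> records the values of \<open>b x\<close> on a basis
  as coordinates. Nondegeneracy makes it injective, hence onto by counting dimensions.\<close>

lemma nondegenerate_functional:
  assumes D: "subspace D" "fin_dim D"
    and l: "\<And>x y. x \<in> D \<Longrightarrow> y \<in> D \<Longrightarrow> l (x + y) = l x + l y"
      "\<And>c x. x \<in> D \<Longrightarrow> l (c *c x) = c * l x"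
    and b: "\<And>x y z. b (x + y) z = b x z + b y z" "\<And>c x z. b (c *c x) z = c * b x z"
      "\<And>x y z. b z (x + y) = b z x + b z y" "\<And>c x z. b z (c *c x) = c * b z x"
    and nd: "\<And>x. x \<in> D \<Longrightarrow> (\<And>y. y \<in> D \<Longrightarrow> b x y = 0) \<Longrightarrow> x = 0"
  shows "\<exists>s\<in>D. \<forall>y\<in>D. b s y = (l y :: complex)"
proof -
  obtain B where B: "finite B" "independent B" "span B = D" using fin_dim_basis D by blast
  let ?f = "\<lambda>x. \<Sum>y\<in>B. b x y *c y"
  have f: "endo ?f"
    by (rule endoI) (simp_all add: b scale_left_distrib sum.distrib scale_sum_right)
  have b0: "b x 0 = 0" for x using b(4)[of x 0 0] by simp
  have l0: "l 0 = 0" using l(2)[of 0 0] subspace_0[OF D(1)] by simp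
  have eq: "\<forall>y\<in>D. b s y = m y"
    if s: "\<forall>y\<in>B. b s y = m y" and "m 0 = 0" "\<And>x y. x \<in> D \<Longrightarrow> y \<in> D \<Longrightarrow> m (x + y) = m x + m y"
      "\<And>c x. x \<in> D \<Longrightarrow> m (c *c x) = c * m x" for s and m :: "'b \<Rightarrow> complex"
  proof
    fix y assume "y \<in> D"
    then have "y \<in> span B" by (simp add: B)
    then have "y \<in> D \<and> b s y = m y"
    proof (induction rule: span_induct_alt)
      case base show ?case using that b0 D by (simp add: subspace_0)
    next
      case (step c x y)
      then have "x \<in> D" using B(3) span_base by blast
      then show ?case using step that D(1) by (simp add: b subspace_add subspace_scale)
    qed
    then show "b s y = m y" by simp
  qed
  have coords: "\<forall>y\<in>B. p y = q y" if "(\<Sum>y\<in>B. p y *c y) = (\<Sum>y\<in>B. q y *c y)" for p q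
  proof -
    have "(\<Sum>y\<in>B. (p y - q y) *c y) = 0"
      using that by (simp add: scale_left_diff_distrib sum_subtractf)
    then show ?thesis using independentD[OF B(2,1) order.refl, of "\<lambda>y. p y - q y"] by auto
  qed
  have "\<exists>s\<in>span B. ?f s = (\<Sum>y\<in>B. l y *c y)"
  proof (rule injective_on_span(2)[OF B(1,2,1) f])
    show "?f x \<in> span B" "(\<Sum>y\<in>B. l y *c y) \<in> span B" for x
      by (intro span_sum span_scale span_base; simp)+
    show "card B = card B" ..
    fix x assume x: "x \<in> span B" "?f x = 0"
    then have "\<forall>y\<in>B. b x y = 0" using coords[of "b x" "\<lambda>_. 0"] by simp
    then have "\<forall>y\<in>D. b x y = 0" using eq[of x "\<lambda>_. 0"] by simp
    then show "x = 0" using nd x(1) B(3) by blast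
  qed
  then obtain s where s: "s \<in> D" "?f s = (\<Sum>y\<in>B. l y *c y)" unfolding B by blast
  then have "\<forall>y\<in>B. b s y = l y" using coords by blast
  then show ?thesis using s(1) eq[of s l] l l0 by blast
qed

text \<open>The operator \<open>S f\<close> multiplies the generalized eigenspace for \<open>a\<close> by \<open>f a\<close>; \<open>S id\<close> is the
  semisimple part of \<open>T\<close>.\<close>

lemma spectral_functions:
  assumes T: "endo T" and F: "finite F" "span F = UNIV"
  obtains B lab S where "finite B" "independent B" "span B = UNIV"
    "\<And>b. b \<in> B \<Longrightarrow> b \<in> gen_eigen T (lab b)" "\<And>f. endo (S f)"
    "\<And>f a v. v \<in> gen_eigen T a \<Longrightarrow> S f v = f a *c v"
proof -
  let ?E = "\<Union>a. gen_eigen T a"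
  have "UNIV \<subseteq> span ?E"
    using gen_eigen_span[OF T, of UNIV F] F by (auto simp: subspace_UNIV)
  then obtain B where B: "finite B" "independent B" "B \<subseteq> ?E" "span B = UNIV"
    using finite_basis[of F UNIV ?E] F by (auto simp: subspace_UNIV)
  then obtain lab where lab: "\<And>b. b \<in> B \<Longrightarrow> b \<in> gen_eigen T (lab b)" by (metis UN_iff subsetD)
  have "\<forall>f. \<exists>g. endo g \<and> (\<forall>b\<in>B. g b = f (lab b) *c b)"
    by (intro allI pair.linear_independent_extend[OF B(2)])
  then obtain S where S: "\<And>f. endo (S f)" "\<And>f b. b \<in> B \<Longrightarrow> S f b = f (lab b) *c b" by metis
  have "S f v = f a *c v" if v: "v \<in> gen_eigen T a" for f a v
  proof -
    let ?r = "representation B v"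
    let ?u = "\<lambda>c. \<Sum>b\<in>{b\<in>B. lab b = c}. ?r b *c b"
    let ?L = "insert a (lab ` B)"
    have "v = (\<Sum>b\<in>B. ?r b *c b)" using sum_representation_eq[of B v B] B by simp
    also have "\<dots> = (\<Sum>c\<in>?L. ?u c)"
      using B(1) by (intro sum.group[symmetric]) auto
    finally have v_sum: "v = (\<Sum>c\<in>?L. ?u c)" .
    have u: "?u c \<in> gen_eigen T c" for c
      using subspace_gen_eigen[OF T] lab by (auto intro!: subspace_sum subspace_scale)
    \<comment> \<open>Subtracting \<open>v\<close> at the single index \<open>a\<close> makes the
      components sum to zero. The zero subspace is invariant, so each of them lies in it.\<close>
    let ?w = "\<lambda>c. ?u c - (if c = a then v else 0)"
    have w: "?w c \<in> gen_eigen T c" for c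
      using u v subspace_gen_eigen[OF T] by (auto intro: subspace_diff)
    have "(\<Sum>c\<in>?L. ?w c) = 0" unfolding sum_subtractf v_sum[symmetric] using B(1) by simp
    then have "?w c \<in> {0}" if "c \<in> ?L" for c
      using gen_eigen_sum_in_subspace[OF T _ _ _ w, of "{0}" ?L c] that B(1) endoD(3)[OF T]
      by (auto simp: subspace_single_0)
    from this[of a] have "?u a = v" by simp
    moreover have "S f (?u a) = f a *c ?u a"
      unfolding endoD(6)[OF S(1)] scale_sum_right
      by (rule sum.cong) (auto simp: S endoD[OF S(1)] mult.commute)
    ultimately show ?thesis by simp
  qed
  then show thesis using that[of B lab S] B(1,2,4) lab S(1) by blast
qed

end

section \<open>Matrices, commutators and the trace form\<close>

interpretation vs: complex_space "(*s) :: complex \<Rightarrow> complex^'n \<Rightarrow> complex^'n"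
  by (simp add: complex_space_def vec.vector_space_axioms)

interpretation gl: complex_space "mat_scale :: complex \<Rightarrow> complex^'n^'n \<Rightarrow> complex^'n^'n"
  by (simp add: complex_space_def mat_scale_vector_space)

lemma mat_scale_vec [simp]: "mat_scale c A *v x = c *s (A *v x)"
  by (simp add: vec_eq_iff mat_scale_def matrix_vector_mult_def sum_distrib_left mult.assoc)

lemma matrix_vec_scale: "A *v (c *s x) = c *s (A *v x)" for A :: "complex^'n^'n"
  by (simp add: vector_scalar_commute)

lemma commutator_vec: "commutator A B *v x = A *v (B *v x) - B *v (A *v x)"
  by (simp add: commutator_def matrix_vector_mult_diff_rdistrib matrix_vector_mul_assoc)

lemmas mat_vec_simps = commutator_vec matrix_vector_mult_add_rdistrib matrix_vector_mult_diff_rdistrib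
  matrix_vector_right_distrib matrix_vector_mult_diff_distrib matrix_vec_scale

lemma commutator_linear:
  "commutator A (X + Y) = commutator A X + commutator A Y"
  "commutator (X + Y) A = commutator X A + commutator Y A"
  "commutator A (mat_scale c X) = mat_scale c (commutator A X)"
  "commutator (mat_scale c X) A = mat_scale c (commutator X A)"
  "commutator A (X - Y) = commutator A X - commutator A Y"
  "commutator (X - Y) A = commutator X A - commutator Y A"
  "commutator A 0 = 0" "commutator 0 A = 0"
  by (simp_all add: matrix_eq mat_vec_simps algebra_simps vector_sub_rdistrib vec.scale_right_diff_distrib
      vec.scale_right_distrib)

lemma commutator_swap: "commutator A B = - commutator B A"
  by (simp add: commutator_def)

lemma commutator_self [simp]: "commutator A A = 0"
  by (simp add: commutator_def)

lemma commutator_jacobi: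
  "commutator A (commutator B C) = commutator (commutator A B) C + commutator B (commutator A C)"
  by (simp add: matrix_eq mat_vec_simps algebra_simps)

lemma endo_commutator: "gl.endo (commutator A)"
  by (rule gl.endoI) (simp_all add: commutator_linear)

lemma endo_matrix: "vs.endo ((*v) A)" for A :: "complex^'n^'n"
  by (rule vs.endoI) (simp_all add: mat_vec_simps)

lemma matrix_of_endo: "vs.endo f \<Longrightarrow> matrix f *v x = f x" for f :: "complex^'n \<Rightarrow> complex^'n"
  by (rule matrix_works)

lemma gl_fin_dim: "gl.fin_dim (W :: (complex^'n^'n) set)"
proof -
  have "gl.fin_dim (UNIV :: (complex^'n^'n) set)"
    by (rule gl.fin_dim_functionals[of "UNIV :: ('n \<times> 'n) set" _ "\<lambda>(i, j) A. A $ i $ j"])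
      (auto simp: gl.subspace_UNIV vec_eq_iff Vector_Spaces.linear_iff mat_scale_def gl.vector_space_axioms
        vector_space_over_itself.vector_space_axioms)
  then show ?thesis by (rule gl.fin_dim_subset) simp
qed

text \<open>Any basis will do: it provides \<open>gl.dim\<close>, by which the theorem of Engel is
  proved inductively.\<close>

definition mat_basis :: "(complex^'n^'n) set" where
  "mat_basis = (SOME B. finite B \<and> gl.independent B \<and> gl.span B = UNIV)"

interpretation gl: finite_dimensional_vector_space
  "mat_scale :: complex \<Rightarrow> complex^'n^'n \<Rightarrow> complex^'n^'n" mat_basis
proof -
  have "\<exists>B. finite B \<and> gl.independent B \<and> gl.span B = (UNIV :: (complex^'n^'n) set)"
    using gl.fin_dim_basis[OF gl_fin_dim gl.subspace_UNIV] by metis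
  then have "finite (mat_basis :: (complex^'n^'n) set) \<and> gl.independent (mat_basis :: (complex^'n^'n) set)
      \<and> gl.span mat_basis = (UNIV :: (complex^'n^'n) set)"
    unfolding mat_basis_def by (rule someI_ex)
  then show "finite_dimensional_vector_space (mat_scale :: complex \<Rightarrow> complex^'n^'n \<Rightarrow> _) mat_basis"
    by unfold_locales auto
qed

lemma trace_mat_scale: "trace (mat_scale c A) = c * trace A"
  by (simp add: trace_def mat_scale_def sum_distrib_left)

lemma mat_scale_mult: "mat_scale c A ** B = mat_scale c (A ** B)" "A ** mat_scale c B = mat_scale c (A ** B)"
  by (simp_all add: matrix_eq matrix_vec_scale flip: matrix_vector_mul_assoc)

lemma matrix_mult_distrib:
  "(A + B) ** C = A ** C + B ** C" "C ** (A + B) = C ** A + C ** B"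
  "(A - B) ** C = A ** C - B ** C" "C ** (A - B) = C ** A - C ** B" for A :: "complex^'n^'n"
  by (simp_all add: matrix_eq mat_vec_simps flip: matrix_vector_mul_assoc)

lemma trace_commutator: "trace (commutator A B ** C) = trace (A ** commutator B C)"
  for A :: "complex^'n^'n"
proof -
  have "trace (B ** A ** C) = trace (A ** (C ** B))"
    using trace_mul_sym[of B "A ** C"] by (simp add: matrix_mul_assoc)
  then show ?thesis
    by (simp add: commutator_def matrix_mult_distrib trace_sub matrix_mul_assoc)
qed

text \<open>Passes from the sum of diagonal entries to a basis of generalized eigenvectors.\<close>

lemma trace_eq_tr:
  assumes "vec.independent B" "finite B" "vec.span B = (UNIV :: (complex^'n) set)"
  shows "trace A = vs.tr B ((*v) A)"
proof -
  have rep: "vec.representation cart_basis v = (\<lambda>b. if b \<in> cart_basis then v $ (THE i. b = axis i 1) else 0)"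
    for v :: "complex^'n"
  proof (rule vec.representation_eqI[OF independent_cart_basis])
    let ?f = "\<lambda>b. if b \<in> cart_basis then v $ (THE i. b = axis i 1) else 0"
    have sub: "{b. ?f b \<noteq> 0} \<subseteq> cart_basis" by auto
    then show "finite {b. ?f b \<noteq> 0}" using finite_cart_basis finite_subset by blast
    have inj: "inj (\<lambda>i::'n. axis i (1::complex))" by (auto intro!: injI simp: axis_eq_axis)
    have the: "(THE j. axis i 1 = axis j (1::complex)) = i" for i :: 'n by (auto simp: axis_eq_axis)
    have "(\<Sum>b | ?f b \<noteq> 0. ?f b *s b) = (\<Sum>b\<in>cart_basis. ?f b *s b)"
      using sub finite_cart_basis by (intro sum.mono_neutral_left) auto
    also have "\<dots> = (\<Sum>b\<in>range (\<lambda>i::'n. axis i 1). ?f b *s b)"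
      by (simp add: cart_basis_def full_SetCompr_eq)
    also have "\<dots> = (\<Sum>i\<in>UNIV. v $ i *s axis i 1)"
      unfolding sum.reindex[OF inj] by (intro sum.cong) (auto simp: the cart_basis_def)
    also have "\<dots> = v" by (rule basis_expansion)
    finally show "(\<Sum>b | ?f b \<noteq> 0. ?f b *s b) = v" .
  qed (auto split: if_splits)
  have inj: "inj (\<lambda>i::'n. axis i (1::complex))" by (auto intro!: injI simp: axis_eq_axis)
  have the: "(THE j. axis i 1 = axis j (1::complex)) = i" for i :: 'n by (auto simp: axis_eq_axis)
  have "vs.tr cart_basis ((*v) A) = (\<Sum>b\<in>range (\<lambda>i::'n. axis i 1). (A *v b) $ (THE i. b = axis i 1))"
    unfolding vs.tr_def rep by (auto simp: cart_basis_def full_SetCompr_eq intro!: sum.cong)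
  also have "\<dots> = (\<Sum>i\<in>UNIV. (A *v axis i 1) $ i)"
    unfolding sum.reindex[OF inj] by (intro sum.cong) (auto simp: the)
  also have "\<dots> = trace A"
    by (simp add: trace_def matrix_vector_mult_def axis_def if_distrib cong: if_cong)
  finally have "trace A = vs.tr cart_basis ((*v) A)" ..
  also have "\<dots> = vs.tr B ((*v) A)"
    by (rule vs.tr_basis_change)
      (use assms in \<open>auto simp: independent_cart_basis finite_cart_basis endo_matrix\<close>)
  finally show ?thesis .
qed

subsection \<open>Functions of the eigenvalues of a matrix\<close>

abbreviation eigen :: "complex^'n^'n \<Rightarrow> complex \<Rightarrow> (complex^'n) set" where
  "eigen A \<equiv> vs.gen_eigen ((*v) A)"

text \<open>Leibniz rule: \<open>A - (b + c)\<close> applied to \<open>X v\<close> is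
  \<open>((ad A - c) X) v + X ((A - b) v)\<close>, so the exponents \<open>n\<close> and
  \<open>m\<close> add up.\<close>

lemma ad_eigen_maps_eigen:
  assumes "X \<in> gl.gen_eigen (commutator A) c" "v \<in> eigen A b"
  shows "X *v v \<in> eigen A (b + c)"
proof -
  have "(vs.shift ((*v) A) (b + c) ^^ k) (X *v v) = 0"
    if "(gl.shift (commutator A) c ^^ n) X = 0" "(vs.shift ((*v) A) b ^^ m) v = 0" "k = n + m" for n m k X v
    using that
  proof (induction k arbitrary: n m X v)
    case 0
    then show ?case by simp
  next
    case (Suc k)
    note D = vs.endoD[OF vs.endo_funpow[OF vs.endo_shift[OF endo_matrix]]]
    have eq: "vs.shift ((*v) A) (b + c) (X *v v)
        = gl.shift (commutator A) c X *v v + X *v vs.shift ((*v) A) b v"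
      by (simp add: vs.shift_def gl.shift_def mat_vec_simps algebra_simps)
    have 1: "(vs.shift ((*v) A) (b + c) ^^ k) (gl.shift (commutator A) c X *v v) = 0"
    proof (cases n)
      case 0
      then show ?thesis using Suc.prems
        by (simp add: gl.shift_def commutator_linear D)
    next
      case (Suc n')
      then show ?thesis using Suc.IH[of n' _ m v] Suc.prems
        by (simp add: funpow_Suc_right del: funpow.simps)
    qed
    have 2: "(vs.shift ((*v) A) (b + c) ^^ k) (X *v vs.shift ((*v) A) b v) = 0"
    proof (cases m)
      case 0
      then show ?thesis using Suc.prems
        by (simp add: vs.shift_def D)
    next
      case (Suc m')
      then show ?thesis using Suc.IH[of n X m'] Suc.prems
        by (simp add: funpow_Suc_right del: funpow.simps)
    qed
    show ?case by (simp add: funpow_Suc_right eq D 1 2 del: funpow.simps)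
  qed
  then show ?thesis using assms unfolding vs.gen_eigen_def gl.gen_eigen_def by blast
qed

lemma eigen_span: "v \<in> vec.span (\<Union>a. eigen A a)"
  using vs.gen_eigen_span[OF endo_matrix, where W = UNIV and F = cart_basis and v = v and A1 = A]
  by (simp add: finite_cart_basis vec.subspace_UNIV)

lemma ad_eigen_decomp:
  "\<exists>F X'. finite F \<and> (\<forall>c. X' c \<in> gl.gen_eigen (commutator A) c) \<and> X = (\<Sum>c\<in>F. X' c)"
proof -
  have "X \<in> gl.span (UNIV \<inter> (\<Union>c. gl.gen_eigen (commutator A) c))"
    by (rule gl.gen_eigen_span[OF endo_commutator _ _ gl.finite_Basis])
      (auto simp: gl.subspace_UNIV gl.span_Basis)
  from gl.gen_eigen_decomp[OF endo_commutator this gl.subspace_UNIV] show ?thesis by auto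
qed

lemma matrix_eqI_on_eigen:
  fixes X Y :: "complex^'n^'n"
  assumes "\<And>v b. v \<in> eigen A b \<Longrightarrow> X *v v = Y *v v"
  shows "X = Y"
proof -
  have "X *v v = Y *v v" for v
    using eigen_span[of v A]
  proof (induction rule: vec.span_induct_alt)
    case (step c x y)
    then show ?case using assms by (auto simp: mat_vec_simps)
  qed simp
  then show ?thesis by (simp add: matrix_eq)
qed

text \<open>Additivity without complex linearity admits complex conjugation and the real and
  imaginary parts as functions of the eigenvalues.\<close>

definition additive :: "(complex \<Rightarrow> complex) \<Rightarrow> bool" where
  "additive f \<longleftrightarrow> (\<forall>x y. f (x + y) = f x + f y)"

definition nilp :: "complex^'n^'n \<Rightarrow> bool" where
  "nilp A \<longleftrightarrow> (\<forall>v. v \<in> eigen A 0)"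

lemma nilpE:
  assumes "nilp A" obtains n where "\<And>v. ((*v) A ^^ n) v = 0"
proof -
  have z: "vs.shift ((*v) A) 0 = (*v) A" by (rule ext) simp
  have "\<forall>v. \<exists>n. ((*v) A ^^ n) v = 0"
    using assms unfolding nilp_def vs.gen_eigen_def z by blast
  then obtain n where n: "\<And>v. ((*v) A ^^ n v) v = 0" by metis
  define N where "N = Max (n ` cart_basis)"
  have N: "((*v) A ^^ N) v = 0" if "v \<in> cart_basis" for v
  proof -
    have "n v \<le> N" unfolding N_def by (rule Max_ge) (use that finite_cart_basis in auto)
    then show ?thesis
      using vs.shift_funpow_mono[OF endo_matrix, where A1 = A and a = 0 and n = "n v" and v = v and m = N]
        n[of v] unfolding z by blast
  qed
  have "((*v) A ^^ N) v = 0" if "v \<in> vec.span cart_basis" for v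
    using that
  proof (induction rule: vec.span_induct_alt)
    case base show ?case by (simp add: vs.endoD[OF vs.endo_funpow[OF endo_matrix]])
  next
    case (step c x y) then show ?case by (simp add: N vs.endoD[OF vs.endo_funpow[OF endo_matrix]])
  qed
  then show thesis using that[of N] by simp
qed

lemma trace_nilp:
  assumes "nilp A" shows "trace A = 0"
proof -
  obtain n where "\<And>v. ((*v) A ^^ n) v = 0" using nilpE assms by blast
  then have "vs.tr cart_basis ((*v) A) = 0"
    by (intro vs.tr_nilpotent[of _ _ n]) (auto simp: independent_cart_basis finite_cart_basis endo_matrix)
  then show ?thesis
    using trace_eq_tr[OF independent_cart_basis finite_cart_basis, of A] by simp
qed

text \<open>Stands in for the statement that \<open>ad S\<close> is a polynomial in
  \<open>ad A\<close> without constant term, expressed by its effect on invariant subspaces so that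
  no interpolation polynomial is required.\<close>

definition ad_dominates :: "complex^'n^'n \<Rightarrow> complex^'n^'n \<Rightarrow> bool" where
  "ad_dominates A S \<longleftrightarrow> (\<forall>W X. gl.subspace W \<longrightarrow> (\<forall>Y\<in>W. commutator A Y \<in> W) \<longrightarrow>
     commutator A X \<in> W \<longrightarrow> commutator S X \<in> W)"

text \<open>For additive \<open>f\<close>, \<open>ad (S f)\<close> multiplies the generalized
  eigenspace of \<open>ad A\<close> for \<open>c\<close> by \<open>f c\<close>, since
  \<open>S f\<close> has the value \<open>f (b + c) = f b + f c\<close> on the image of the space
  for \<open>b\<close>. As \<open>f 0 = 0\<close>, the part of \<open>X\<close> on which
  \<open>ad A\<close> is nilpotent contributes nothing.\<close>

lemma spectral_matrix:
  fixes A :: "complex^'n^'n"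
  obtains B lab S where "finite B" "vec.independent B" "vec.span B = UNIV"
    "\<And>b. b \<in> B \<Longrightarrow> b \<in> eigen A (lab b)"
    "\<And>f a v. v \<in> eigen A a \<Longrightarrow> S f *v v = f a *s v"
    "\<And>f. trace (S f) = (\<Sum>b\<in>B. f (lab b))"
    "\<And>f. trace (S f ** A) = (\<Sum>b\<in>B. f (lab b) * lab b)"
    "\<And>f. additive f \<Longrightarrow> ad_dominates A (S f)"
proof -
  obtain B lab S' where B: "finite B" "vec.independent B" "vec.span B = UNIV"
    and lab: "\<And>b. b \<in> B \<Longrightarrow> b \<in> eigen A (lab b)" and S': "\<And>f. vs.endo (S' f)"
    "\<And>f a v. v \<in> eigen A a \<Longrightarrow> S' f v = f a *s v"
    by (rule vs.spectral_functions[OF endo_matrix finite_cart_basis span_cart_basis, of A]) (rule that)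
  define S where "S f = matrix (S' f)" for f
  have S: "S f *v v = f a *s v" if "v \<in> eigen A a" for f a v
    using that S'(2) by (simp add: S_def matrix_of_endo[OF S'(1)])
  have diag: "trace (S f) = (\<Sum>b\<in>B. f (lab b))" for f
    unfolding trace_eq_tr[OF B(2,1,3)] by (rule vs.tr_eigen[OF B(2)]) (use S lab in auto)
  have tr: "trace (S f ** A) = (\<Sum>b\<in>B. f (lab b) * lab b)" for f
  proof -
    \<comment> \<open>The nilpotent part of \<open>A\<close>. The product \<open>S f ** N\<close> is
      nilpotent too, because \<open>S f\<close> is a scalar on each generalized eigenspace and
      \<open>N\<close> preserves it; hence \<open>A\<close> may be replaced by its semisimple part
      under the trace.\<close>
    define N where "N = A - S (\<lambda>a. a)"
    have N: "N *v v = vs.shift ((*v) A) a v" if "v \<in> eigen A a" for v a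
      using S[OF that] by (simp add: N_def vs.shift_def mat_vec_simps)
    have sh: "vs.shift ((*v) A) a v \<in> eigen A a" if "v \<in> eigen A a" for v a
      by (rule vs.shift_gen_eigen[OF endo_matrix that])
    have pow: "((*v) (S f ** N) ^^ k) v = f a ^ k *s (vs.shift ((*v) A) a ^^ k) v
        \<and> (vs.shift ((*v) A) a ^^ k) v \<in> eigen A a" if "v \<in> eigen A a" for v a k
      by (induction k) (use that sh in \<open>auto simp: N S[OF sh] matrix_vec_scale simp flip: matrix_vector_mul_assoc\<close>)
    have "v \<in> eigen (S f ** N) 0" for v
    proof -
      have z: "vs.shift ((*v) (S f ** N)) 0 = (*v) (S f ** N)" by (rule ext) simp
      have "x \<in> eigen (S f ** N) 0" if x: "x \<in> eigen A a" for x a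
      proof -
        obtain n where "(vs.shift ((*v) A) a ^^ n) x = 0"
          using x by (auto simp: vs.gen_eigen_def)
        then have "((*v) (S f ** N) ^^ n) x = 0" using pow[OF x, of n] by simp
        then show ?thesis by (auto simp: vs.gen_eigen_def z)
      qed
      then have "vec.span (\<Union>a. eigen A a) \<subseteq> eigen (S f ** N) 0"
        by (intro vec.span_minimal vs.subspace_gen_eigen endo_matrix) auto
      then show ?thesis using eigen_span by blast
    qed
    then have "trace (S f ** N) = 0" by (intro trace_nilp) (simp add: nilp_def)
    then have "trace (S f ** A) = trace (S f ** S (\<lambda>a. a))"
      by (simp add: N_def matrix_mult_distrib trace_sub)
    also have "\<dots> = (\<Sum>b\<in>B. f (lab b) * lab b)"
      unfolding trace_eq_tr[OF B(2,1,3)]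
      by (rule vs.tr_eigen[OF B(2)])
        (simp add: S[OF lab] matrix_vec_scale mult.commute flip: matrix_vector_mul_assoc)
    finally show ?thesis .
  qed
  have ad: "commutator (S f) X \<in> W" if f: "additive f" and W: "gl.subspace W"
    "\<And>Y. Y \<in> W \<Longrightarrow> commutator A Y \<in> W" and X: "commutator A X \<in> W" for f W X
  proof -
    have f0: "f 0 = 0" using f[unfolded additive_def, rule_format, of 0 0] by simp
    obtain F X' where F: "finite F" "\<And>c. X' c \<in> gl.gen_eigen (commutator A) c" "X = (\<Sum>c\<in>F. X' c)"
      using ad_eigen_decomp[of A X] by blast
    have adX: "commutator A (X' c) \<in> gl.gen_eigen (commutator A) c" for c
      using gl.shift_gen_eigen[OF endo_commutator F(2), of 0 c] by simp
    have "(\<Sum>c\<in>F. commutator A (X' c)) \<in> W"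
      using X by (simp add: F(3) gl.endoD[OF endo_commutator])
    then have "commutator A (X' c) \<in> W" if "c \<in> F" for c
      using gl.gen_eigen_sum_in_subspace[OF endo_commutator W F(1) adX] that by blast
    \<comment> \<open>\<open>ad A\<close> is invertible on the generalized eigenspace for
      \<open>c\<close>, so the component itself lies in \<open>W\<close> once its bracket with
      \<open>A\<close> does.\<close>
    then have XW: "X' c \<in> W" if "c \<in> F" "c \<noteq> 0" for c
      using gl.gen_eigen_in_subspace[OF endo_commutator W F(2), of 0 c] that by simp
    have "commutator (S f) (X' c) = mat_scale (f c) (X' c)" for c
    proof (rule matrix_eqI_on_eigen[of A])
      fix v b assume v: "v \<in> eigen A b"
      have "X' c *v v \<in> eigen A (b + c)" by (rule ad_eigen_maps_eigen[OF F(2) v])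
      then show "commutator (S f) (X' c) *v v = mat_scale (f c) (X' c) *v v"
        using f S v by (simp add: commutator_vec matrix_vec_scale additive_def vec.scale_left_distrib)
    qed
    then have "commutator (S f) X = (\<Sum>c\<in>F. mat_scale (f c) (X' c))"
      by (simp add: F(3) gl.endoD[OF endo_commutator])
    also have "\<dots> \<in> W"
    proof (rule gl.subspace_sum[OF W(1)])
      fix c assume "c \<in> F"
      then show "mat_scale (f c) (X' c) \<in> W"
        using XW W(1) f0 by (cases "c = 0") (auto simp: gl.subspace_0 gl.subspace_scale)
    qed
    finally show ?thesis .
  qed
  show thesis by (rule that[OF B lab S diag tr]) (auto simp: ad_dominates_def intro: ad)
qed

subsection \<open>The theorem of Engel\<close>

text \<open>A component of \<open>X\<close> for a nonzero eigenvalue \<open>c\<close> of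
  \<open>ad A\<close> would map the generalized kernel of \<open>A\<close>, which is everything,
  into the generalized eigenspace for \<open>c\<close>, which is zero.\<close>

lemma ad_nilpotent:
  assumes "nilp A" shows "\<exists>n. (commutator A ^^ n) X = 0"
proof -
  obtain F X' where F: "finite F" "\<And>c. X' c \<in> gl.gen_eigen (commutator A) c" "X = (\<Sum>c\<in>F. X' c)"
    using ad_eigen_decomp[of A X] by blast
  have "X' c = 0" if c: "c \<noteq> 0" for c
  proof -
    have "X' c *v v = 0" for v
    proof -
      have "X' c *v v \<in> eigen A c"
        using ad_eigen_maps_eigen[OF F(2), of v 0 c] assms by (simp add: nilp_def)
      moreover obtain n where "((*v) A ^^ n) (X' c *v v) = 0" using nilpE[OF assms] by metis
      moreover have "vs.shift ((*v) A) 0 = (*v) A" by (rule ext) simp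
      ultimately have "(vs.shift ((*v) A) 0 ^^ n) (X' c *v v) = 0" "X' c *v v \<in> eigen A c" by simp_all
      then show ?thesis
      proof (induction n arbitrary: v)
        case (Suc n)
        have "w \<in> {0}" if "w \<in> eigen A c" "A *v w \<in> {0}" for w
          using vs.gen_eigen_in_subspace[OF endo_matrix vec.subspace_single_0 _ that(1), of 0] c that(2)
          by simp
        moreover have "((vs.shift ((*v) A) 0) ^^ n) w = 0 \<longrightarrow> w \<in> eigen A c \<longrightarrow> w = 0" for w n
        proof (induction n arbitrary: w)
          case (Suc n)
          show ?case
          proof (intro impI)
            assume w: "(vs.shift ((*v) A) 0 ^^ Suc n) w = 0" "w \<in> eigen A c"
            have "vs.shift ((*v) A) 0 w = 0"
              using Suc[of "vs.shift ((*v) A) 0 w"] w vs.shift_gen_eigen[OF endo_matrix w(2), of 0]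
              by (simp add: funpow_Suc_right del: funpow.simps vs.shift_zero)
            then show "w = 0" using calculation[of w] w(2) by simp
          qed
        qed simp
        ultimately show ?case using Suc.prems by blast
      qed simp
    qed
    then show ?thesis by (simp add: matrix_eq)
  qed
  then have "X = (\<Sum>c\<in>F. if c = 0 then X' 0 else 0)"
    unfolding F(3) by (intro sum.cong) auto
  also have "\<dots> \<in> gl.gen_eigen (commutator A) 0"
    using F(1,2) gl.subspace_gen_eigen[OF endo_commutator, of A 0] by (simp add: gl.subspace_0)
  finally have "X \<in> gl.gen_eigen (commutator A) 0" .
  moreover have "gl.shift (commutator A) 0 = commutator A" by (rule ext) simp
  ultimately show ?thesis by (simp add: gl.gen_eigen_def)
qed

definition gl_subalgebra :: "(complex^'n^'n) set \<Rightarrow> bool" where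
  "gl_subalgebra J \<longleftrightarrow> gl.subspace J \<and> (\<forall>A\<in>J. \<forall>B\<in>J. commutator A B \<in> J)"

text \<open>The representation \<open>\<rho>\<close> acts on matrices so that the induction can use both left
  multiplication and the adjoint representation.\<close>

lemma engel:
  fixes J :: "(complex^'n^'n) set" and \<rho> :: "complex^'n^'n \<Rightarrow> complex^'n^'n \<Rightarrow> complex^'n^'n"
  assumes "gl_subalgebra J" "\<And>A. A \<in> J \<Longrightarrow> nilp A"
    and "\<And>A. A \<in> J \<Longrightarrow> gl.endo (\<rho> A)"
    and "\<And>A B X. A \<in> J \<Longrightarrow> B \<in> J \<Longrightarrow> \<rho> (A + B) X = \<rho> A X + \<rho> B X"
    and "\<And>A c X. A \<in> J \<Longrightarrow> \<rho> (mat_scale c A) X = mat_scale c (\<rho> A X)"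
    and "\<And>A B X. A \<in> J \<Longrightarrow> B \<in> J \<Longrightarrow> \<rho> (commutator A B) X = \<rho> A (\<rho> B X) - \<rho> B (\<rho> A X)"
    and "gl.subspace W" "gl.subspace U" "W \<subseteq> U" "W \<noteq> U"
    and "\<And>A X. A \<in> J \<Longrightarrow> X \<in> W \<Longrightarrow> \<rho> A X \<in> W" "\<And>A X. A \<in> J \<Longrightarrow> X \<in> U \<Longrightarrow> \<rho> A X \<in> U"
    and "\<And>A X. A \<in> J \<Longrightarrow> X \<in> U \<Longrightarrow> \<exists>n. (\<rho> A ^^ n) X \<in> W"
  shows "\<exists>X\<in>U - W. \<forall>A\<in>J. \<rho> A X \<in> W"
  using assms
proof (induction "gl.dim J" arbitrary: J \<rho> W U rule: less_induct)
  case less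
  note J = less.prems(1)[unfolded gl_subalgebra_def]
  note nil = less.prems(2) and endo = less.prems(3) and add = less.prems(4) and scl = less.prems(5)
    and br = less.prems(6) and W = less.prems(7) and U = less.prems(8) and WU = less.prems(9,10)
    and invW = less.prems(11) and invU = less.prems(12) and nilW = less.prems(13)
  show ?case
  proof (cases "J = {0}")
    case True
    obtain X where X: "X \<in> U - W" using WU by blast
    have "\<rho> 0 X = 0" using scl[of 0 0 X] True by simp
    then show ?thesis using X W True by (intro bexI[of _ X]) (auto simp: gl.subspace_0)
  next
    case False
    let ?S = "{J'. gl_subalgebra J' \<and> J' \<subset> J}"
    have "{0} \<in> ?S"
      using J False by (auto simp: gl_subalgebra_def commutator_linear gl.subspace_0 gl.subspace_single_0)
    moreover have "\<forall>J'. J' \<in> ?S \<longrightarrow> gl.dim J' < Suc (gl.dim J)"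
      by (auto intro!: gl.dim_subset simp: less_Suc_eq_le)
    ultimately have "\<exists>J0. J0 \<in> ?S \<and> (\<forall>J'. J' \<in> ?S \<longrightarrow> gl.dim J' \<le> gl.dim J0)"
      by (rule ex_has_greatest_nat[where b = "Suc (gl.dim J)"])
    then obtain J0 where J0: "J0 \<in> ?S" "\<And>J'. J' \<in> ?S \<Longrightarrow> gl.dim J' \<le> gl.dim J0" by blast
    then have J0': "gl_subalgebra J0" "J0 \<subset> J" and sJ0: "gl.subspace J0"
      and cJ0: "\<And>A B. A \<in> J0 \<Longrightarrow> B \<in> J0 \<Longrightarrow> commutator A B \<in> J0"
      by (auto simp: gl_subalgebra_def)
    have dim_less: "gl.dim S < gl.dim T" if "gl.subspace S" "gl.subspace T" "S \<subset> T"
      for S T :: "(complex^'n^'n) set"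
    proof -
      have e: "gl.span S = S" "gl.span T = T" using that by (simp_all only: gl.span_eq_iff)
      show ?thesis by (rule gl.dim_psubset) (simp only: e that)
    qed
    have less_dim: "gl.dim J0 < gl.dim J" using dim_less sJ0 J J0'(2) by blast
    \<comment> \<open>The induction hypothesis for the adjoint action of the maximal proper
      subalgebra \<open>J0\<close> on \<open>J\<close> modulo \<open>J0\<close>. Pairs
      \<open>W\<close>, \<open>U\<close> of subspaces replace quotient spaces throughout.\<close>
    have "\<exists>B\<in>J - J0. \<forall>A\<in>J0. commutator A B \<in> J0"
    proof (rule less.hyps[OF less_dim J0'(1)])
      show "\<exists>n. (commutator A ^^ n) X \<in> J0" if "A \<in> J0" for A X
        using ad_nilpotent[OF nil, of A X] that J0'(2) sJ0 gl.subspace_0 by (metis psubsetD)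
      show "commutator (commutator A B) X
          = commutator A (commutator B X) - commutator B (commutator A X)" for A B X
        by (simp add: commutator_jacobi[of A B X])
      show "nilp A" if "A \<in> J0" for A using that nil J0'(2) by blast
      show "gl.subspace J0" "gl.subspace J" "J0 \<subseteq> J" "J0 \<noteq> J" using sJ0 J J0'(2) by blast+
      show "commutator A X \<in> J0" if "A \<in> J0" "X \<in> J0" for A X using that cJ0 by blast
      show "commutator A X \<in> J" if "A \<in> J0" "X \<in> J" for A X using that J J0'(2) by blast
    qed (simp_all only: endo_commutator commutator_linear)
    then obtain B where B: "B \<in> J" "B \<notin> J0" "\<And>A. A \<in> J0 \<Longrightarrow> commutator A B \<in> J0" by blast
    \<comment> \<open>Since \<open>B\<close> normalizes \<open>J0\<close>, this is a subalgebra
      strictly larger than \<open>J0\<close>, hence all of \<open>J\<close> by maximality.\<close>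
    let ?J1 = "gl.span (insert B J0)"
    have span_J0: "gl.span J0 = J0" using sJ0 by (simp only: gl.span_eq_iff)
    have J1_elim: "\<exists>c A'. A' \<in> J0 \<and> A = mat_scale c B + A'" if A: "A \<in> ?J1" for A
    proof -
      obtain c where "A - mat_scale c B \<in> J0" using A unfolding gl.span_insert span_J0 by blast
      then show ?thesis by (intro exI[of _ c] exI[of _ "A - mat_scale c B"]) simp
    qed
    have sub1: "J0 \<subseteq> ?J1" "B \<in> ?J1" by (auto intro: gl.span_base)
    have "commutator A A' \<in> ?J1" if A: "A \<in> ?J1" and A': "A' \<in> ?J1" for A A'
    proof -
      obtain c D c' D' where D: "D \<in> J0" "D' \<in> J0" "A = mat_scale c B + D" "A' = mat_scale c' B + D'"
        using J1_elim[OF A] J1_elim[OF A'] by blast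
      have "commutator A A' = mat_scale c' (commutator D B) - mat_scale c (commutator D' B) + commutator D D'"
        unfolding D(3,4) by (simp add: commutator_linear commutator_swap[of B D'])
      also have "\<dots> \<in> J0" using D B cJ0 sJ0
        by (intro gl.subspace_add gl.subspace_diff gl.subspace_scale) auto
      finally show ?thesis using sub1 by blast
    qed
    then have "gl_subalgebra ?J1" by (simp add: gl_subalgebra_def)
    moreover have "?J1 \<subseteq> J" using J J0'(2) B(1) by (intro gl.span_minimal) auto
    moreover have "gl.dim J0 < gl.dim ?J1" using dim_less[OF sJ0 gl.subspace_span] sub1 B(2) by blast
    ultimately have J1: "?J1 = J" using J0(2)[of ?J1] by (auto simp: psubset_eq)
    \<comment> \<open>The vectors of \<open>U\<close> killed by \<open>J0\<close> modulo
      \<open>W\<close>. The space is not contained in \<open>W\<close> by induction, and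
      \<open>B\<close> preserves it because \<open>B\<close> normalizes \<open>J0\<close>.\<close>
    let ?U0 = "{X \<in> U. \<forall>A\<in>J0. \<rho> A X \<in> W}"
    have J0J: "A \<in> J" if "A \<in> J0" for A using J0'(2) that by blast
    have "\<exists>X\<in>U - W. \<forall>A\<in>J0. \<rho> A X \<in> W"
    proof (rule less.hyps[OF less_dim J0'(1) nil endo add scl br W U WU invW invU nilW])
    qed (use J0J in auto)
    then obtain X0 where X0: "X0 \<in> ?U0" "X0 \<notin> W" by blast
    have "\<rho> B X \<in> ?U0" if X: "X \<in> ?U0" for X
    proof -
      have "\<rho> A (\<rho> B X) \<in> W" if A: "A \<in> J0" for A
      proof -
        have "\<rho> A (\<rho> B X) = \<rho> B (\<rho> A X) + \<rho> (commutator A B) X"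
          using br[OF J0J[OF A] B(1), of X] by simp
        also have "\<dots> \<in> W" using X A B(1,3) invW W by (auto intro!: gl.subspace_add)
        finally show ?thesis .
      qed
      then show ?thesis using X invU B(1) by simp
    qed
    then have pow: "(\<rho> B ^^ k) X0 \<in> ?U0" for k by (induction k) (use X0 in auto)
    \<comment> \<open>The last power of \<open>B\<close> before the orbit of \<open>X0\<close>
      enters \<open>W\<close> gives a vector that is killed modulo \<open>W\<close> by
      \<open>B\<close> as well.\<close>
    define n where "n = (LEAST n. (\<rho> B ^^ n) X0 \<in> W)"
    have n: "(\<rho> B ^^ n) X0 \<in> W"
      unfolding n_def by (rule LeastI_ex) (use nilW[OF B(1)] X0 in blast)
    then obtain k where k: "n = Suc k" using X0(2) by (cases n) auto
    have "(\<rho> B ^^ k) X0 \<notin> W" using not_less_Least[of k "\<lambda>n. (\<rho> B ^^ n) X0 \<in> W"] k n_def by simp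
    moreover have "\<rho> A ((\<rho> B ^^ k) X0) \<in> W" if A: "A \<in> J" for A
    proof -
      obtain c D where D: "D \<in> J0" "A = mat_scale c B + D" using J1_elim A J1 by blast
      have "mat_scale c B \<in> J" using B(1) J by (simp add: gl.subspace_scale)
      then have "\<rho> A ((\<rho> B ^^ k) X0) = mat_scale c (\<rho> B ((\<rho> B ^^ k) X0)) + \<rho> D ((\<rho> B ^^ k) X0)"
        unfolding D(2) using add[of "mat_scale c B" D] scl[OF B(1)] J0J[OF D(1)] by simp
      also have "\<dots> \<in> W" using n[unfolded k] pow[of k] D(1) W
        by (intro gl.subspace_add gl.subspace_scale) auto
      finally show ?thesis .
    qed
    ultimately show ?thesis using pow[of k] by blast
  qed
qed

text \<open>Left multiplication on matrices serves as the representation: a nonzero \<open>X\<close>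
  with \<open>A ** X = 0\<close> for all \<open>A\<close> has common null vectors as its
  values.\<close>

lemma engel_vector:
  fixes J :: "(complex^'n^'n) set"
  assumes "gl_subalgebra J" "\<And>A. A \<in> J \<Longrightarrow> nilp A"
  obtains v where "v \<noteq> 0" "\<And>A. A \<in> J \<Longrightarrow> A *v v = 0"
proof -
  have "\<exists>X\<in>UNIV - {0}. \<forall>A\<in>J. A ** X \<in> {0 :: complex^'n^'n}"
  proof (rule engel[OF assms])
    show "\<exists>n. ((**) A ^^ n) X \<in> {0}" if A: "A \<in> J" for A X :: "complex^'n^'n"
    proof -
      obtain n where n: "\<And>v. ((*v) A ^^ n) v = 0" using nilpE[OF assms(2)[OF A]] by blast
      have "((**) A ^^ k) X *v v = ((*v) A ^^ k) (X *v v)" for k v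
        by (induction k) (simp_all flip: matrix_vector_mul_assoc)
      then show ?thesis using n by (intro exI[of _ n]) (simp add: matrix_eq)
    qed
    have "axis i 1 \<noteq> (0 :: complex^'n)" for i by (simp add: axis_eq_0_iff)
    then have "(mat 1 :: complex^'n^'n) \<noteq> 0"
      by (metis matrix_vector_mul_lid matrix_vector_mult_0)
    then show "{0 :: complex^'n^'n} \<noteq> UNIV" by blast
    show "gl.endo ((**) A)" for A :: "complex^'n^'n"
      by (rule gl.endoI) (simp_all add: matrix_mult_distrib mat_scale_mult)
    show "commutator A B ** X = A ** (B ** X) - B ** (A ** X)" for A B X :: "complex^'n^'n"
      by (simp add: commutator_def matrix_mult_distrib matrix_mul_assoc)
  qed (simp_all add: matrix_mult_distrib mat_scale_mult gl.subspace_UNIV gl.subspace_single_0)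
  then obtain X where "X \<in> UNIV - {0}" and X2: "\<forall>A\<in>J. A ** X \<in> {0 :: complex^'n^'n}" ..
  then have X: "X \<noteq> 0" "\<And>A. A \<in> J \<Longrightarrow> A ** X = 0" by simp_all
  have "\<exists>v. X *v v \<noteq> 0" using X(1) unfolding matrix_eq[of X 0] matrix_vector_mult_0 by blast
  then obtain v where v: "X *v v \<noteq> 0" by blast
  have "A *v (X *v v) = 0" if "A \<in> J" for A
    unfolding matrix_vector_mul_assoc X(2)[OF that] by (rule matrix_vector_mult_0)
  with v show thesis by (rule that)
qed

subsection \<open>Irreducible subalgebras of the symplectic algebra\<close>

locale symplectic =
  fixes \<Omega> :: "complex^'n \<Rightarrow> complex^'n \<Rightarrow> complex"
  assumes symplectic: "symplectic_form \<Omega>"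
begin

lemma form_linear:
  "\<Omega> (x + y) z = \<Omega> x z + \<Omega> y z" "\<Omega> z (x + y) = \<Omega> z x + \<Omega> z y"
  "\<Omega> (c *s x) z = c * \<Omega> x z" "\<Omega> z (c *s x) = c * \<Omega> z x"
  "\<Omega> 0 z = 0" "\<Omega> z 0 = 0" "\<Omega> (- x) z = - \<Omega> x z" "\<Omega> z (- x) = - \<Omega> z x"
  "\<Omega> (x - y) z = \<Omega> x z - \<Omega> y z" "\<Omega> z (x - y) = \<Omega> z x - \<Omega> z y"
proof -
  interpret l: Vector_Spaces.linear "(*s)" "(*)" "\<lambda>x. \<Omega> x z"
    using symplectic by (simp add: symplectic_form_def)
  interpret r: Vector_Spaces.linear "(*s)" "(*)" "\<lambda>x. \<Omega> z x"
    using symplectic by (simp add: symplectic_form_def)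
  show "\<Omega> (x + y) z = \<Omega> x z + \<Omega> y z" "\<Omega> z (x + y) = \<Omega> z x + \<Omega> z y"
    "\<Omega> (c *s x) z = c * \<Omega> x z" "\<Omega> z (c *s x) = c * \<Omega> z x"
    "\<Omega> 0 z = 0" "\<Omega> z 0 = 0" "\<Omega> (- x) z = - \<Omega> x z" "\<Omega> z (- x) = - \<Omega> z x"
    "\<Omega> (x - y) z = \<Omega> x z - \<Omega> y z" "\<Omega> z (x - y) = \<Omega> z x - \<Omega> z y"
    by (fact l.add r.add l.scale r.scale l.zero r.zero l.neg r.neg l.diff r.diff)+
qed

lemma form_self [simp]: "\<Omega> x x = 0"
  using symplectic by (simp add: symplectic_form_def)

lemma form_swap: "\<Omega> x y = - \<Omega> y x"
proof -
  have "\<Omega> (x + y) (x + y) = 0" by (rule form_self)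
  then show ?thesis by (simp add: form_linear eq_neg_iff_add_eq_0 del: form_self)
     (simp add: add_eq_0_iff)
qed

lemma form_nondegenerate: "(\<And>y. \<Omega> x y = 0) \<Longrightarrow> x = 0"
  using symplectic by (auto simp: symplectic_form_def)

lemma form_nondegenerate_right: "(\<And>y. \<Omega> y x = 0) \<Longrightarrow> x = 0"
  by (rule form_nondegenerate) (metis form_swap neg_equal_0_iff_equal)

lemma spD: "A \<in> sp \<Omega> \<Longrightarrow> \<Omega> (A *v x) y = - \<Omega> x (A *v y)"
  by (simp add: sp_def eq_neg_iff_add_eq_0)

end

locale irreducible_sp = symplectic \<Omega> for \<Omega> :: "complex^'n \<Rightarrow> complex^'n \<Rightarrow> complex" +
  fixes K :: "(complex^'n^'n) set"
  assumes K_sp: "K \<subseteq> sp \<Omega>"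
    and K_sub: "lie_subalgebra mat_scale commutator K"
    and irred: "acts_irreducibly K"
begin

lemma subspace_K: "gl.subspace K" and commutator_K: "A \<in> K \<Longrightarrow> B \<in> K \<Longrightarrow> commutator A B \<in> K"
  using K_sub by (auto simp: lie_subalgebra_def)

lemma irreducible:
  assumes "vec.subspace W" "\<And>A x. A \<in> K \<Longrightarrow> x \<in> W \<Longrightarrow> A *v x \<in> W" "x \<in> W" "x \<noteq> 0"
  shows "W = UNIV"
  using assms irred unfolding acts_irreducibly_def by blast

lemma schur:
  assumes "\<And>A. A \<in> K \<Longrightarrow> commutator X A = 0"
  obtains a where "\<And>v. X *v v = a *s v"
proof -
  obtain w a where w: "w \<noteq> 0" "X *v w = a *s w"
    by (rule vs.eigenvector_exists[OF endo_matrix, where A1 = X and W = UNIV and F = cart_basis and v = "axis undefined 1"])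
      (auto simp: vec.subspace_UNIV finite_cart_basis axis_eq_0_iff)
  let ?W = "{v. X *v v = a *s v}"
  have "?W = UNIV"
  proof (rule irreducible)
    show "vec.subspace ?W"
      by (rule vec.subspaceI) (auto simp: mat_vec_simps vec.scale_right_distrib mult.commute)
    show "A *v x \<in> ?W" if "A \<in> K" "x \<in> ?W" for A x
    proof -
      have "commutator X A *v x = 0" using assms[OF that(1)] by simp
      then show ?thesis using that(2) by (simp add: mat_vec_simps)
    qed
  qed (use w in auto)
  then show thesis using that by blast
qed

text \<open>A central element is a scalar by \<open>schur\<close>, and a nonzero scalar in
  \<open>sp\<close> would force \<Omega> to vanish.\<close>

lemma central_zero:
  assumes "X \<in> K" "\<And>A. A \<in> K \<Longrightarrow> commutator X A = 0"
  shows "X = 0"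
proof -
  obtain a where a: "\<And>v. X *v v = a *s v" using schur assms(2) by blast
  have "a = 0"
  proof (rule ccontr)
    assume "a \<noteq> 0"
    then have "\<Omega> x y = 0" for x y
      using spD[of X x y] K_sp assms(1) a by (auto simp: form_linear)
    then have "axis undefined 1 = (0 :: complex^'n)" using form_nondegenerate by blast
    moreover have "axis undefined (1 :: complex) \<noteq> (0 :: complex^'n)" by (simp add: axis_eq_0_iff)
    ultimately show False by contradiction
  qed
  then show ?thesis using a by (simp add: matrix_eq)
qed

definition ideal :: "(complex^'n^'n) set \<Rightarrow> bool" where
  "ideal I \<longleftrightarrow> gl.subspace I \<and> I \<subseteq> K \<and> (\<forall>A\<in>K. \<forall>B\<in>I. commutator A B \<in> I)"

lemma idealD:
  assumes "ideal I"
  shows "gl.subspace I" "A \<in> I \<Longrightarrow> A \<in> K" "A \<in> K \<Longrightarrow> B \<in> I \<Longrightarrow> commutator A B \<in> I"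
    "B \<in> I \<Longrightarrow> A \<in> K \<Longrightarrow> commutator B A \<in> I"
proof -
  show "gl.subspace I" "A \<in> I \<Longrightarrow> A \<in> K" "A \<in> K \<Longrightarrow> B \<in> I \<Longrightarrow> commutator A B \<in> I"
    using assms by (auto simp: ideal_def)
  then show "B \<in> I \<Longrightarrow> A \<in> K \<Longrightarrow> commutator B A \<in> I"
    using assms by (subst commutator_swap) (auto simp: ideal_def gl.subspace_neg)
qed

lemma ideal_K: "ideal K"
  by (simp add: ideal_def subspace_K commutator_K)

lemma ideal_span:
  assumes "E \<subseteq> K" "\<And>A B. A \<in> K \<Longrightarrow> B \<in> E \<Longrightarrow> commutator A B \<in> gl.span E"
  shows "ideal (gl.span E)"
proof -
  have "commutator A B \<in> gl.span E" if A: "A \<in> K" and B: "B \<in> gl.span E" for A B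
    using B
  proof (induction rule: gl.span_induct_alt)
    case (step c x y)
    then show ?case using assms(2)[OF A] by (simp add: commutator_linear gl.span_add gl.span_scale)
  qed (simp add: commutator_linear gl.span_zero)
  then show ?thesis using gl.span_minimal[OF assms(1) subspace_K] by (simp add: ideal_def)
qed

lemma ideal_commutators:
  assumes "ideal I" "ideal J"
  shows "ideal (gl.span {commutator A B | A B. A \<in> I \<and> B \<in> J})" (is "ideal (gl.span ?E)")
proof (rule ideal_span)
  show "?E \<subseteq> K" using assms idealD commutator_K by blast
  fix A B assume A: "A \<in> K" and "B \<in> ?E"
  then obtain C D where CD: "B = commutator C D" "C \<in> I" "D \<in> J" by blast
  then have "commutator A B = commutator (commutator A C) D + commutator C (commutator A D)"
    by (simp add: commutator_jacobi[of A C D])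
  also have "\<dots> \<in> gl.span ?E"
    using A CD assms idealD(3) by (intro gl.span_add gl.span_base) blast+
  finally show "commutator A B \<in> gl.span ?E" .
qed

text \<open>The common kernel of an ideal is \<open>K\<close>-invariant. It is nonzero by Engel,
  hence everything by irreducibility.\<close>

lemma nilpotent_ideal:
  assumes I: "ideal I" and nil: "\<And>A. A \<in> I \<Longrightarrow> nilp A" and A: "A \<in> I"
  shows "A = 0"
proof -
  have "gl_subalgebra I" using idealD[OF I] by (auto simp: gl_subalgebra_def)
  then obtain v where v: "v \<noteq> 0" "\<And>A. A \<in> I \<Longrightarrow> A *v v = 0" 
    using engel_vector[OF _ nil] by metis
  let ?W = "{v. \<forall>A\<in>I. A *v v = 0}"
  have "?W = UNIV"
  proof (rule irreducible)
    show "vec.subspace ?W" by (rule vec.subspaceI) (auto simp: mat_vec_simps)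
    show "B *v x \<in> ?W" if "B \<in> K" "x \<in> ?W" for B x
    proof -
      have "A *v (B *v x) = commutator A B *v x + B *v (A *v x)" for A by (simp add: mat_vec_simps)
      then show ?thesis using that idealD(4)[OF I] by auto
    qed
  qed (use v in auto)
  then show ?thesis using A by (auto simp: matrix_eq)
qed

section \<open>Cartan's criterion and nondegeneracy of the trace form\<close>

lemma nilp_if_trace_conj:
  fixes A :: "complex^'n^'n"
  obtains S where "trace (S ** A) = 0 \<Longrightarrow> nilp A"
    "ad_dominates A S"
proof -
  obtain B lab S where B: "finite B" "vec.span B = UNIV"
    and lab: "\<And>b. b \<in> B \<Longrightarrow> b \<in> eigen A (lab b)"
    and tr: "\<And>f. trace (S f ** A) = (\<Sum>b\<in>B. f (lab b) * lab b)"
    and ad: "\<And>f. additive f \<Longrightarrow> ad_dominates A (S f)"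
    by (rule spectral_matrix[of A]) (rule that)
  \<comment> \<open>With complex conjugation as the function of the eigenvalues, the trace is the
    sum of their squared absolute values.\<close>
  have "nilp A" if "trace (S cnj ** A) = 0"
  proof -
    have "of_real (\<Sum>b\<in>B. (cmod (lab b))\<^sup>2) = (\<Sum>b\<in>B. cnj (lab b) * lab b)"
      unfolding of_real_sum by (intro sum.cong refl)
        (metis complex_norm_square mult.commute)
    then have "(\<Sum>b\<in>B. (cmod (lab b))\<^sup>2) = 0" using that tr[of cnj] by (metis of_real_eq_0_iff)
    then have "lab b = 0" if "b \<in> B" for b using that B(1) by (simp add: sum_nonneg_eq_0_iff)
    then have "B \<subseteq> eigen A 0" using lab by fastforce
    then have "vec.span B \<subseteq> eigen A 0" by (intro vec.span_minimal vs.subspace_gen_eigen endo_matrix)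
    then show ?thesis using B(2) by (auto simp: nilp_def)
  qed
  then show thesis using that[of "S cnj"] ad[of cnj] by (simp add: additive_def)
qed

lemma trace_span:
  assumes "A \<in> gl.span E" "\<And>B. B \<in> E \<Longrightarrow> trace (S ** B) = 0"
  shows "trace (S ** A) = 0"
  using assms(1)
proof (induction rule: gl.span_induct_alt)
  case (step c x y)
  then show ?case by (simp add: matrix_mult_distrib mat_scale_mult trace_add trace_mat_scale assms(2))
qed (simp add: trace_def matrix_matrix_mult_def)

text \<open>Cartan's criterion: pair an element of the ideal with its conjugate part, which
  acts on every subspace that the element acts on.\<close>

lemma isotropic_ideal:
  assumes I: "ideal I" and iso: "\<And>A B. A \<in> I \<Longrightarrow> B \<in> I \<Longrightarrow> trace (A ** B) = 0" and A: "A \<in> I"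
  shows "A = 0"
proof -
  \<comment> \<open>Two rounds: \<open>[I, I] = 0\<close> first, then \<open>[K, I] = 0\<close>,
    after which \<open>I\<close> is central. In each round the span of brackets is an ideal of
    nilpotent elements.\<close>
  let ?E1 = "{commutator A B | A B. A \<in> I \<and> B \<in> I}"
  have I1: "ideal (gl.span ?E1)" by (rule ideal_commutators[OF I I])
  have sub1: "gl.span ?E1 \<subseteq> I" using idealD[OF I] by (intro gl.span_minimal) auto
  have "C = 0" if "C \<in> gl.span ?E1" for C
  proof (rule nilpotent_ideal[OF I1 _ that])
    fix A assume A: "A \<in> gl.span ?E1"
    obtain S where S: "trace (S ** A) = 0 \<Longrightarrow> nilp A"
      "ad_dominates A S" by (rule nilp_if_trace_conj[of A]) (rule that)
    \<comment> \<open>By invariance \<open>trace (S [B, C]) = trace ([S, B] C)\<close>, and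
      \<open>[S, B]\<close> is back in the isotropic ideal.\<close>
    have "commutator S X \<in> I" if "X \<in> I" for X
      using S(2)[unfolded ad_dominates_def, rule_format, of I X] that A sub1 idealD[OF I] by blast
    then have "trace (S ** commutator B C) = 0" if "B \<in> I" "C \<in> I" for B C
      using iso that by (simp flip: trace_commutator)
    then have "trace (S ** A) = 0" by (intro trace_span[OF A]) auto
    then show "nilp A" by (rule S(1))
  qed
  then have abelian: "commutator B C = 0" if "B \<in> I" "C \<in> I" for B C
    using that by (intro \<open>\<And>C. C \<in> gl.span ?E1 \<Longrightarrow> C = 0\<close> gl.span_base) blast
  let ?E2 = "{commutator A B | A B. A \<in> K \<and> B \<in> I}"
  have I2: "ideal (gl.span ?E2)" by (rule ideal_commutators[OF ideal_K I])
  have sub2: "gl.span ?E2 \<subseteq> I" using idealD[OF I] by (intro gl.span_minimal) auto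
  have central: "C = 0" if "C \<in> gl.span ?E2" for C
  proof (rule nilpotent_ideal[OF I2 _ that])
    fix A assume A: "A \<in> gl.span ?E2"
    obtain S where S: "trace (S ** A) = 0 \<Longrightarrow> nilp A"
      "ad_dominates A S" by (rule nilp_if_trace_conj[of A]) (rule that)
    \<comment> \<open>The invariant subspace is now zero: \<open>A\<close> commutes with the abelian
      ideal \<open>I\<close>, hence so does \<open>S\<close>.\<close>
    have "commutator S X = 0" if "X \<in> I" for X
      using S(2)[unfolded ad_dominates_def, rule_format, of "{0}" X] that A sub2 abelian[of A X]
      by (auto simp: gl.subspace_single_0 commutator_linear)
    then have "trace (S ** commutator C B) = 0" if "B \<in> I" "C \<in> K" for B C
      using that trace_commutator[of S B C] commutator_swap[of C B]
      by (simp add: trace_def matrix_matrix_mult_def sum_negf)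
    then have "trace (S ** A) = 0" by (intro trace_span[OF A]) auto
    then show "nilp A" by (rule S(1))
  qed
  show ?thesis
  proof (rule central_zero)
    show "A \<in> K" using idealD[OF I] A by blast
    fix B assume "B \<in> K"
    then have "commutator B A = 0" using A by (intro central gl.span_base) blast
    then show "commutator A B = 0" using commutator_swap[of A B] by simp
  qed
qed

text \<open>The radical of the trace form on an ideal is itself an ideal, and it is
  isotropic.\<close>

lemma trace_form_nondegenerate:
  assumes I: "ideal I" and A: "A \<in> I" "\<And>B. B \<in> I \<Longrightarrow> trace (A ** B) = 0"
  shows "A = 0"
proof -
  let ?R = "{A \<in> I. \<forall>B\<in>I. trace (A ** B) = 0}"
  have "ideal ?R"
    unfolding ideal_def
  proof (intro conjI ballI)
    show "gl.subspace ?R" using idealD(1)[OF I]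
      by (auto intro!: gl.subspaceI simp: gl.subspace_0 gl.subspace_add gl.subspace_scale
          matrix_mult_distrib mat_scale_mult trace_add trace_mat_scale)
        (simp add: trace_def matrix_matrix_mult_def)
    show "?R \<subseteq> K" using idealD[OF I] by blast
    fix C A assume C: "C \<in> K" "A \<in> ?R"
    have "trace (commutator C A ** B) = 0" if "B \<in> I" for B
    proof -
      have "trace (commutator A C ** B) = 0"
        using trace_commutator[of A C B] C that idealD(3)[OF I] by simp
      then show ?thesis unfolding commutator_swap[of C A]
        by (simp add: trace_def matrix_matrix_mult_def sum_negf)
    qed
    then show "commutator C A \<in> ?R" using C idealD(3)[OF I] by blast
  qed
  then show ?thesis by (rule isotropic_ideal) (use A in auto)
qed

lemma ideal_functional:
  assumes I: "ideal I"
    and l: "\<And>x y. x \<in> I \<Longrightarrow> y \<in> I \<Longrightarrow> l (x + y) = l x + l y"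
      "\<And>c x. x \<in> I \<Longrightarrow> l (mat_scale c x) = c * l x"
  obtains s where "s \<in> I" "\<And>A. A \<in> I \<Longrightarrow> trace (s ** A) = l A"
proof -
  have "\<exists>s\<in>I. \<forall>A\<in>I. trace (s ** A) = l A"
    by (rule gl.nondegenerate_functional[OF idealD(1)[OF I] gl_fin_dim l])
      (use trace_form_nondegenerate[OF I] in
        \<open>auto simp: matrix_mult_distrib mat_scale_mult trace_add trace_mat_scale\<close>)
  then show thesis using that by blast
qed

text \<open>The matrix \<open>s\<close> that represents \<open>l\<close> commutes with
  \<open>K\<close>, by invariance of the trace form, and so is zero. In effect \<open>[I, K]\<close>
  is all of \<open>I\<close>; used for traces of \<open>I\<close> in other representations.\<close>

lemma functional_zero:
  assumes I: "ideal I" and A: "A \<in> I"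
    and l: "\<And>x y. x \<in> I \<Longrightarrow> y \<in> I \<Longrightarrow> l (x + y) = l x + l y"
      "\<And>c x. x \<in> I \<Longrightarrow> l (mat_scale c x) = c * l x"
    and l0: "\<And>x y. x \<in> I \<Longrightarrow> y \<in> K \<Longrightarrow> l (commutator x y) = 0"
  shows "l A = 0"
proof -
  obtain s where s: "s \<in> I" "\<And>A. A \<in> I \<Longrightarrow> trace (s ** A) = l A"
    using ideal_functional[of I l, OF I l] by blast
  have "commutator s C = 0" if C: "C \<in> K" for C
  proof (rule trace_form_nondegenerate[OF I])
    show "commutator s C \<in> I" using idealD(4)[OF I s(1) C] .
    fix B assume B: "B \<in> I"
    have "trace (commutator s C ** B) = trace (s ** commutator C B)" by (rule trace_commutator)
    also have "\<dots> = l (- commutator B C)"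
      using s(2)[OF idealD(3)[OF I C B]] commutator_swap[of C B] by simp
    also have "\<dots> = 0"
      using l(2)[of "commutator B C" "- 1"] l0[OF B C] idealD(4)[OF I B C]
      by (simp add: gl.scale_minus_left)
    finally show "trace (commutator s C ** B) = 0" .
  qed
  then have "s = 0" using central_zero s(1) idealD(2)[OF I] by blast
  then show ?thesis using s(2)[OF A] by (simp add: trace_def matrix_matrix_mult_def)
qed

lemma trace_commutator_zero: "trace (commutator A B) = 0"
  unfolding commutator_def trace_sub using trace_mul_sym[of A B] by simp

lemma trace_zero: "A \<in> K \<Longrightarrow> trace A = 0"
  by (rule functional_zero[OF ideal_K, where l = trace])
    (simp_all add: trace_add trace_mat_scale trace_commutator_zero)

text \<open>\<open>I\<close> contains an element \<open>A\<close> that is not nilpotent. Replacing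
  each eigenvalue by its real or imaginary part gives a real diagonalizable matrix; the work lies in
  showing that it stays in \<open>I\<close>.\<close>

lemma real_semisimple_element:
  assumes I: "ideal I" and ne: "I \<noteq> {0}"
  obtains S B d where "S \<in> I" "S \<noteq> 0" "finite B" "vec.independent B" "vec.span B = UNIV"
    "\<And>b. b \<in> B \<Longrightarrow> S *v b = of_real (d b) *s b"
proof -
  note witness = that
  have "\<exists>A\<in>I. A \<noteq> 0" using ne gl.subspace_0[OF idealD(1)[OF I]] by blast
  then obtain A where A: "A \<in> I" "\<not> nilp A" using nilpotent_ideal[OF I] by blast
  obtain B lab S where B: "finite B" "vec.independent B" "vec.span B = UNIV"
    and lab: "\<And>b. b \<in> B \<Longrightarrow> b \<in> eigen A (lab b)"
    and S: "\<And>f a v. v \<in> eigen A a \<Longrightarrow> S f *v v = f a *s v"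
    and tr: "\<And>f. trace (S f) = (\<Sum>b\<in>B. f (lab b))"
    and trA: "\<And>f. trace (S f ** A) = (\<Sum>b\<in>B. f (lab b) * lab b)"
    and ad: "\<And>f. additive f \<Longrightarrow> ad_dominates A (S f)"
    by (rule spectral_matrix[of A]) (rule that)
  have S_I: "S f \<in> I" if f: "additive f" for f
  proof -
    have SK: "commutator (S f) X \<in> I" if "X \<in> K" for X
      using ad[OF f, unfolded ad_dominates_def, rule_format, of I X] idealD[OF I] A(1) that by blast
    \<comment> \<open>The trace-orthogonal projection of \<open>S f\<close> to \<open>I\<close>. The
      difference has brackets with \<open>K\<close> that lie in \<open>I\<close> and are orthogonal
      to \<open>I\<close>; hence it commutes with \<open>K\<close>, is a scalar by
      \<open>schur\<close>, and the scalar is zero since both traces are.\<close>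
    obtain s where s: "s \<in> I" "\<And>A. A \<in> I \<Longrightarrow> trace (s ** A) = trace (S f ** A)"
      by (rule ideal_functional[OF I, of "\<lambda>A. trace (S f ** A)"])
        (simp_all add: mat_scale_mult matrix_mult_distrib trace_add trace_mat_scale that)
    have "commutator (S f - s) C = 0" if C: "C \<in> K" for C
    proof (rule trace_form_nondegenerate[OF I])
      show "commutator (S f - s) C \<in> I"
        using SK[OF C] idealD(4)[OF I s(1) C] idealD(1)[OF I] by (simp add: commutator_linear gl.subspace_diff)
      fix D assume "D \<in> I"
      then have "trace ((S f - s) ** commutator C D) = 0"
        using s(2)[OF idealD(3)[OF I C]] by (simp add: matrix_mult_distrib trace_sub)
      then show "trace (commutator (S f - s) C ** D) = 0" by (simp add: trace_commutator)
    qed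
    then obtain a where a: "\<And>v. (S f - s) *v v = a *s v" using schur by blast
    have "S f - s = mat_scale a (mat 1)" by (simp add: matrix_eq a)
    then have "trace (S f) - trace s = a * of_nat CARD('n)"
      by (metis trace_I trace_mat_scale trace_sub)
    moreover have "trace s = 0" using trace_zero s(1) idealD(2)[OF I] by blast
    moreover have "trace (S f) = 0"
    proof -
      have "f 0 = 0" using f[unfolded additive_def, rule_format, of 0 0] by simp
      \<comment> \<open>The trace of \<open>S f\<close> is \<open>f\<close> of the trace of
        \<open>A\<close>, and the latter is zero for elements of \<open>K\<close>.\<close>
      then have "(\<Sum>b\<in>B. f (lab b)) = f (\<Sum>b\<in>B. lab b)"
        using f B(1) by (induction B rule: infinite_finite_induct) (auto simp: additive_def)
      moreover have "(\<Sum>b\<in>B. lab b) = trace A"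
      proof -
        \<comment> \<open>The constant function 1, though not additive, is admissible in the trace
          formula and yields the trace of \<open>A\<close> itself.\<close>
        have "S (\<lambda>_. 1) = mat 1"
          by (rule matrix_eqI_on_eigen[of A]) (simp add: S)
        then show ?thesis using trA[of "\<lambda>_. 1"] by simp
      qed
      moreover have "trace A = 0" using trace_zero A(1) idealD(2)[OF I] by blast
      ultimately show ?thesis using tr \<open>f 0 = 0\<close> by simp
    qed
    ultimately have "a = 0" by simp
    then have "S f = s" using a by (simp add: matrix_eq mat_vec_simps)
    then show ?thesis using s(1) by simp
  qed
  have "\<exists>b\<in>B. lab b \<noteq> 0"
  proof (rule ccontr)
    assume "\<not> ?thesis"
    then have "B \<subseteq> eigen A 0" using lab by fastforce
    then have "vec.span B \<subseteq> eigen A 0" by (intro vec.span_minimal vs.subspace_gen_eigen endo_matrix)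
    then show False using B(3) A(2) by (auto simp: nilp_def)
  qed
  then obtain b where b: "b \<in> B" "lab b \<noteq> 0" by blast
  have b0: "b \<noteq> 0" using b(1) B(2) vec.dependent_zero by blast
  let ?f = "\<lambda>g z. complex_of_real (g z)"
  have *: thesis if "additive (?f g)" "g (lab b) \<noteq> 0" for g
  proof (rule witness[of "S (?f g)" B "\<lambda>b. g (lab b)"])
    show "S (?f g) \<in> I" by (rule S_I) fact
    show "S (?f g) \<noteq> 0"
    proof
      assume "S (?f g) = 0"
      then have "?f g (lab b) *s b = 0" using S[OF lab[OF b(1)], of "?f g"] by simp
      then show False using that(2) b0 by simp
    qed
  qed (use B S[OF lab] in auto)
  show thesis
  proof (cases "Re (lab b) = 0")
    case True
    then have "Im (lab b) \<noteq> 0" using b(2) by (simp add: complex_eq_iff)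
    then show thesis by (intro *[of Im]) (simp add: additive_def)
  next
    case False
    then show thesis by (intro *[of Re]) (simp add: additive_def)
  qed
qed

end

subsection \<open>Iterated classical prolongations\<close>

text \<open>A polynomial vector field is recorded by its iterated directional derivatives at the
  origin: \<open>P [y1, ..., yk]\<close> is the derivative along \<open>y1\<close>, ...,
  \<open>yk\<close>.\<close>

type_synonym 'n field_jet = "(complex^'n) list \<Rightarrow> complex^'n"

definition jet_scale :: "complex \<Rightarrow> ('n::finite) field_jet \<Rightarrow> 'n field_jet" where
  "jet_scale c P = (\<lambda>w. c *s P w)"

interpretation jet: complex_space "jet_scale :: complex \<Rightarrow> ('n::finite) field_jet \<Rightarrow> 'n field_jet"
  by (simp add: complex_space_def, unfold_locales)
    (simp_all add: jet_scale_def fun_eq_iff vec.scale_right_distrib vec.scale_left_distrib)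

definition dv :: "complex^'n \<Rightarrow> 'n field_jet \<Rightarrow> 'n field_jet" where
  "dv y P = (\<lambda>w. P (y # w))"

definition const_jet :: "complex^'n \<Rightarrow> 'n field_jet" where
  "const_jet v = (\<lambda>w. if w = [] then v else 0)"

text \<open>The action of the linear vector field \<open>A\<close> on vector fields. The recursion
  is its commutation rule with a directional derivative, \<open>dv_act\<close>.\<close>

primrec act_at :: "complex^'n^'n \<Rightarrow> (complex^'n) list \<Rightarrow> 'n field_jet \<Rightarrow> complex^'n" where
  "act_at A [] P = A *v P []"
| "act_at A (y # w) P = act_at A w (dv y P) - P ((A *v y) # w)"

definition act :: "complex^'n^'n \<Rightarrow> 'n field_jet \<Rightarrow> 'n field_jet" where
  "act A P = (\<lambda>w. act_at A w P)"

text \<open>Bracket with the quadratic vector field whose derivative along \<open>y\<close> is the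
  linear field \<open>\<phi> y\<close>; it raises the degree by one.\<close>

primrec quad_at :: "(complex^'n \<Rightarrow> complex^'n^'n) \<Rightarrow> (complex^'n) list \<Rightarrow> 'n field_jet \<Rightarrow> complex^'n" where
  "quad_at \<phi> [] P = 0"
| "quad_at \<phi> (y # w) P = act_at (\<phi> y) w P + quad_at \<phi> w (dv y P)"

definition quad :: "(complex^'n \<Rightarrow> complex^'n^'n) \<Rightarrow> 'n field_jet \<Rightarrow> 'n field_jet" where
  "quad \<phi> P = (\<lambda>w. quad_at \<phi> w P)"

lemma dv_nil: "dv y P w = P (y # w)"
  by (simp add: dv_def)

lemma dv_act: "dv y (act A P) = act A (dv y P) - dv (A *v y) P"
  by (simp add: dv_def act_def fun_eq_iff)

lemma act_nil: "act A P [] = A *v P []"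
  by (simp add: act_def)

lemma dv_quad: "dv y (quad \<phi> P) = act (\<phi> y) P + quad \<phi> (dv y P)"
  by (simp add: dv_def act_def quad_def fun_eq_iff)

lemma quad_nil: "quad \<phi> P [] = 0"
  by (simp add: quad_def)

lemma dv_const [simp]: "dv y (const_jet v) = 0"
  by (simp add: dv_def const_jet_def fun_eq_iff)

lemma const_nil [simp]: "const_jet v [] = v"
  by (simp add: const_jet_def)

lemma jet_eqI:
  assumes "P [] = Q []" "\<And>y. dv y P = dv y Q"
  shows "P = Q"
proof
  show "P w = Q w" for w
    by (cases w) (use assms in \<open>auto simp: dv_def fun_eq_iff\<close>)
qed

lemma endo_dv: "jet.endo (dv y)"
  by (rule jet.endoI) (simp_all add: dv_def jet_scale_def fun_eq_iff)

lemma endo_act: "jet.endo (act A)"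
proof (rule jet.endoI)
  have *: "act_at A w (P + Q) = act_at A w P + act_at A w Q" for w and P Q :: "'a field_jet"
    by (induction w arbitrary: P Q)
      (simp_all add: mat_vec_simps jet.endoD(1)[OF endo_dv])
  then show "act A (P + Q) = act A P + act A Q" for P Q by (simp add: act_def fun_eq_iff)
  have *: "act_at A w (jet_scale c P) = c *s act_at A w P" for w c and P :: "'a field_jet"
    by (induction w arbitrary: P)
      (simp_all add: matrix_vec_scale jet.endoD(2)[OF endo_dv],
       simp_all add: jet_scale_def matrix_vec_scale vec.scale_right_diff_distrib)
  then show "act A (jet_scale c P) = jet_scale c (act A P)" for c P
    by (simp add: act_def fun_eq_iff) (simp add: jet_scale_def)
qed

lemma endo_quad: "jet.endo (quad \<phi>)"
proof (rule jet.endoI)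
  have a: "act_at A w (P + Q) = act_at A w P + act_at A w Q"
    "act_at A w (jet_scale c P) = c *s act_at A w P" for A c w and P Q :: "'a field_jet"
    using jet.endoD(1,2)[OF endo_act[of A], THEN fun_cong, of _ _ w] by (simp_all add: act_def jet_scale_def)
  have *: "quad_at \<phi> w (P + Q) = quad_at \<phi> w P + quad_at \<phi> w Q" for w P Q
    by (induction w arbitrary: P Q) (simp_all add: a jet.endoD(1)[OF endo_dv])
  then show "quad \<phi> (P + Q) = quad \<phi> P + quad \<phi> Q" for P Q by (simp add: quad_def fun_eq_iff)
  have *: "quad_at \<phi> w (jet_scale c P) = c *s quad_at \<phi> w P" for w c P
    by (induction w arbitrary: P) (simp_all add: a jet.endoD(2)[OF endo_dv] vec.scale_right_distrib)
  then show "quad \<phi> (jet_scale c P) = jet_scale c (quad \<phi> P)" for c P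
    by (simp add: quad_def fun_eq_iff) (simp add: jet_scale_def)
qed

lemmas dv_linear = jet.endoD[OF endo_dv]
lemma dv_lambda:
  "dv y (\<lambda>w. P w + Q w) = dv y P + dv y Q" "dv y (\<lambda>w. P w - Q w) = dv y P - dv y Q" "dv y (\<lambda>w. 0) = 0"
  by (simp_all add: dv_def fun_eq_iff)

lemmas act_linear = jet.endoD[OF endo_act]
lemmas quad_linear = jet.endoD[OF endo_quad]

definition dir_linear :: "('n::finite) field_jet \<Rightarrow> bool" where
  "dir_linear P \<longleftrightarrow> (\<forall>x y. dv (x + y) P = dv x P + dv y P) \<and> (\<forall>c x. dv (c *s x) P = jet_scale c (dv x P))"

lemma dir_linearD:
  assumes "dir_linear P"
  shows "dv (x + y) P = dv x P + dv y P" "dv (c *s x) P = jet_scale c (dv x P)"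
    "dv (x - y) P = dv x P - dv y P"
proof -
  show "dv (x + y) P = dv x P + dv y P" "dv (c *s x) P = jet_scale c (dv x P)"
    using assms by (auto simp: dir_linear_def)
  show "dv (x - y) P = dv x P - dv y P"
  proof -
    have "dv (x - y + y) P = dv (x - y) P + dv y P" using assms unfolding dir_linear_def by blast
    then show ?thesis by simp
  qed
qed

text \<open>\<open>level K n\<close> consists of the homogeneous polynomial vector fields of degree \<open>n\<close> whose partial
  derivatives of order \<open>n - 1\<close> lie in \<open>K\<close>, encoded by their values on words of directions.\<close>

fun level :: "(complex^'n^'n) set \<Rightarrow> nat \<Rightarrow> 'n field_jet set" where
  "level K 0 = range const_jet"
| "level K (Suc 0) = {P. P [] = 0 \<and> (\<exists>A\<in>K. \<forall>y. dv y P = const_jet (A *v y))}"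
| "level K (Suc (Suc n)) = {P. P [] = 0 \<and> dir_linear P \<and> (\<forall>y. dv y P \<in> level K (Suc n)) \<and>
     (\<forall>y z. dv y (dv z P) = dv z (dv y P))}"

lemma const_add: "const_jet (u + v) = const_jet u + const_jet v"
  and const_scale: "const_jet (c *s v) = jet_scale c (const_jet v)"
  by (simp_all add: const_jet_def jet_scale_def fun_eq_iff)

lemma levelD:
  assumes "P \<in> level K n"
  shows "dir_linear P" "dv y P \<in> level K (n - 1)" "dv y (dv z P) = dv z (dv y P)"
    "n \<noteq> 0 \<Longrightarrow> P [] = 0" "n = 0 \<Longrightarrow> dv y P = 0"
proof -
  have "const_jet 0 = 0" by (simp add: const_jet_def fun_eq_iff)
  then have c0: "0 \<in> range const_jet" by (metis rangeI)
  have "dir_linear P \<and> dv y P \<in> level K (n - 1) \<and> dv y (dv z P) = dv z (dv y P) \<and>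
    (n \<noteq> 0 \<longrightarrow> P [] = 0) \<and> (n = 0 \<longrightarrow> dv y P = 0)"
    using assms
    by (cases "(K, n)" rule: level.cases)
      (auto simp: dir_linear_def const_add const_scale mat_vec_simps dv_linear jet.scale_zero_right c0)
  then show "dir_linear P" "dv y P \<in> level K (n - 1)" "dv y (dv z P) = dv z (dv y P)"
    "n \<noteq> 0 \<Longrightarrow> P [] = 0" "n = 0 \<Longrightarrow> dv y P = 0" by auto
qed

lemma dir_linear_subspace:
  "dir_linear 0" "dir_linear P \<Longrightarrow> dir_linear Q \<Longrightarrow> dir_linear (P + Q)"
  "dir_linear P \<Longrightarrow> dir_linear (jet_scale c P)"
  by (simp_all add: dir_linear_def dv_linear jet.scale_right_distrib mult.commute)

lemma subspace_level:
  assumes "gl.subspace K"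
  shows "jet.subspace (level K n)"
  using assms
proof (induction K n rule: level.induct)
  case (1 K)
  have "const_jet 0 = 0" by (simp add: const_jet_def fun_eq_iff)
  then have c0: "0 \<in> range const_jet" by (metis rangeI)
  show ?case
    by (auto intro!: jet.subspaceI c0 simp flip: const_add const_scale)
next
  case (2 K)
  have c0: "const_jet 0 = 0" by (simp add: const_jet_def fun_eq_iff)
  show ?case
  proof (rule jet.subspaceI)
    show "0 \<in> level K (Suc 0)"
      using gl.subspace_0[OF 2] by (auto simp: dv_linear c0 intro!: bexI[of _ 0])
    show "P + Q \<in> level K (Suc 0)" if PQ: "P \<in> level K (Suc 0)" "Q \<in> level K (Suc 0)" for P Q
    proof -
      obtain A B where "A \<in> K" "B \<in> K" "\<forall>y. dv y P = const_jet (A *v y)" "\<forall>y. dv y Q = const_jet (B *v y)"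
        using PQ by auto
      then show ?thesis using PQ gl.subspace_add[OF 2]
        by (auto simp: dv_linear mat_vec_simps const_add intro!: bexI[of _ "A + B"])
    qed
    show "jet_scale c P \<in> level K (Suc 0)" if P: "P \<in> level K (Suc 0)" for c P
    proof -
      obtain A where "A \<in> K" "\<forall>y. dv y P = const_jet (A *v y)" using P by auto
      then show ?thesis using P gl.subspace_scale[OF 2]
        by (auto simp: dv_linear const_scale intro!: bexI[of _ "mat_scale c A"]) (simp add: jet_scale_def)
    qed
  qed
next
  case (3 K n)
  note S = 3(1)[OF 3(2)]
  have "jet_scale c P [] = 0" if "P [] = 0" for c and P :: "'a field_jet" using that by (simp add: jet_scale_def)
  then show ?case
    by (auto intro!: jet.subspaceI dir_linear_subspace
        simp: dv_linear jet.subspace_0[OF S] jet.subspace_add[OF S] jet.subspace_scale[OF S])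
qed

context irreducible_sp
begin

abbreviation lev :: "nat \<Rightarrow> 'n field_jet set" where "lev \<equiv> level K"

lemmas subspace_lev = subspace_level[OF subspace_K]

lemma act_lev:
  assumes "A \<in> K" "P \<in> lev n"
  shows "act A P \<in> lev n"
  using assms(2)
proof (induction n arbitrary: P)
  case 0
  then obtain v where P: "P = const_jet v" by auto
  have "act A P = const_jet (A *v v)"
    by (rule jet_eqI) (simp_all add: P act_nil dv_act act_linear)
  then show ?case by simp
next
  case (Suc n)
  note IH = Suc.IH and P = levelD[OF Suc.prems]
  show ?case
  proof (cases n)
    case 0
    then obtain B where B: "B \<in> K" "\<And>y. dv y P = const_jet (B *v y)" "P [] = 0" using Suc.prems by auto
    have a: "act A (const_jet v) = const_jet (A *v v)" for v
      by (rule jet_eqI) (simp_all add: act_nil dv_act act_linear)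
    have d: "const_jet u - const_jet v = const_jet (u - v)" for u v :: "complex^'n"
      by (simp add: const_jet_def fun_eq_iff)
    have "dv y (act A P) = const_jet (commutator A B *v y)" for y
      by (simp add: dv_act B a d commutator_vec)
    moreover have "act A P [] = 0" by (simp add: act_nil B)
    ultimately show ?thesis using 0 commutator_K[OF assms(1) B(1)] by auto
  next
    case (Suc m)
    have "act A P [] = 0" by (simp add: act_nil P)
    moreover have "dir_linear (act A P)"
      by (simp add: dir_linear_def dv_act dir_linearD[OF P(1)] act_linear matrix_vector_right_distrib
          matrix_vec_scale jet.scale_right_diff_distrib)
    moreover have "dv y (act A P) \<in> lev n" for y
      using IH[of "dv y P"] P(2) subspace_lev by (simp add: dv_act jet.subspace_diff)
    moreover have "dv y (dv z (act A P)) = dv z (dv y (act A P))" for y z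
      using P(3) by (simp add: dv_act dv_linear)
    ultimately show ?thesis using Suc by simp
  qed
qed

lemma act_commutator:
  assumes "P \<in> lev n"
  shows "act (commutator A B) P = act A (act B P) - act B (act A P)"
  using assms
proof (induction n arbitrary: P)
  case 0
  show ?case
    by (rule jet_eqI) (simp_all add: act_nil dv_act dv_linear dv_lambda levelD(5)[OF 0] act_linear commutator_vec)
next
  case (Suc n)
  note P = levelD[OF Suc.prems]
  have c: "act (commutator A B) (dv y P) = act A (act B (dv y P)) - act B (act A (dv y P))" for y
    by (rule Suc.IH) (use P(2) in simp)
  show ?case
    by (rule jet_eqI)
      (simp_all add: c act_nil dv_act dv_linear dv_lambda act_linear P(4)
        dir_linearD[OF P(1)] commutator_vec)
qed

lemma act_add:
  assumes "P \<in> lev n"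
  shows "act (A + B) P = act A P + act B P" "act (mat_scale c A) P = jet_scale c (act A P)"
proof -
  have "act (A + B) P = act A P + act B P \<and> act (mat_scale c A) P = jet_scale c (act A P)"
    using assms
  proof (induction n arbitrary: P)
    case 0
    have c: "jet_scale c (act A P) [] = c *s (A *v P [])" by (simp add: jet_scale_def act_nil)
    show ?case
      by (intro conjI; rule jet_eqI)
        (simp_all add: c act_nil dv_act dv_linear dv_lambda levelD(5)[OF 0] act_linear mat_vec_simps)
  next
    case (Suc n)
    note P = levelD[OF Suc.prems]
    have c: "jet_scale c (act A P) [] = 0" by (simp add: jet_scale_def act_nil P)
    have IH: "act (A + B) (dv y P) = act A (dv y P) + act B (dv y P)"
      "act (mat_scale c A) (dv y P) = jet_scale c (act A (dv y P))" for y
      using Suc.IH[of "dv y P", OF P(2)[of y, unfolded diff_Suc_1]] by blast+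
    show ?case
      by (intro conjI; rule jet_eqI)
        (simp_all add: c IH act_nil dv_act dv_linear dv_lambda act_linear P(4) dir_linearD[OF P(1)] mat_vec_simps
          jet.scale_right_diff_distrib)
  qed
  then show "act (A + B) P = act A P + act B P" "act (mat_scale c A) P = jet_scale c (act A P)" by auto
qed

definition prolongs :: "(complex^'n \<Rightarrow> complex^'n^'n) \<Rightarrow> bool" where
  "prolongs \<phi> \<longleftrightarrow> (\<forall>x. \<phi> x \<in> K) \<and> (\<forall>x y. \<phi> (x + y) = \<phi> x + \<phi> y) \<and>
     (\<forall>c x. \<phi> (c *s x) = mat_scale c (\<phi> x)) \<and> (\<forall>x y. \<phi> x *v y = \<phi> y *v x)"

text \<open>Symmetry of \<open>\<phi> x *v y\<close> is what makes the mixed derivatives of the new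
  field commute.\<close>

lemma quad_lev:
  assumes \<phi>: "prolongs \<phi>" and P: "P \<in> lev n"
  shows "quad \<phi> P \<in> lev (Suc n)"
  using P
proof (induction n arbitrary: P)
  case 0
  then obtain v where P: "P = const_jet v" by auto
  have "act A (const_jet v) = const_jet (A *v v)" for A
    by (rule jet_eqI) (simp_all add: act_nil dv_act act_linear)
  then have "dv y (quad \<phi> P) = const_jet (\<phi> v *v y)" for y
    using \<phi> by (simp add: dv_quad P quad_linear prolongs_def)
  moreover have "\<phi> v \<in> K" using \<phi> by (simp add: prolongs_def)
  ultimately show ?case by (auto simp: quad_nil)
next
  case (Suc n)
  note P = levelD[OF Suc.prems]
  have mem: "dv y (quad \<phi> P) \<in> lev (Suc n)" for y
    unfolding dv_quad
    by (intro jet.subspace_add[OF subspace_lev] act_lev Suc.prems Suc.IH)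
      (use \<phi> P(2) in \<open>auto simp: prolongs_def\<close>)
  have lin: "dir_linear (quad \<phi> P)"
    using \<phi> by (simp add: dir_linear_def dv_quad prolongs_def act_add[OF Suc.prems] dir_linearD[OF P(1)]
        quad_linear jet.scale_right_distrib)
  have "\<phi> x *v y = \<phi> y *v x" for x y using \<phi> by (simp add: prolongs_def)
  then have "dv y (dv z (quad \<phi> P)) = dv z (dv y (quad \<phi> P))" for y z
    using P(3)[of y z] by (simp add: dv_quad dv_linear dv_act)
  then show ?case using mem lin by (simp add: quad_nil)
qed

lemma lev_zero:
  assumes "P \<in> lev n" "vec.span E = UNIV" "\<And>w. set w \<subseteq> E \<Longrightarrow> length w = n \<Longrightarrow> P w = 0"
  shows "P = 0"
  using assms(1,3)
proof (induction n arbitrary: P)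
  case 0
  show ?case
    by (rule jet_eqI) (use 0 levelD(5)[OF 0(1)] in \<open>auto simp: dv_linear dv_lambda\<close>)
next
  case (Suc n)
  note P = levelD[OF Suc.prems(1)]
  have E: "dv y P = 0" if y: "y \<in> E" for y
  proof (rule Suc.IH)
    show "dv y P \<in> lev n" using P(2) by simp
    show "dv y P w = 0" if "set w \<subseteq> E" "length w = n" for w
      using Suc.prems(2)[of "y # w"] that y by (simp add: dv_nil)
  qed
  have "dv y P = 0" for y
  proof -
    have "y \<in> vec.span E" using assms(2) by simp
    then show ?thesis
    proof (induction rule: vec.span_induct_alt)
      case base
      show ?case using dir_linearD(2)[OF P(1), of 0 0] by simp
    next
      case (step c x y)
      then show ?case using E by (simp add: dir_linearD[OF P(1)])
    qed
  qed
  then show ?case using P(4) by (intro jet_eqI[of P 0]) (simp_all add: dv_linear)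
qed

lemma lev_fin_dim: "jet.fin_dim (lev n)"
proof (rule jet.fin_dim_functionals[OF _ subspace_lev])
  let ?I = "{w :: (complex^'n) list. set w \<subseteq> cart_basis \<and> length w = n} \<times> (UNIV :: 'n set)"
  show "finite ?I" by (intro finite_cartesian_product finite_lists_length_eq finite_cart_basis) simp
  show "Vector_Spaces.linear jet_scale (*) (\<lambda>P :: 'n field_jet. case wi of (w, i) \<Rightarrow> P w $ i)" for wi
    by (auto simp: Vector_Spaces.linear_iff jet_scale_def jet.vector_space_axioms
        vector_space_over_itself.vector_space_axioms split: prod.splits)
  fix P assume P: "P \<in> lev n" "\<And>i. i \<in> ?I \<Longrightarrow> (case i of (w, i) \<Rightarrow> P w $ i) = 0"
  show "P = 0"
    by (rule lev_zero[OF P(1), of cart_basis]) (use P(2) in \<open>auto simp: vec_eq_iff\<close>)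
qed

lemma prolongsD:
  assumes "prolongs \<phi>"
  shows "\<phi> x \<in> K" "\<phi> (x + y) = \<phi> x + \<phi> y" "\<phi> (c *s x) = mat_scale c (\<phi> x)" "\<phi> x *v y = \<phi> y *v x"
    "\<phi> (x - y) = \<phi> x - \<phi> y"
proof -
  show 1: "\<phi> x \<in> K" "\<phi> (x + y) = \<phi> x + \<phi> y" "\<phi> (c *s x) = mat_scale c (\<phi> x)" "\<phi> x *v y = \<phi> y *v x" for x y
    using assms unfolding prolongs_def by blast+
  show "\<phi> (x - y) = \<phi> x - \<phi> y" using 1(2)[of "x - y" y] by simp
qed

text \<open>A single \<open>\<phi> x\<close> need not be semisimple. Passing to the generated ideal
  makes \<open>real_semisimple_element\<close> available.\<close>

definition prol_ideal :: "(complex^'n^'n) set" where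
  "prol_ideal = gl.span {\<phi> x | \<phi> x. prolongs \<phi>}"

lemma prolongs_act:
  assumes A: "A \<in> K" and \<phi>: "prolongs \<phi>"
  shows "prolongs (\<lambda>x. commutator A (\<phi> x) - \<phi> (A *v x))"
proof -
  note \<phi>D = prolongsD[OF \<phi>]
  have "commutator A (\<phi> x) - \<phi> (A *v x) \<in> K" for x
    using A \<phi>D(1) commutator_K subspace_K by (intro gl.subspace_diff) auto
  moreover have "(commutator A (\<phi> x) - \<phi> (A *v x)) *v y = (commutator A (\<phi> y) - \<phi> (A *v y)) *v x" for x y
    using \<phi>D(4)[of x y] \<phi>D(4)[of x "A *v y"] \<phi>D(4)[of y "A *v x"] by (simp add: mat_vec_simps)
  moreover have "commutator A (\<phi> (c *s x)) - \<phi> (A *v (c *s x)) = mat_scale c (commutator A (\<phi> x) - \<phi> (A *v x))" for c x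
    by (simp add: \<phi>D matrix_vec_scale commutator_linear gl.scale_right_diff_distrib)
  ultimately show ?thesis
    by (simp add: prolongs_def \<phi>D matrix_vector_right_distrib commutator_linear)
qed

lemma ideal_prol_ideal: "ideal prol_ideal"
  unfolding prol_ideal_def
proof (rule ideal_span)
  let ?E = "{\<phi> x | \<phi> x. prolongs \<phi>}"
  show "?E \<subseteq> K" using prolongsD by blast
  have E: "\<psi> y \<in> gl.span ?E" if "prolongs \<psi>" for \<psi> y
    by (rule gl.span_base) (use that in blast)
  fix A B assume A: "A \<in> K" and "B \<in> ?E"
  then obtain \<phi> x where B: "B = \<phi> x" "prolongs \<phi>" by blast
  have "commutator A B = (commutator A (\<phi> x) - \<phi> (A *v x)) + \<phi> (A *v x)" by (simp add: B)
  also have "\<dots> \<in> gl.span ?E"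
    using E[OF prolongs_act[OF A B(2)], of x] E[OF B(2), of "A *v x"] by (rule gl.span_add)
  finally show "commutator A B \<in> gl.span ?E" .
qed

lemma act_zero [simp]: "act 0 P = 0" if "P \<in> lev n" for P
  using act_add(2)[OF that, of 0 0] by simp

text \<open>On a word of eigenvectors of \<open>S\<close>, the action on fields reduces to
  \<open>S\<close> on the value minus the sum of the eigenvalues of the letters.\<close>

lemma shift_act_word:
  assumes "P \<in> lev n" "set w \<subseteq> B" "\<And>b. b \<in> B \<Longrightarrow> S *v b = d b *s b"
  shows "act S P w = S *v P w - sum_list (map d w) *s P w"
  using assms(1,2)
proof (induction w arbitrary: P n)
  case Nil
  then show ?case by (simp add: act_nil)
next
  case (Cons y w)
  note P = levelD[OF Cons.prems(1)]
  have "act S P (y # w) = act S (dv y P) w - dv (S *v y) P w"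
    using dv_act[of y S P, THEN fun_cong, of w] by (simp add: dv_nil[of y _ w])
  also have "act S (dv y P) w = S *v P (y # w) - sum_list (map d w) *s P (y # w)"
    using Cons.IH[OF P(2), of y] Cons.prems(2) by (simp add: dv_nil[of y P w])
  also have "dv (S *v y) P w = d y *s P (y # w)"
    using Cons.prems(2) assms(3) by (simp add: dir_linearD[OF P(1)]) (simp add: jet_scale_def dv_nil[of y P w])
  finally show ?case by (simp add: vec.scale_left_distrib)
qed

lemma diag_gen_eigen:
  assumes B: "finite B" "vec.independent B" "vec.span B = UNIV"
    and S: "\<And>b. b \<in> B \<Longrightarrow> S *v b = d b *s b" and v: "v \<in> eigen S c"
  shows "S *v v = c *s v" "v \<noteq> 0 \<Longrightarrow> c \<in> d ` B"
proof -
  let ?r = "vec.representation B v"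
  have v_eq: "(\<Sum>b\<in>B. ?r b *s b) = v" using vec.sum_representation_eq[of B v B] B by simp
  obtain k where k: "(vs.shift ((*v) S) c ^^ k) v = 0" using v by (auto simp: vs.gen_eigen_def)
  note D = vs.endoD[OF vs.endo_funpow[OF vs.endo_shift[OF endo_matrix]]]
  have "(vs.shift ((*v) S) c ^^ k) b = (d b - c) ^ k *s b" if "b \<in> B" for b k
    by (induction k) (use that S in \<open>auto simp: vs.shift_def mat_vec_simps vec.scale_left_diff_distrib algebra_simps\<close>)
  then have "(vs.shift ((*v) S) c ^^ k) (\<Sum>b\<in>B. ?r b *s b) = (\<Sum>b\<in>B. (?r b * (d b - c) ^ k) *s b)"
    by (simp add: D)
  then have "(\<Sum>b\<in>B. (?r b * (d b - c) ^ k) *s b) = 0" using k v_eq by simp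
  then have "\<forall>b\<in>B. ?r b * (d b - c) ^ k = 0"
    using vec.independentD[OF B(2,1) order.refl, of "\<lambda>b. ?r b * (d b - c) ^ k"] by blast
  then have r: "?r b = 0 \<or> d b = c" if "b \<in> B" for b using that by auto
  have "S *v v = (\<Sum>b\<in>B. ?r b *s (d b *s b))"
    using vs.endoD(6)[OF endo_matrix, of S "\<lambda>b. ?r b *s b" B] S by (simp add: v_eq matrix_vec_scale)
  also have "\<dots> = (\<Sum>b\<in>B. c *s (?r b *s b))" using r by (intro sum.cong) auto
  also have "\<dots> = c *s v" by (simp only: v_eq flip: vec.scale_sum_right)
  finally show "S *v v = c *s v" .
  show "c \<in> d ` B" if "v \<noteq> 0"
  proof -
    have "\<exists>b\<in>B. ?r b \<noteq> 0"
    proof (rule ccontr)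
      assume "\<not> ?thesis"
      then have "(\<Sum>b\<in>B. ?r b *s b) = 0" by (intro sum.neutral) simp
      then show False using v_eq that by simp
    qed
    then obtain b where "b \<in> B" "?r b \<noteq> 0" by blast
    then show ?thesis using r by blast
  qed
qed

text \<open>By \<open>shift_act_word\<close>, the values on words over \<open>B\<close> of a
  generalized eigenvector of \<open>act S\<close> are generalized eigenvectors of the diagonalizable
  \<open>S\<close>, hence eigenvectors. Its eigenvalue is some \<open>d b\<close> minus a sum of
  values of \<open>d\<close>, hence real.\<close>

lemma level_eigenbasis:
  assumes B: "finite B" "vec.independent B" "vec.span B = UNIV" and SK: "S \<in> K"
    and S: "\<And>b. b \<in> B \<Longrightarrow> S *v b = of_real (d b) *s b"
  obtains C e where "finite C" "jet.independent C" "jet.span C = lev n"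
    "\<And>P. P \<in> C \<Longrightarrow> act S P = jet_scale (of_real (e P)) P"
proof -
  have eig: "act S P = jet_scale a P \<and> (P \<noteq> 0 \<longrightarrow> a \<in> \<real>)" if P: "P \<in> lev n" "P \<in> jet.gen_eigen (act S) a" for P a
  proof -
    obtain k where k: "(jet.shift (act S) a ^^ k) P = 0" using P(2) by (auto simp: jet.gen_eigen_def)
    let ?c = "\<lambda>w. a + sum_list (map (\<lambda>b. of_real (d b)) w)"
    have mem: "(jet.shift (act S) a ^^ k) P \<in> lev n" for k
      by (induction k) (use P(1) in \<open>auto intro!: jet.shift_in_subspace subspace_lev act_lev SK\<close>)
    have "((jet.shift (act S) a ^^ k) P) w = (vs.shift ((*v) S) (?c w) ^^ k) (P w)" if w: "set w \<subseteq> B" for w k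
    proof (induction k)
      case (Suc k)
      let ?Q = "(jet.shift (act S) a ^^ k) P"
      have "jet.shift (act S) a ?Q w = act S ?Q w - a *s ?Q w" by (simp add: jet.shift_def jet_scale_def)
      also have "\<dots> = vs.shift ((*v) S) (?c w) (?Q w)"
        using shift_act_word[OF mem w S, of k] by (simp add: vs.shift_def vec.scale_left_distrib)
      finally show ?case using Suc by simp
    qed simp
    then have ge: "P w \<in> eigen S (?c w)" if "set w \<subseteq> B" for w
      using k that by (auto simp: vs.gen_eigen_def intro!: exI[of _ k]) (metis zero_fun_apply)
    have diag: "S *v P w = ?c w *s P w" "P w \<noteq> 0 \<Longrightarrow> \<exists>b. ?c w = of_real (d b)"
      if w: "set w \<subseteq> B" for w
      using diag_gen_eigen[OF B, of S "\<lambda>b. of_real (d b)" "P w" "?c w"] S ge[OF w] by auto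
    have "jet.shift (act S) a P = 0"
    proof (rule lev_zero[OF _ B(3)])
      show "jet.shift (act S) a P \<in> lev n" using mem[of 1] by simp
      fix w assume w: "set w \<subseteq> B"
      show "jet.shift (act S) a P w = 0"
        using shift_act_word[OF P(1) w S] diag(1)[OF w]
        by (simp add: jet.shift_def jet_scale_def vec.scale_left_distrib)
    qed
    then have "act S P = jet_scale a P" by (simp add: jet.shift_def)
    moreover have "a \<in> \<real>" if P0: "P \<noteq> 0"
    proof -
      obtain w where w: "set w \<subseteq> B" "P w \<noteq> 0" using lev_zero[OF P(1) B(3)] P0 by blast
      obtain b where "?c w = of_real (d b)" using diag(2)[OF w] by blast
      moreover have "sum_list (map (\<lambda>b. complex_of_real (d b)) w) = of_real (sum_list (map d w))"
        by (induction w) simp_all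
      ultimately have "a = of_real (d b - sum_list (map d w))" by (simp add: algebra_simps)
      then show ?thesis by simp
    qed
    ultimately show ?thesis by blast
  qed
  let ?E = "lev n \<inter> (\<Union>a. jet.gen_eigen (act S) a)"
  obtain F where F: "finite F" "lev n \<subseteq> jet.span F" using lev_fin_dim unfolding jet.fin_dim_def by blast
  have "lev n \<subseteq> jet.span ?E"
    using jet.gen_eigen_span[OF endo_act subspace_lev _ F, of S] act_lev[OF SK] by blast
  then obtain C where C: "finite C" "jet.independent C" "C \<subseteq> ?E" "jet.span C = lev n"
    using jet.finite_basis[OF F, of ?E] subspace_lev by blast
  have "\<exists>r::real. act S P = jet_scale (of_real r) P" if "P \<in> C" for P
  proof -
    obtain a where a: "P \<in> lev n" "P \<in> jet.gen_eigen (act S) a" using C(3) \<open>P \<in> C\<close> by blast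
    have "P \<noteq> 0" using \<open>P \<in> C\<close> C(2) jet.dependent_zero by blast
    then have "act S P = jet_scale a P" "a \<in> \<real>" using eig[OF a] by auto
    then show ?thesis by (metis Reals_cases)
  qed
  then obtain e where "\<And>P. P \<in> C \<Longrightarrow> act S P = jet_scale (of_real (e P)) P" by metis
  then show thesis using that C by blast
qed

text \<open>For \<open>B\<close> and \<open>\<phi> x\<close> in the ideal generated by the prolongation, the trace of
  \<open>B \<circ> dv x \<circ> quad \<phi>\<close> on \<open>lev n\<close> is the sum of the traces of \<open>B \<circ> \<phi> x\<close> on the levels up to \<open>n\<close>;
  it would vanish if \<open>lev (n + 1)\<close> were zero, but for \<open>B = \<phi> x\<close> real semisimple it is positive.\<close>

lemma level_nonzero:
  assumes \<phi>0: "prolongs \<phi>0" "\<phi>0 x0 \<noteq> 0"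
  shows "lev (Suc N) \<noteq> {0}"
proof
  assume zero: "lev (Suc N) = {0}"
  note I = ideal_prol_ideal
  have "\<phi>0 x0 \<in> prol_ideal" using \<phi>0(1) unfolding prol_ideal_def by (intro gl.span_base) blast
  then have "prol_ideal \<noteq> {0}" using \<phi>0(2) by blast
  then obtain S B d where S: "S \<in> prol_ideal" "S \<noteq> 0" "finite B" "vec.independent B" "vec.span B = UNIV"
    "\<And>b. b \<in> B \<Longrightarrow> S *v b = of_real (d b) *s b"
    by (rule real_semisimple_element[OF I]) (rule that)
  have SK: "S \<in> K" using S(1) idealD[OF I] by blast
  have "\<forall>n. \<exists>C e. finite C \<and> jet.independent C \<and> jet.span C = lev n \<and>
    (\<forall>P\<in>C. act S P = jet_scale (of_real (e P)) P)"
    using level_eigenbasis[OF S(3-5) SK S(6)] by metis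
  then obtain C e where C: "\<And>n. finite (C n)" "\<And>n. jet.independent (C n)" "\<And>n. jet.span (C n) = lev n"
    and e: "\<And>n P. P \<in> C n \<Longrightarrow> act S P = jet_scale (complex_of_real (e n P)) P" by metis
  have C_lev: "P \<in> lev n" if "P \<in> C n" for P n using that C(3) jet.span_base by blast
  let ?t = "\<lambda>n f. jet.tr (C n) f"
  have comm: "?t n (\<lambda>P. g (f P)) = ?t m (\<lambda>P. f (g P))"
    if "jet.endo f" "\<And>P. P \<in> lev n \<Longrightarrow> f P \<in> lev m" "jet.endo g" "\<And>P. P \<in> lev m \<Longrightarrow> g P \<in> lev n" for n m f g
    by (rule jet.tr_comm) (use that C in auto)
  have inK: "X \<in> K" if "X \<in> prol_ideal" for X using that idealD[OF I] by blast
  \<comment> \<open>The trace on a level is a functional on the ideal that vanishes on brackets with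
    \<open>K\<close>, so \<open>functional_zero\<close> applies.\<close>
  have t_act: "?t n (act X) = 0" if X: "X \<in> prol_ideal" for n X
  proof (rule functional_zero[OF I X, where l = "\<lambda>X. ?t n (act X)"])
    show "?t n (act (X + Y)) = ?t n (act X) + ?t n (act Y)" if "X \<in> prol_ideal" "Y \<in> prol_ideal" for X Y
    proof -
      have "?t n (act (X + Y)) = ?t n (\<lambda>P. act X P + act Y P)"
        by (rule jet.tr_cong) (rule act_add(1)[OF C_lev])
      then show ?thesis using inK that C C_lev act_lev by (subst (asm) jet.tr_add) auto
    qed
    show "?t n (act (mat_scale c X)) = c * ?t n (act X)" if "X \<in> prol_ideal" for c X
    proof -
      have "?t n (act (mat_scale c X)) = ?t n (\<lambda>P. jet_scale c (act X P))"
        by (rule jet.tr_cong) (rule act_add(2)[OF C_lev])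
      then show ?thesis using inK that C C_lev act_lev by (subst (asm) jet.tr_scale) auto
    qed
    show "?t n (act (commutator X Y)) = 0" if "X \<in> prol_ideal" "Y \<in> K" for X Y
    proof -
      have "?t n (act (commutator X Y)) = ?t n (\<lambda>P. act X (act Y P) - act Y (act X P))"
        by (rule jet.tr_cong) (rule act_commutator[OF C_lev])
      also have "\<dots> = ?t n (\<lambda>P. act X (act Y P)) - ?t n (\<lambda>P. act Y (act X P))"
        using inK that C C_lev act_lev by (intro jet.tr_diff) auto
      also have "\<dots> = 0" using comm[of "act Y" n n "act X"] endo_act act_lev inK that by auto
      finally show ?thesis .
    qed
  qed
  have dvlev: "dv x P \<in> lev n" if "P \<in> lev (Suc n)" for x P n using levelD(2)[OF that] by simp
  have dv0: "dv x P = 0" if "P \<in> lev 0" for x P using levelD(5)[OF that] by simp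
  \<comment> \<open>Commuting \<open>dv x\<close> past \<open>quad \<phi>\<close> costs
    \<open>act (\<phi> x)\<close>, which has trace zero, and cyclicity then moves the trace one
    level down; on level 0 all derivatives vanish.\<close>
  have b: "?t n (\<lambda>P. dv x (quad \<phi> P)) = 0" if \<phi>: "prolongs \<phi>" for n x \<phi>
  proof (induction n)
    have X: "\<phi> x \<in> prol_ideal" using \<phi> unfolding prol_ideal_def by (intro gl.span_base) blast
    case 0
    have "?t 0 (\<lambda>P. dv x (quad \<phi> P)) = ?t 0 (act (\<phi> x))"
      by (rule jet.tr_cong) (simp only: dv_quad dv0[OF C_lev] quad_linear add_0_right)
    then show ?case using t_act[OF X] by simp
  next
    have X: "\<phi> x \<in> prol_ideal" using \<phi> unfolding prol_ideal_def by (intro gl.span_base) blast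
    case (Suc n)
    have "?t (Suc n) (\<lambda>P. dv x (quad \<phi> P)) = ?t (Suc n) (\<lambda>P. act (\<phi> x) P + quad \<phi> (dv x P))"
      by (simp only: dv_quad)
    also have "\<dots> = ?t (Suc n) (act (\<phi> x)) + ?t (Suc n) (\<lambda>P. quad \<phi> (dv x P))"
      by (rule jet.tr_add) (use C C_lev act_lev inK[OF X] quad_lev[OF \<phi>] dvlev in auto)
    also have "?t (Suc n) (\<lambda>P. quad \<phi> (dv x P)) = ?t n (\<lambda>P. dv x (quad \<phi> P))"
      by (rule comm) (use endo_dv endo_quad quad_lev[OF \<phi>] dvlev in auto)
    finally show ?case using Suc t_act[OF X] by simp
  qed
  \<comment> \<open>The same descent with an additional factor \<open>act A\<close>. Moving it back
    past \<open>dv x\<close> leaves a term along \<open>A *v x\<close>, whose trace is zero by the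
    previous step, so the traces of \<open>act A (act (\<phi> x) P)\<close> accumulate over the
    levels.\<close>
  have a: "?t n (\<lambda>P. act A (dv x (quad \<phi> P))) = (\<Sum>j\<le>n. ?t j (\<lambda>P. act A (act (\<phi> x) P)))"
    if \<phi>: "prolongs \<phi>" and A: "A \<in> K" for n x \<phi> A
  proof (induction n)
    case 0
    have "?t 0 (\<lambda>P. act A (dv x (quad \<phi> P))) = ?t 0 (\<lambda>P. act A (act (\<phi> x) P))"
      by (rule jet.tr_cong) (simp only: dv_quad dv0[OF C_lev] quad_linear add_0_right)
    then show ?case by simp
  next
    case (Suc n)
    have X: "\<phi> x \<in> K" using prolongsD[OF \<phi>] by blast
    have "?t (Suc n) (\<lambda>P. act A (dv x (quad \<phi> P)))
        = ?t (Suc n) (\<lambda>P. act A (act (\<phi> x) P) + act A (quad \<phi> (dv x P)))"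
      by (simp only: dv_quad act_linear)
    also have "\<dots> = ?t (Suc n) (\<lambda>P. act A (act (\<phi> x) P)) + ?t (Suc n) (\<lambda>P. act A (quad \<phi> (dv x P)))"
      by (rule jet.tr_add) (use C C_lev act_lev X A quad_lev[OF \<phi>] dvlev in auto)
    also have "?t (Suc n) (\<lambda>P. act A (quad \<phi> (dv x P))) = ?t n (\<lambda>P. dv x (act A (quad \<phi> P)))"
    proof (rule comm[where f = "dv x" and g = "\<lambda>P. act A (quad \<phi> P)"])
      show "jet.endo (\<lambda>P. act A (quad \<phi> P))" by (rule jet.endoI) (simp_all add: act_linear quad_linear)
    qed (use endo_dv act_lev[OF A] quad_lev[OF \<phi>] dvlev in auto)
    also have "\<dots> = ?t n (\<lambda>P. act A (dv x (quad \<phi> P)) - dv (A *v x) (quad \<phi> P))"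
      by (simp only: dv_act)
    also have "\<dots> = ?t n (\<lambda>P. act A (dv x (quad \<phi> P))) - ?t n (\<lambda>P. dv (A *v x) (quad \<phi> P))"
      by (rule jet.tr_diff) (use C C_lev act_lev A quad_lev[OF \<phi>] dvlev in auto)
    finally show ?case using Suc b[OF \<phi>] by simp
  qed
  \<comment> \<open>If level \<open>N + 1\<close> is zero then \<open>quad \<phi>\<close> vanishes
    on level \<open>N\<close>, and so does the left-hand side of \<open>a\<close>. Linearity extends
    this from the generators \<open>\<phi> x\<close> to the ideal, in particular to \<open>S\<close>
    itself.\<close>
  have vanish: "X \<in> prol_ideal \<and> (\<Sum>j\<le>N. ?t j (\<lambda>P. act S (act X P))) = 0" if "X \<in> prol_ideal" for X
    using that[unfolded prol_ideal_def]
  proof (induction rule: gl.span_induct_alt)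
    case base
    have "?t j (\<lambda>P. act S (act 0 P)) = ?t j (\<lambda>P. 0)" for j
      by (rule jet.tr_cong) (simp only: act_zero[OF C_lev] act_linear)
    then show ?case using gl.subspace_0[OF idealD(1)[OF I]] by simp
  next
    case (step c X Y)
    obtain \<phi> x where X: "X = \<phi> x" "prolongs \<phi>" using step(1) by blast
    have XK: "X \<in> K" "X \<in> prol_ideal" using X prolongsD by (auto simp: prol_ideal_def intro!: gl.span_base)
    have YK: "Y \<in> K" using step(2) inK by blast
    have "?t N (\<lambda>P. act S (dv x (quad \<phi> P))) = ?t N (\<lambda>P. 0)"
    proof (rule jet.tr_cong)
      fix P assume "P \<in> C N"
      then have "quad \<phi> P = 0" using quad_lev[OF X(2) C_lev] zero by blast
      then show "act S (dv x (quad \<phi> P)) = 0" by (simp only: dv_linear act_linear)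
    qed
    then have "(\<Sum>j\<le>N. ?t j (\<lambda>P. act S (act X P))) = 0" using a[OF X(2) SK, of N x] X(1) by simp
    moreover have "?t j (\<lambda>P. act S (act (mat_scale c X + Y) P))
        = c * ?t j (\<lambda>P. act S (act X P)) + ?t j (\<lambda>P. act S (act Y P))" for j
    proof -
      have "?t j (\<lambda>P. act S (act (mat_scale c X + Y) P))
          = ?t j (\<lambda>P. jet_scale c (act S (act X P)) + act S (act Y P))"
        by (rule jet.tr_cong) (simp only: act_add[OF C_lev] act_linear)
      also have "\<dots> = ?t j (\<lambda>P. jet_scale c (act S (act X P))) + ?t j (\<lambda>P. act S (act Y P))"
        by (rule jet.tr_add) (use C C_lev act_lev XK YK SK jet.subspace_scale[OF subspace_lev] in auto)
      also have "?t j (\<lambda>P. jet_scale c (act S (act X P))) = c * ?t j (\<lambda>P. act S (act X P))"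
        by (rule jet.tr_scale) (use C C_lev act_lev XK SK in auto)
      finally show ?thesis .
    qed
    ultimately have "(\<Sum>j\<le>N. ?t j (\<lambda>P. act S (act (mat_scale c X + Y) P))) = 0"
      using step(2) by (simp add: sum.distrib flip: sum_distrib_left)
    then show ?case
      using XK(2) step(2) idealD(1)[OF I] by (simp add: gl.subspace_add gl.subspace_scale)
  qed
  have sq: "?t j (\<lambda>P. act S (act S P)) = of_real (\<Sum>P\<in>C j. (e j P)\<^sup>2)" for j
    unfolding of_real_sum
    by (rule jet.tr_eigen) (use C e in \<open>auto simp: act_linear power2_eq_square\<close>)
  \<comment> \<open>Real eigenvalues make this a vanishing sum of real squares. Level 0 alone, a
    copy of the vector space itself, then gives \<open>S = 0\<close>.\<close>
  have "(\<Sum>j\<le>N. \<Sum>P\<in>C j. (e j P)\<^sup>2) = 0"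
    using vanish[OF S(1), THEN conjunct2] unfolding sq of_real_sum[symmetric] by (simp only: of_real_eq_0_iff)
  then have "\<forall>j\<le>N. (\<Sum>P\<in>C j. (e j P)\<^sup>2) = 0"
    by (simp add: sum_nonneg_eq_0_iff sum_nonneg)
  then have "(\<Sum>P\<in>C 0. (e 0 P)\<^sup>2) = 0" by blast
  then have e0: "e 0 P = 0" if "P \<in> C 0" for P
    using that C(1)[of 0] by (simp add: sum_nonneg_eq_0_iff)
  have "act S P = 0" if "P \<in> lev 0" for P
  proof -
    have "P \<in> jet.span (C 0)" using that C(3) by simp
    then show ?thesis
    proof (induction rule: jet.span_induct_alt)
      case (step c x y)
      then show ?case using e[OF step(1)] e0[OF step(1)] by (simp only: act_linear of_real_0 jet.scale_zero_left jet.scale_zero_right add_0)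
    qed (simp only: act_linear)
  qed
  then have "act S (const_jet v) [] = 0" for v by simp
  then have "S = 0" by (simp add: act_nil matrix_eq)
  then show False using S(2) by contradiction
qed

end

lemma minus_mat_vec: "(- A) *v x = - (A *v x)" for A :: "complex^'n^'n"
  by (simp add: vec_eq_iff matrix_vector_mult_def sum_negf)

lemma nonincreasing_eventually_constant:
  fixes f :: "nat \<Rightarrow> nat"
  assumes "\<And>n. m \<le> n \<Longrightarrow> f (Suc n) \<le> f n"
  obtains k where "m \<le> k" "\<And>n. k \<le> n \<Longrightarrow> f (Suc n) = f n"
proof -
  obtain k where k: "m \<le> k" "\<And>n. m \<le> n \<Longrightarrow> f k \<le> f n"
    using ex_has_least_nat[of "\<lambda>n. m \<le> n" m f] by auto
  have "f n \<le> f k" if "k \<le> n" for n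
    using that
  proof (induction rule: dec_induct)
    case (step n)
    then show ?case using assms[of n] k(1) by linarith
  qed simp
  then have "f n = f k" if "k \<le> n" for n using k that by (metis le_trans order_antisym)
  then show thesis using that[of k] k(1) by (metis le_SucI)
qed

section \<open>Existence of a rank one element\<close>

context irreducible_sp
begin

definition lev_ann :: "(complex^'n) set \<Rightarrow> nat \<Rightarrow> 'n field_jet set" where
  "lev_ann U n = {P \<in> lev n. \<forall>u\<in>U. dv u P = 0}"

lemma subspace_lev_ann: "jet.subspace (lev_ann U n)"
  unfolding lev_ann_def using subspace_lev[of n]
  by (auto intro!: jet.subspaceI simp: jet.subspace_0 jet.subspace_add jet.subspace_scale dv_linear)

lemma lev_ann_dv:
  assumes P: "P \<in> lev_ann U (Suc n)" shows "dv y P \<in> lev_ann U n"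
proof -
  have PD: "P \<in> lev (Suc n)" "\<And>u. u \<in> U \<Longrightarrow> dv u P = 0" using P by (auto simp: lev_ann_def)
  have "dv u (dv y P) = 0" if "u \<in> U" for u
    unfolding levelD(3)[OF PD(1), of u y] PD(2)[OF that] by (rule dv_linear)
  then show ?thesis using levelD(2)[OF PD(1), of y] by (simp add: lev_ann_def)
qed

lemma lev_ann_span:
  "P \<in> lev_ann (vec.span (insert y U)) n \<longleftrightarrow> P \<in> lev_ann U n \<and> dv y P = 0"
proof
  show "P \<in> lev_ann U n \<and> dv y P = 0" if "P \<in> lev_ann (vec.span (insert y U)) n"
    using that by (auto simp: lev_ann_def intro: vec.span_base)
  assume P: "P \<in> lev_ann U n \<and> dv y P = 0"
  then have lin: "dir_linear P" using levelD(1)[of P K n] by (simp add: lev_ann_def)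
  have "dv u P = 0" if "u \<in> vec.span (insert y U)" for u
    using that
  proof (induction rule: vec.span_induct_alt)
    case base show ?case using dir_linearD(2)[OF lin, of 0 0] by simp
  next
    case (step c x z)
    then show ?case using P by (auto simp: dir_linearD[OF lin] lev_ann_def)
  qed
  then show "P \<in> lev_ann (vec.span (insert y U)) n" using P by (simp add: lev_ann_def)
qed

lemma lev_dv_zero: "P \<in> lev (Suc n) \<Longrightarrow> (\<And>y. dv y P = 0) \<Longrightarrow> P = 0"
  using levelD(4)[of P K "Suc n"] by (intro jet_eqI[of P 0]) (simp_all add: dv_linear)

lemma lev_ann_down:
  assumes "lev_ann U (Suc m) = {0}" "m \<le> n"
  shows "lev_ann U (Suc n) = {0}"
  using assms(2)
proof (induction rule: dec_induct)
  case (step n)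
  have "P = 0" if P: "P \<in> lev_ann U (Suc (Suc n))" for P
  proof (rule lev_dv_zero)
    show "P \<in> lev (Suc (Suc n))" using P unfolding lev_ann_def by blast
    show "dv y P = 0" for y using lev_ann_dv[OF P, of y] unfolding step.IH by blast
  qed
  then show ?case using jet.subspace_0[OF subspace_lev_ann] by blast
qed (rule assms(1))

text \<open>Choose a maximal \<open>U\<close> annihilating nonzero elements in every level. If \<open>y\<close>, \<open>z\<close> are independent
  modulo \<open>U\<close>, then differentiation along \<open>y\<close> is eventually bijective, and an eigenvector of
  \<open>dv z \<circ> (dv y)\<^sup>-\<^sup>1\<close> for \<open>c\<close> shows that \<open>U\<close> can be enlarged by \<open>z - c y\<close>.\<close>

lemma rank_one_element:
  assumes ne: "\<And>n. lev (Suc n) \<noteq> {0}"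
  obtains A v where "A \<in> K" "A \<noteq> 0" "\<And>x. \<exists>c. A *v x = c *s v"
proof -
  define good where "good U \<longleftrightarrow> vec.subspace U \<and> (\<forall>n. lev_ann U (Suc n) \<noteq> {0})" for U
  have "lev_ann {0} n = lev n" for n
    using dir_linearD(2)[OF levelD(1), of _ K n 0 0] by (auto simp: lev_ann_def)
  then have "good {0}" using ne by (simp add: good_def vec.subspace_single_0)
  moreover have "\<forall>U. good U \<longrightarrow> vec.dim U < Suc CARD('n)"
    using vec.dim_subset_UNIV by (auto simp: less_Suc_eq_le vec.dimension_def card_cart_basis)
  ultimately have "\<exists>U. good U \<and> (\<forall>U'. good U' \<longrightarrow> vec.dim U' \<le> vec.dim U)"
    by (rule ex_has_greatest_nat[where b = "Suc CARD('n)"])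
  then obtain U where U: "good U" and max: "\<And>U'. good U' \<Longrightarrow> vec.dim U' \<le> vec.dim U" by blast
  have sU: "vec.subspace U" "\<And>n. lev_ann U (Suc n) \<noteq> {0}" using U by (auto simp: good_def)
  have spanU: "vec.span U = U" using sU(1) by (simp only: vec.span_eq_iff)
  have not_good: "\<not> good (vec.span (insert x U))" if "x \<notin> U" for x
  proof
    assume "good (vec.span (insert x U))"
    then have "vec.dim (insert x U) \<le> vec.dim U" using max by fastforce
    then show False using vec.dim_insert[of x U] that by (simp add: spanU)
  qed
  \<comment> \<open>Level 1 supplies a nonzero \<open>A\<close> in \<open>K\<close> that kills
    \<open>U\<close>; it has rank one as soon as \<open>U\<close> and one further vector span the
    space.\<close>
  obtain P where P: "P \<in> lev_ann U (Suc 0)" "P \<noteq> 0"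
    using sU(2)[of 0] jet.subspace_0[OF subspace_lev_ann] by blast
  then obtain A where A: "A \<in> K" "\<And>x. dv x P = const_jet (A *v x)" by (auto simp: lev_ann_def)
  have AU: "A *v u = 0" if "u \<in> U" for u
  proof -
    have "dv u P = 0" using P(1) that by (simp add: lev_ann_def)
    then have "const_jet (A *v u) [] = 0" using A(2) by simp
    then show ?thesis by simp
  qed
  have "A \<noteq> 0"
  proof
    assume "A = 0"
    then have "dv x P = 0" for x using A(2) by (simp add: const_jet_def fun_eq_iff)
    then show False using lev_dv_zero[of P 0] P by (auto simp: lev_ann_def)
  qed
  then obtain y where y: "y \<notin> U" using AU by (auto simp: matrix_eq)
  let ?Uy = "vec.span (insert y U)"
  obtain m where "lev_ann ?Uy (Suc m) = {0}"
    using not_good[OF y] by (auto simp: good_def)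
  then have m: "lev_ann ?Uy (Suc n) = {0}" if "m \<le> n" for n using lev_ann_down that by blast
  have inj: "Q = 0" if "Q \<in> lev_ann U (Suc n)" "dv y Q = 0" "m \<le> n" for Q n
    using m[OF that(3)] lev_ann_span[of Q y U "Suc n"] that by auto
  have fin: "jet.fin_dim (lev_ann U n)" for n
    by (rule jet.fin_dim_subset[OF lev_fin_dim]) (auto simp: lev_ann_def)
  \<comment> \<open>A vector \<open>z\<close> outside would allow \<open>U\<close> to be enlarged,
    against its maximality.\<close>
  have "z \<in> ?Uy" for z
  proof (rule ccontr)
    assume z: "z \<notin> ?Uy"
    have "\<forall>n. \<exists>C. finite C \<and> jet.independent C \<and> jet.span C = lev_ann U (Suc n)"
      using jet.fin_dim_basis[OF fin subspace_lev_ann] by metis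
    then obtain C where C: "\<And>n. finite (C n)" "\<And>n. jet.independent (C n)"
      "\<And>n. jet.span (C n) = lev_ann U (Suc n)" by metis
    \<comment> \<open>From degree \<open>m + 1\<close> on, no nonzero element annihilated by
      \<open>U\<close> is also annihilated by \<open>y\<close>. So \<open>dv y\<close> is injective
      between consecutive levels, the dimensions decrease, and once they are constant it is
      bijective.\<close>
    have "card (C (Suc n)) \<le> card (C n)" if "m \<le> n" for n
    proof (rule jet.injective_on_span(1)[OF C(1,2,1) endo_dv[of y]])
      show "dv y Q \<in> jet.span (C n)" if "Q \<in> jet.span (C (Suc n))" for Q
        using that lev_ann_dv unfolding C(3) by blast
      show "Q = 0" if "Q \<in> jet.span (C (Suc n))" "dv y Q = 0" for Q
        using inj[of Q "Suc n"] that \<open>m \<le> n\<close> unfolding C(3) by simp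
    qed
    then obtain k where k: "m \<le> k" "\<And>n. k \<le> n \<Longrightarrow> card (C (Suc n)) = card (C n)"
      using nonincreasing_eventually_constant[of m "\<lambda>n. card (C n)"] by blast
    have surj: "\<exists>P\<in>lev_ann U (Suc (Suc n)). dv y P = Q" if n: "k \<le> n" and Q: "Q \<in> lev_ann U (Suc n)" for n Q
      unfolding C(3)[of "Suc n", symmetric]
    proof (rule jet.injective_on_span(2)[OF C(1,2,1) endo_dv[of y] _ _ k(2)[OF n]])
      show "dv y Q \<in> jet.span (C n)" if "Q \<in> jet.span (C (Suc n))" for Q
        using that lev_ann_dv unfolding C(3) by blast
      show "Q = 0" if "Q \<in> jet.span (C (Suc n))" "dv y Q = 0" for Q
        using inj[of Q "Suc n"] that n k(1) unfolding C(3) by simp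
      show "Q \<in> jet.span (C n)" using Q unfolding C(3) .
    qed
    let ?W = "lev_ann U (Suc k)"
    have "inj_on (dv y) (lev_ann U (Suc (Suc k)))"
    proof (rule inj_onI)
      fix Q Q' assume Q: "Q \<in> lev_ann U (Suc (Suc k))" "Q' \<in> lev_ann U (Suc (Suc k))" "dv y Q = dv y Q'"
      then have "Q - Q' = 0"
        using inj[of "Q - Q'" "Suc k"] k(1) jet.subspace_diff[OF subspace_lev_ann Q(1,2)] by (simp add: dv_linear)
      then show "Q = Q'" by simp
    qed
    \<comment> \<open>The inverse of \<open>dv y\<close>. Composed with \<open>dv z\<close> it gives
      an endomorphism of one finite-dimensional level, so that an eigenvalue \<open>c\<close>
      exists.\<close>
    then obtain g where g: "jet.endo g" "\<And>Q. Q \<in> lev_ann U (Suc (Suc k)) \<Longrightarrow> g (dv y Q) = Q"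
      using jet.pair.linear_exists_left_inverse_on[OF endo_dv subspace_lev_ann, of y U "Suc (Suc k)"] by blast
    have gW: "g Q \<in> lev_ann U (Suc (Suc k)) \<and> dv y (g Q) = Q" if "Q \<in> ?W" for Q
      using surj[OF order.refl that] g(2) by force
    obtain Q0 where Q0: "Q0 \<in> ?W" "Q0 \<noteq> 0" using sU(2) jet.subspace_0[OF subspace_lev_ann] by blast
    obtain F where F: "finite F" "?W \<subseteq> jet.span F" using fin unfolding jet.fin_dim_def by blast
    have "jet.endo (\<lambda>Q. dv z (g Q))"
      by (rule jet.endoI) (simp_all add: jet.endoD[OF g(1)] dv_linear)
    moreover have "dv z (g Q) \<in> ?W" if "Q \<in> ?W" for Q using gW[OF that] lev_ann_dv by blast
    ultimately obtain Q c where Q: "Q \<in> ?W" "Q \<noteq> 0" "dv z (g Q) = jet_scale c Q"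
      using jet.eigenvector_exists[OF _ subspace_lev_ann _ F Q0, of "\<lambda>Q. dv z (g Q)"] by metis
    let ?x = "z - c *s y"
    \<comment> \<open>Lifts through \<open>dv y\<close> stay annihilated by \<open>?x\<close>,
      because derivatives commute and \<open>dv y\<close> is injective. This produces nonzero
      elements in all higher levels, and \<open>lev_ann_down\<close> covers the lower ones.\<close>
    have chain: "\<exists>P\<in>lev_ann U (Suc (Suc (k + j))). P \<noteq> 0 \<and> dv ?x P = 0" for j
    proof (induction j)
      case 0
      have gQ: "g Q \<in> lev_ann U (Suc (Suc k))" "dv y (g Q) = Q" using gW[OF Q(1)] by auto
      then have lin: "dir_linear (g Q)" using levelD(1)[of "g Q" K] by (auto simp: lev_ann_def)
      have "dv ?x (g Q) = 0" by (simp add: dir_linearD[OF lin] gQ Q(3))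
      moreover have "g Q \<noteq> 0" using gQ(2) Q(2) by (auto simp: dv_linear)
      ultimately show ?case using gQ(1) unfolding add_0_right by blast
    next
      case (Suc j)
      then obtain P where P: "P \<in> lev_ann U (Suc (Suc (k + j)))" "P \<noteq> 0" "dv ?x P = 0" by blast
      obtain P' where P': "P' \<in> lev_ann U (Suc (Suc (Suc (k + j))))" "dv y P' = P"
        using surj[OF _ P(1)] by auto
      have "dv y (dv ?x P') = dv ?x (dv y P')"
        using P'(1) levelD(3)[of P' K] by (auto simp: lev_ann_def)
      then have "dv ?x P' = 0"
        using inj[of "dv ?x P'" "Suc (k + j)"] lev_ann_dv[OF P'(1), of ?x] P' P(3) k(1) by simp
      moreover have "P' \<noteq> 0" using P'(2) P(2) by (auto simp: dv_linear)
      ultimately show ?case using P'(1) unfolding add_Suc_right by blast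
    qed
    have x: "?x \<notin> U"
    proof
      assume "?x \<in> U"
      then have "?x + c *s y \<in> ?Uy" by (intro vec.span_add vec.span_scale vec.span_base) auto
      then show False using z by simp
    qed
    have "lev_ann (vec.span (insert ?x U)) (Suc n) \<noteq> {0}" for n
    proof
      assume "lev_ann (vec.span (insert ?x U)) (Suc n) = {0}"
      then have "lev_ann (vec.span (insert ?x U)) (Suc (Suc (k + n))) = {0}"
        by (rule lev_ann_down) simp
      moreover obtain P where "P \<in> lev_ann U (Suc (Suc (k + n)))" "P \<noteq> 0" "dv ?x P = 0"
        using chain by blast
      ultimately show False using lev_ann_span[of P ?x U] by blast
    qed
    then show False using not_good[OF x] by (simp add: good_def)
  qed
  then have "\<exists>c. A *v x = c *s (A *v y)" for x
  proof -
    obtain c where "x - c *s y \<in> U"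
      using \<open>\<And>z. z \<in> ?Uy\<close>[of x] unfolding vec.span_insert spanU by blast
    then have "A *v (x - c *s y) = 0" by (rule AU)
    then have "A *v x = c *s (A *v y)" by (simp add: mat_vec_simps)
    then show ?thesis by blast
  qed
  then show thesis using that A(1) \<open>A \<noteq> 0\<close> by blast
qed

subsection \<open>Rank one elements\<close>

lemma form_sum: "\<Omega> x (\<Sum>i\<in>I. f i) = (\<Sum>i\<in>I. \<Omega> x (f i))"
  by (induction I rule: infinite_finite_induct) (simp_all add: form_linear)

text \<open>The element of \<open>sp\<close> that corresponds to the product of \<open>x\<close> and
  \<open>y\<close> in the symmetric square.\<close>

definition sq :: "complex^'n \<Rightarrow> complex^'n \<Rightarrow> complex^'n^'n" where
  "sq x y = matrix (\<lambda>z. \<Omega> x z *s y + \<Omega> y z *s x)"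

lemma sq_vec: "sq x y *v z = \<Omega> x z *s y + \<Omega> y z *s x"
  unfolding sq_def
  by (rule matrix_of_endo, rule vs.endoI)
    (simp_all add: form_linear vec.scale_left_distrib vec.scale_right_distrib)

lemma sq_self: "sq x x *v z = (2 * \<Omega> x z) *s x"
  by (simp add: sq_vec flip: vec.scale_left_distrib)

lemma sq_linear:
  "sq (x + x') y = sq x y + sq x' y" "sq y (x + x') = sq y x + sq y x'"
  "sq (c *s x) y = mat_scale c (sq x y)" "sq y (c *s x) = mat_scale c (sq y x)" "sq x y = sq y x"
  "sq 0 x = 0" "sq x 0 = 0"
  by (simp_all add: matrix_eq sq_vec mat_vec_simps form_linear vec.scale_left_distrib
      vec.scale_right_distrib mult.commute)

lemma commutator_sq: "A \<in> sp \<Omega> \<Longrightarrow> commutator A (sq x y) = sq (A *v x) y + sq x (A *v y)"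
  by (simp add: matrix_eq sq_vec mat_vec_simps spD)

text \<open>Pairing with squares under the trace form recovers the quadratic form of
  \<open>A\<close>.\<close>

lemma trace_sq: "trace (A ** sq x x) = 2 * \<Omega> x (A *v x)"
proof -
  have "(A ** sq x x) $ i $ i = 2 * (\<Omega> x (axis i 1) * (A *v x) $ i)" for i
  proof -
    have "(A ** sq x x) $ i $ i = ((A ** sq x x) *v axis i 1) $ i"
      by (simp add: matrix_vector_mult_def axis_def if_distrib cong: if_cong)
    also have "(A ** sq x x) *v axis i 1 = A *v (sq x x *v axis i 1)"
      by (simp only: matrix_vector_mul_assoc)
    finally show ?thesis by (simp add: sq_self mat_vec_simps)
  qed
  then have "trace (A ** sq x x) = 2 * (\<Sum>i\<in>UNIV. \<Omega> x ((A *v x) $ i *s axis i 1))"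
    by (simp add: trace_def form_linear sum_distrib_left mult_ac)
  then show ?thesis by (simp only: basis_expansion flip: form_sum)
qed

lemma commutator_sq_K:
  "A \<in> K \<Longrightarrow> sq x y \<in> K \<Longrightarrow> sq (A *v x) y + sq x (A *v y) \<in> K"
  using commutator_K[of A "sq x y"] commutator_sq[of A x y] K_sp by auto

definition squares :: "(complex^'n) set" where "squares = {x. sq x x \<in> K}"

lemmas K_closed = gl.subspace_add[OF subspace_K] gl.subspace_diff[OF subspace_K]
  gl.subspace_scale[OF subspace_K]

lemma K_scaleD:
  assumes "mat_scale c A \<in> K" "c \<noteq> 0" shows "A \<in> K"
  using K_closed(3)[OF assms(1), of "1 / c"] assms(2) by simp

text \<open>\<open>sq x x\<close> is a nonzero element of \<open>K\<close>, so by nondegeneracy it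
  pairs nontrivially with some \<open>A\<close>, and \<open>trace_sq\<close> turns this pairing into
  \<Omega>.\<close>

lemma squares_witness:
  assumes "x \<in> squares" "x \<noteq> 0"
  obtains A where "A \<in> K" "\<Omega> (A *v x) x \<noteq> 0"
proof -
  obtain z where z: "\<Omega> x z \<noteq> 0" using form_nondegenerate assms(2) by blast
  then have "sq x x \<noteq> 0" using sq_self[of x z] assms(2) by auto
  then obtain A where A: "A \<in> K" "trace (sq x x ** A) \<noteq> 0"
    using trace_form_nondegenerate[OF ideal_K] assms(1) unfolding squares_def by blast
  then have "\<Omega> x (A *v x) \<noteq> 0" using trace_sq[of A x] trace_mul_sym[of A "sq x x"] by simp
  then show thesis using that A(1) form_swap[of x "A *v x"] by simp
qed

text \<open>If \<open>\<Omega> y x \<noteq> 0\<close> for \<open>y = A x\<close>, then \<open>H = sq x y / \<Omega> y x\<close> has eigenvalues \<open>1, 0, -1\<close>, and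
  \<open>sq y y\<close> is the component of weight \<open>-2\<close> of \<open>[A, [A, sq x x]]\<close>.\<close>

lemma squares_step:
  assumes x: "x \<in> squares" and A: "A \<in> K" and nz: "\<Omega> (A *v x) x \<noteq> 0"
  shows "A *v x \<in> squares"
proof -
  define y where "y = A *v x"
  define H where "H = mat_scale (1 / \<Omega> y x) (sq x y)"
  have "sq y x + sq x y \<in> K" using commutator_sq_K[OF A] x by (simp add: squares_def y_def)
  then have xy: "sq x y \<in> K"
    using K_scaleD[of 2 "sq x y"] sq_linear(5)[of y x]
    by (simp add: gl.scale_left_distrib[of 1 1, simplified])
  then have HK: "H \<in> K" unfolding H_def by (rule K_closed)
  have Hx: "H *v x = x" "H *v y = - y"
    using nz form_swap[of x y] by (simp_all add: H_def sq_vec y_def)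
  have H3: "H *v (H *v (H *v z)) = H *v z" for z
  proof -
    have "H *v z = (\<Omega> x z / \<Omega> y x) *s y + (\<Omega> y z / \<Omega> y x) *s x"
      by (simp add: H_def sq_vec vec.scale_right_distrib)
    then show ?thesis by (simp add: mat_vec_simps Hx)
  qed
  \<comment> \<open>Half of \<open>[A, [A, sq x x]]\<close> is \<open>E (A *v y) 1\<close>. Since
    \<open>H\<close> has weights -1, 0, 1 and \<open>x\<close> has weight 1, the elements
    \<open>sq x v\<close> carry the \<open>ad H\<close>-weights 0, 1, 2, while \<open>sq y y\<close>
    has weight -2.\<close>
  define E where "E v c = sq x v + mat_scale c (sq y y)" for v c
  have adE: "commutator H (E v c) = E (v + H *v v) (- 2 * c)" for v c
  proof -
    have "H \<in> sp \<Omega>" using HK K_sp by blast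
    then have "commutator H (sq y y) = mat_scale (- 2) (sq y y)"
      unfolding commutator_sq[OF \<open>H \<in> sp \<Omega>\<close>] Hx matrix_eq
      by (simp add: vec_eq_iff sq_vec mat_vec_simps minus_mat_vec form_linear)
    then show ?thesis
      by (simp add: E_def commutator_linear commutator_sq[OF \<open>H \<in> sp \<Omega>\<close>] Hx sq_linear(2))
  qed
  have subE: "E v c - mat_scale k (E v' c') = E (v - k *s v') (c - k * c')" for v c k v' c'
    by (simp add: E_def matrix_eq mat_vec_simps sq_vec form_linear algebra_simps)
  have 1: "E (A *v y) 1 \<in> K"
    using commutator_sq_K[OF A xy] by (simp add: E_def add.commute flip: y_def)
  have 2: "commutator H X - mat_scale k X \<in> K" if "X \<in> K" for X k
    using that HK by (intro K_closed commutator_K)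
  let ?v = "A *v y"
  \<comment> \<open>Applying \<open>ad H\<close>, \<open>ad H - 1\<close> and
    \<open>ad H - 2\<close> removes the weights 0, 1, 2, and multiplies \<open>sq y y\<close> by
    (-2)(-3)(-4) = -24.\<close>
  have "E (?v + H *v ?v) (- 2) \<in> K" using 2[OF 1, of 0] by (simp add: adE)
  from 2[OF this, of 1] have "E (H *v ?v + H *v (H *v ?v)) 6 \<in> K"
    unfolding adE subE by (simp add: mat_vec_simps)
  from 2[OF this, of 2] have "E (H *v (H *v (H *v ?v)) - H *v ?v) (- 24) \<in> K"
    unfolding adE subE by (simp add: mat_vec_simps vec.scale_right_distrib algebra_simps
        vec.scale_left_distrib[of 1 1, simplified])
  then have "mat_scale (- 24) (sq y y) \<in> K" by (simp add: H3 E_def sq_linear)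
  then have "sq y y \<in> K" by (rule K_scaleD) simp
  then show ?thesis by (simp add: squares_def y_def)
qed

text \<open>If \<Omega> vanishes on \<open>A *v x\<close> and \<open>x\<close>, a witness
  \<open>B\<close> is added and subtracted: \<open>squares_step\<close> applies to
  \<open>A + B\<close>, \<open>A - B\<close> and \<open>B\<close>, and the parallelogram identity
  isolates \<open>A\<close>.\<close>

lemma squares_invariant:
  assumes x: "x \<in> squares" and A: "A \<in> K"
  shows "A *v x \<in> squares"
proof (cases "x = 0 \<or> \<Omega> (A *v x) x \<noteq> 0")
  case True
  then show ?thesis using squares_step[OF x A] x by auto
next
  case False
  then obtain B where B: "B \<in> K" "\<Omega> (B *v x) x \<noteq> 0" using squares_witness x by blast
  let ?a = "A *v x" and ?b = "B *v x"
  have AB: "A + B \<in> K" "A - B \<in> K" using A B(1) by (simp_all add: K_closed)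
  have "\<Omega> ((A + B) *v x) x \<noteq> 0" "\<Omega> ((A - B) *v x) x \<noteq> 0"
    using False B(2) by (simp_all add: mat_vec_simps form_linear)
  then have "(A + B) *v x \<in> squares" "(A - B) *v x \<in> squares"
    using squares_step[OF x] AB by blast+
  then have "sq (?a + ?b) (?a + ?b) + sq (?a - ?b) (?a - ?b) \<in> K"
    by (intro K_closed) (simp_all add: squares_def mat_vec_simps)
  moreover have "sq (?a + ?b) (?a + ?b) + sq (?a - ?b) (?a - ?b)
      = mat_scale 2 (sq ?a ?a) + mat_scale 2 (sq ?b ?b)"
    unfolding matrix_eq by (simp add: vec_eq_iff sq_vec mat_vec_simps form_linear algebra_simps)
  moreover have "mat_scale 2 (sq ?b ?b) \<in> K"
    using squares_step[OF x B] by (intro K_closed) (simp add: squares_def)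
  ultimately have "mat_scale 2 (sq ?a ?a) \<in> K" using K_closed(2) by (metis add_diff_cancel_right')
  then show ?thesis using K_scaleD by (simp add: squares_def)
qed

text \<open>The commutator of \<open>sq x x\<close> and \<open>sq y y\<close> is
  \<open>4 * \<Omega> x y\<close> times \<open>sq x y\<close>.\<close>

lemma squares_combine:
  assumes "x \<in> squares" "y \<in> squares" "\<Omega> x y \<noteq> 0"
  shows "sq x y \<in> K" "x + c *s y \<in> squares"
proof -
  have "sq (sq x x *v y) y + sq y (sq x x *v y) \<in> K"
    using commutator_sq_K[of "sq x x" y y] assms by (simp add: squares_def)
  moreover have "sq (sq x x *v y) y + sq y (sq x x *v y) = mat_scale (4 * \<Omega> x y) (sq x y)"
    unfolding sq_self matrix_eq by (simp add: vec_eq_iff sq_vec mat_vec_simps form_linear algebra_simps)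
  ultimately show xy: "sq x y \<in> K" using K_scaleD assms(3) by simp
  have "sq (x + c *s y) (x + c *s y) = sq x x + mat_scale (2 * c) (sq x y) + mat_scale (c * c) (sq y y)"
    unfolding matrix_eq by (simp add: vec_eq_iff sq_vec mat_vec_simps form_linear algebra_simps)
  then show "x + c *s y \<in> squares"
    using xy assms by (simp add: squares_def K_closed)
qed

lemma avoid_two_zeros:
  fixes a b c d :: complex
  assumes "a \<noteq> 0 \<or> b \<noteq> 0" "c \<noteq> 0 \<or> d \<noteq> 0"
  obtains t where "a + t * b \<noteq> 0" "c + t * d \<noteq> 0" "t \<noteq> 0"
proof -
  obtain t where t: "t \<notin> {0, - a / b, - c / d}"
    using ex_new_if_finite[of "{0, - a / b, - c / d}"] infinite_UNIV_char_0[where 'a = complex] by auto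
  have "a + t * b \<noteq> 0"
    using t assms(1) by (cases "b = 0") (auto simp: field_simps eq_neg_iff_add_eq_0)
  moreover have "c + t * d \<noteq> 0"
    using t assms(2) by (cases "d = 0") (auto simp: field_simps eq_neg_iff_add_eq_0)
  ultimately show thesis using that t by blast
qed

text \<open>\<open>G\<close> collects the squares joined to \<open>x0\<close> by a chain of two
  steps with nonzero \<Omega>. Its span is \<open>K\<close>-invariant and contains
  \<open>x0\<close>, hence is everything. Requiring the chain is what brings \<open>sq x0 y\<close>
  into \<open>K\<close> even when \<open>\<Omega> x0 y = 0\<close>.\<close>

lemma squares_span:
  assumes x0: "x0 \<in> squares" "x0 \<noteq> 0"
  defines "G \<equiv> {y \<in> squares. \<exists>z\<in>squares. \<Omega> x0 z \<noteq> 0 \<and> \<Omega> z y \<noteq> 0}"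
  shows "vec.span G = UNIV" "y \<in> G \<Longrightarrow> sq x0 y \<in> K"
proof -
  \<comment> \<open>Chains of three steps reduce to two: a general combination
    \<open>z + t *s y\<close> of the intermediate vectors is again a square and pairs nontrivially
    with both ends.\<close>
  have step: "y' \<in> G" if y: "y \<in> G" "y' \<in> squares" "\<Omega> y y' \<noteq> 0" for y y'
  proof -
    obtain z where z: "y \<in> squares" "z \<in> squares" "\<Omega> x0 z \<noteq> 0" "\<Omega> z y \<noteq> 0"
      using y(1) by (auto simp: G_def)
    obtain t where t: "\<Omega> x0 z + t * \<Omega> x0 y \<noteq> 0" "\<Omega> z y' + t * \<Omega> y y' \<noteq> 0"
      using avoid_two_zeros z(3) y(3) by metis
    have "z + t *s y \<in> squares" by (rule squares_combine) (use z in auto)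
    then show ?thesis using t y(2) by (auto simp: G_def form_linear intro!: bexI[of _ "z + t *s y"])
  qed
  have G: "y \<in> squares" "y \<noteq> 0" if "y \<in> G" for y using that by (auto simp: G_def form_linear)
  \<comment> \<open>\<open>A *v y\<close> may be orthogonal to \<open>y\<close>. Adding a multiple
    of \<open>B *v y\<close> from a witness repairs this, and \<open>B *v y\<close> itself lies in
    \<open>G\<close>.\<close>
  have inv: "A *v y \<in> vec.span G" if y: "y \<in> G" and A: "A \<in> K" for y A
  proof -
    obtain B where B: "B \<in> K" "\<Omega> (B *v y) y \<noteq> 0" using squares_witness G[OF y] by blast
    have By: "B *v y \<in> G"
      using step[OF y squares_invariant[OF G(1)[OF y] B(1)]] B(2) form_swap[of y "B *v y"] by simp
    obtain t where t: "\<Omega> (A *v y) y + t * \<Omega> (B *v y) y \<noteq> 0"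
      using avoid_two_zeros[of "\<Omega> (A *v y) y" "\<Omega> (B *v y) y" 1 0] B(2) by auto
    have "(A + mat_scale t B) *v y \<in> squares"
      by (rule squares_invariant[OF G(1)[OF y]]) (intro K_closed A B)
    then have w: "A *v y + t *s (B *v y) \<in> squares" by (simp add: mat_vec_simps)
    have "\<Omega> (A *v y + t *s (B *v y)) y \<noteq> 0" using t by (simp add: form_linear)
    then have "\<Omega> y (A *v y + t *s (B *v y)) \<noteq> 0" by (metis form_swap neg_equal_0_iff_equal)
    then have "A *v y + t *s (B *v y) \<in> G" by (rule step[OF y w])
    then have "(A *v y + t *s (B *v y)) - t *s (B *v y) \<in> vec.span G"
      using By by (intro vec.span_diff vec.span_scale vec.span_base)
    then show ?thesis by simp
  qed
  obtain B where B: "B \<in> K" "\<Omega> (B *v x0) x0 \<noteq> 0" using squares_witness x0 by blast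
  have "x0 \<in> G"
    using squares_invariant[OF x0(1) B(1)] B(2) form_swap[of x0 "B *v x0"] x0(1)
    by (auto simp: G_def intro!: bexI[of _ "B *v x0"])
  show "vec.span G = UNIV"
  proof (rule irreducible)
    show "A *v x \<in> vec.span G" if A: "A \<in> K" and x: "x \<in> vec.span G" for A x
      using x
    proof (induction rule: vec.span_induct_alt)
      case (step c x y)
      then show ?case using inv[OF step(1) A] by (simp add: mat_vec_simps vec.span_add vec.span_scale)
    qed (simp add: vec.span_zero)
    show "x0 \<in> vec.span G" using \<open>x0 \<in> G\<close> by (rule vec.span_base)
  qed (use x0 in auto)
  show "sq x0 y \<in> K" if y: "y \<in> G"
  proof (cases "\<Omega> x0 y = 0")
    case False
    then show ?thesis using squares_combine(1)[OF x0(1)] G[OF y] by blast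
  next
    \<comment> \<open>Here \<open>z\<close> and \<open>z + y\<close> both combine with
      \<open>x0\<close>, and the difference isolates \<open>sq x0 y\<close>.\<close>
    case True
    obtain z where z: "y \<in> squares" "z \<in> squares" "\<Omega> x0 z \<noteq> 0" "\<Omega> z y \<noteq> 0"
      using y by (auto simp: G_def)
    have "z + 1 *s y \<in> squares" by (rule squares_combine) (use z in auto)
    then have "sq x0 (z + 1 *s y) \<in> K"
      using True z by (intro squares_combine(1)[OF x0(1)]) (simp_all add: form_linear)
    moreover have "sq x0 z \<in> K" by (intro squares_combine(1)[OF x0(1)] z)
    ultimately have "sq x0 (z + 1 *s y) - sq x0 z \<in> K" by (rule K_closed)
    then show ?thesis by (simp add: sq_linear)
  qed
qed

text \<open>Polarization: a matrix of \<open>sp\<close> is determined by its symmetric bilinear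
  form.\<close>

lemma quadratic_zero:
  assumes C: "\<And>x y. \<Omega> (C *v x) y = - \<Omega> x (C *v y)" and diag: "\<And>x. \<Omega> x (C *v x) = 0"
  shows "C = 0"
proof -
  have "\<Omega> x (C *v y) = 0" for x y
  proof -
    have "\<Omega> x (C *v y) + \<Omega> y (C *v x) = 0"
      using diag[of "x + y"] diag[of x] diag[of y] by (simp add: matrix_vector_right_distrib form_linear add.commute)
    moreover have "\<Omega> y (C *v x) = \<Omega> x (C *v y)" using C[of x y] form_swap[of y "C *v x"] by simp
    ultimately show ?thesis by simp
  qed
  then have "C *v y = 0" for y by (intro form_nondegenerate_right) blast
  then show ?thesis by (simp add: matrix_eq)
qed

text \<open>All squares lie in \<open>K\<close>. For \<open>A\<close> in \<open>sp\<close> let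
  \<open>s\<close> in \<open>K\<close> have the same trace pairing with \<open>K\<close>; by
  \<open>trace_sq\<close> the quadratic form of \<open>A - s\<close> is zero.\<close>

lemma sp_if_square:
  assumes "x0 \<in> squares" "x0 \<noteq> 0"
  shows "K = sp \<Omega>"
proof -
  have sq: "sq x y \<in> K" if x: "x \<in> squares" "x \<noteq> 0" for x y
  proof -
    have "y \<in> vec.span {y \<in> squares. \<exists>z\<in>squares. \<Omega> x z \<noteq> 0 \<and> \<Omega> z y \<noteq> 0}"
      using squares_span(1)[OF x] by simp
    then show ?thesis
    proof (induction rule: vec.span_induct_alt)
      case base show ?case using gl.subspace_0[OF subspace_K] by (simp add: sq_linear)
    next
      case (step c u v)
      then show ?case using squares_span(2)[OF x step(1)] by (simp add: sq_linear K_closed)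
    qed
  qed
  have sq: "sq y y \<in> K" for y
  proof -
    have "sq x y \<in> K" for x
    proof -
      have "x \<in> vec.span {y \<in> squares. \<exists>z\<in>squares. \<Omega> x0 z \<noteq> 0 \<and> \<Omega> z y \<noteq> 0}"
        using squares_span(1)[OF assms] by simp
      then show ?thesis
      proof (induction rule: vec.span_induct_alt)
        case base show ?case using gl.subspace_0[OF subspace_K] by (simp add: sq_linear)
      next
        case (step c u v)
        then have "sq u y \<in> K" by (intro sq) (auto simp: form_linear)
        then show ?case using step by (simp add: sq_linear K_closed)
      qed
    qed
    then show ?thesis .
  qed
  have "A \<in> K" if A: "A \<in> sp \<Omega>" for A
  proof -
    obtain s where s: "s \<in> K" "\<And>B. B \<in> K \<Longrightarrow> trace (s ** B) = trace (A ** B)"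
      by (rule ideal_functional[OF ideal_K, of "\<lambda>B. trace (A ** B)"])
        (simp_all add: mat_scale_mult matrix_mult_distrib trace_add trace_mat_scale that)
    let ?C = "A - s"
    have C: "\<Omega> (?C *v x) y = - \<Omega> x (?C *v y)" for x y
      using spD[OF A, of x y] spD[of s x y] s(1) K_sp by (auto simp: mat_vec_simps form_linear)
    have diag: "\<Omega> x (?C *v x) = 0" for x
      using s(2)[OF sq[of x]] trace_sq[of ?C x] by (simp add: matrix_mult_distrib trace_sub)
    have "?C = 0" by (rule quadratic_zero[OF C diag])
    then show ?thesis using s(1) by simp
  qed
  then show ?thesis using K_sp by blast
qed

theorem prolongation_zero:
  assumes "K \<noteq> sp \<Omega>" "prolongs \<phi>"
  shows "\<phi> x = 0"
proof (rule ccontr)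
  assume "\<phi> x \<noteq> 0"
  then obtain A v where A: "A \<in> K" "A \<noteq> 0" "\<And>x. \<exists>c. A *v x = c *s v"
    using rank_one_element level_nonzero[OF assms(2)] by metis
  then obtain l where l: "\<And>x. A *v x = l x *s v" by metis
  have "v \<noteq> 0" using A(2) l by (auto simp: matrix_eq)
  then obtain z where z: "\<Omega> v z \<noteq> 0" using form_nondegenerate by blast
  \<comment> \<open>Membership in \<open>sp\<close> makes the form
    \<open>\<Omega> (A *v x) z\<close> symmetric, so the functional \<open>l\<close> of the rank one
    matrix is proportional to \<open>\<Omega> v\<close>; \<open>z\<close> serves to read off the
    factor.\<close>
  define k where "k = l z / \<Omega> v z"
  have lk: "l x = k * \<Omega> v x" for x
  proof -
    have "l x * \<Omega> v z = l z * \<Omega> v x"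
      using spD[of A x z] A(1) K_sp form_swap[of x v] by (auto simp: l form_linear)
    then show ?thesis using z by (simp add: k_def field_simps)
  qed
  have "k \<noteq> 0" using A(2) lk l by (auto simp: matrix_eq)
  have "sq v v = mat_scale (2 / k) A"
    unfolding matrix_eq using \<open>k \<noteq> 0\<close> by (simp add: vec_eq_iff sq_vec l lk)
  then have "v \<in> squares" using A(1) by (simp add: squares_def K_closed)
  then show False using sp_if_square \<open>v \<noteq> 0\<close> assms(1) by blast
qed

end

text \<open>Induction and resolution eta-expand sums of functions, after which these rules would
  push the sums under the abstraction.\<close>

lemmas fun_apply_list = plus_fun_apply[of _ _ "[]"] minus_apply[of _ _ "[]"] uminus_apply[of _ "[]"]
  zero_fun_apply[of "[]"] plus_fun_apply[of _ _ "_ # _"] minus_apply[of _ _ "_ # _"]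
  uminus_apply[of _ "_ # _"] zero_fun_apply[of "_ # _"]

lemmas fun_apply = plus_fun_apply zero_fun_apply minus_apply uminus_apply

declare fun_apply [simp del]

section \<open>Linear structure of the ambient space\<close>

interpretation neg: complex_space "neg_scale :: complex \<Rightarrow> ('n::finite) neg \<Rightarrow> 'n neg"
  by (simp add: complex_space_def neg_scale_vector_space)

interpretation prol: complex_space "prol_scale :: complex \<Rightarrow> ('n::finite) prol \<Rightarrow> 'n prol"
  by (simp add: complex_space_def prol_scale_vector_space)

definition comp_scale :: "complex \<Rightarrow> 'n neg \<times> 'n zer \<Rightarrow> ('n::finite) neg \<times> 'n zer" where
  "comp_scale c p = (neg_scale c (fst p), (mat_scale c (fst (snd p)), c * snd (snd p)))"

lemma prol_scale_at: "prol_scale c u w = comp_scale c (u w)"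
  by (simp add: prol_scale_def comp_scale_def)

lemma comp_scale_linear:
  "comp_scale c (p + q) = comp_scale c p + comp_scale c q" "comp_scale c 0 = 0"
  "comp_scale c (p - q) = comp_scale c p - comp_scale c q" "comp_scale c (- p) = - comp_scale c p"
  by (simp_all add: comp_scale_def neg_scale_def mat_scale_def prod_eq_iff vec_eq_iff algebra_simps)

lemma prol_eqI:
  assumes "u [] = v []" "\<And>X. ev u X = ev v X"
  shows "u = v"
proof
  show "u w = v w" for w
    by (cases w) (use assms in \<open>auto simp: ev_def fun_eq_iff fun_apply\<close>)
qed

lemma endo_ev: "prol.endo (\<lambda>u. ev u X)"
  by (rule prol.endoI) (simp_all add: ev_def prol_scale_def fun_eq_iff fun_apply)

lemma ev_linear:
  "ev (u + v) X = ev u X + ev v X" "ev (u - v) X = ev u X - ev v X" "ev (- u) X = - ev u X"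
  "ev (prol_scale c u) X = prol_scale c (ev u X)"
  using prol.endoD[OF endo_ev[of X]] by auto

lemma of_neg_linear:
  "of_neg (X + Y) = of_neg X + of_neg Y" "of_neg (X - Y) = of_neg X - of_neg Y" "of_neg (- X) = - of_neg X"
  "of_neg (neg_scale c X) = prol_scale c (of_neg X)"
  by (simp_all add: of_neg_def fun_eq_iff fun_apply prol_scale_at comp_scale_def zero_prod_def neg_scale_def
      mat_scale_def vec_eq_iff)

lemma of_zer_linear:
  "of_zer (a + b) = of_zer a + of_zer b" "of_zer (a - b) = of_zer a - of_zer b" "of_zer (- a) = - of_zer a"
  "of_zer (mat_scale c (fst a), c * snd a) = prol_scale c (of_zer a)"
  by (simp_all add: of_zer_def fun_eq_iff fun_apply prol_scale_at comp_scale_def zero_prod_def neg_scale_def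
      mat_scale_def vec_eq_iff)

lemma part_linear:
  "neg_part (u + v) = neg_part u + neg_part v" "zer_part (u + v) = zer_part u + zer_part v"
  "neg_part (prol_scale c u) = neg_scale c (neg_part u)"
  "zer_part (prol_scale c u) = (mat_scale c (fst (zer_part u)), c * snd (zer_part u))"
  "pos_part (u + v) = pos_part u + pos_part v" "pos_part (prol_scale c u) = prol_scale c (pos_part u)"
  "neg_part (u - v) = neg_part u - neg_part v" "zer_part (u - v) = zer_part u - zer_part v"
  "neg_part (- u) = - neg_part u" "zer_part (- u) = - zer_part u"
  by (simp_all add: neg_part_def zer_part_def pos_part_def prol_scale_def fun_eq_iff fun_apply neg_scale_def
      zero_prod_def mat_scale_def vec_eq_iff)

lemma zer_act_linear:
  "zer_act (a + b) X = zer_act a X + zer_act b X" "zer_act a (X + Y) = zer_act a X + zer_act a Y"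
  "zer_act (mat_scale c (fst a), c * snd a) X = neg_scale c (zer_act a X)"
  "zer_act a (neg_scale c X) = neg_scale c (zer_act a X)"
  "zer_act a (- X) = - zer_act a X" "zer_act (- a) X = - zer_act a X"
  by (simp_all add: zer_act_def neg_scale_def mat_vec_simps algebra_simps prod_eq_iff
      minus_mat_vec vec.scale_left_distrib vec.scale_right_distrib vec.scale_right_diff_distrib
      matrix_vector_mult_diff_distrib[of _ 0, simplified])

lemma nonneg_act_linear:
  "nonneg_act (u + v) X = nonneg_act u X + nonneg_act v X"
  "nonneg_act (prol_scale c u) X = prol_scale c (nonneg_act u X)"
  by (simp_all add: nonneg_act_def ev_linear part_linear zer_act_linear of_neg_linear prol.scale_right_distrib)

subsection \<open>Multilinear elements\<close>

text \<open>The bracket of arbitrary functions on words is not bilinear, since it evaluates one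
  argument at the negative part of the other. Linearity in every letter is the condition, closed
  under the bracket, under which the usual rules hold.\<close>

definition multilinear :: "('n::finite) prol \<Rightarrow> bool" where
  "multilinear u \<longleftrightarrow> (\<forall>w X Y w'. u (w @ (X + Y) # w') = u (w @ X # w') + u (w @ Y # w')) \<and>
     (\<forall>w c X w'. u (w @ neg_scale c X # w') = comp_scale c (u (w @ X # w')))"

lemma multilinear_ev:
  assumes "multilinear u"
  shows "ev u (X + Y) = ev u X + ev u Y" "ev u (neg_scale c X) = prol_scale c (ev u X)"
    "multilinear (ev u X)" "ev u 0 = 0" "ev u (- X) = - ev u X"
proof -
  have add: "u (w @ (X + Y) # w') = u (w @ X # w') + u (w @ Y # w')"
    and scl: "u (w @ neg_scale c X # w') = comp_scale c (u (w @ X # w'))" for w X Y w' c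
    using assms unfolding multilinear_def by blast+
  show 1: "ev u (X + Y) = ev u X + ev u Y" and 2: "ev u (neg_scale c X) = prol_scale c (ev u X)" for X Y c
    using add[of "[]"] scl[of "[]"] by (simp_all add: ev_def fun_eq_iff fun_apply prol_scale_at)
  show "multilinear (ev u X)"
    using add[of "X # _"] scl[of "X # _"] by (simp add: multilinear_def ev_def del: split_paired_All)
  show "ev u 0 = 0" using 2[of 0 0] by simp
  show "ev u (- X) = - ev u X" using 2[of "- 1" X] by simp
qed

lemma multilinearI:
  assumes "\<And>X Y. ev u (X + Y) = ev u X + ev u Y" "\<And>c X. ev u (neg_scale c X) = prol_scale c (ev u X)"
    "\<And>X. multilinear (ev u X)"
  shows "multilinear u"
proof -
  have "u (w @ (X + Y) # w') = u (w @ X # w') + u (w @ Y # w')" for w X Y w'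
  proof (cases w)
    case Nil
    then show ?thesis using assms(1)[of X Y, THEN fun_cong, of w'] by (simp add: ev_def fun_apply)
  next
    case (Cons Z v)
    then show ?thesis using assms(3)[of Z, unfolded multilinear_def]
      by (simp add: ev_def Cons del: split_paired_All)
  qed
  moreover have "u (w @ neg_scale c X # w') = comp_scale c (u (w @ X # w'))" for w X c w'
  proof (cases w)
    case Nil
    then show ?thesis using assms(2)[of c X, THEN fun_cong, of w'] by (simp add: ev_def prol_scale_at)
  next
    case (Cons Z v)
    then show ?thesis using assms(3)[of Z, unfolded multilinear_def]
      by (simp add: ev_def Cons del: split_paired_All)
  qed
  ultimately show ?thesis unfolding multilinear_def by blast
qed

lemma multilinear_closed:
  fixes u v :: "('n::finite) prol"
  shows
  "multilinear 0" "multilinear (of_neg X)" "multilinear (of_zer a)"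
  "multilinear u \<Longrightarrow> multilinear v \<Longrightarrow> multilinear (u + v)"
  "multilinear u \<Longrightarrow> multilinear v \<Longrightarrow> multilinear (u - v)"
  "multilinear u \<Longrightarrow> multilinear (- u)"
  "multilinear u \<Longrightarrow> multilinear (prol_scale c u)"
  "multilinear u \<Longrightarrow> multilinear (pos_part u)"
  "multilinear u \<Longrightarrow> multilinear (nonneg_act u X)"
proof -
  have cc: "comp_scale c (comp_scale d p) = comp_scale d (comp_scale c p)" for c d and p :: "'n neg \<times> 'n zer"
    by (simp add: comp_scale_def neg_scale_def mat_scale_def vec_eq_iff mult.left_commute)
  show "multilinear 0" "multilinear (of_neg X)" "multilinear (of_zer a)"
    by (simp_all add: multilinear_def of_neg_def of_zer_def comp_scale_linear fun_apply del: split_paired_All)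
  show "multilinear u \<Longrightarrow> multilinear v \<Longrightarrow> multilinear (u - v)" "multilinear u \<Longrightarrow> multilinear (- u)"
    "multilinear u \<Longrightarrow> multilinear (prol_scale c u)" "multilinear u \<Longrightarrow> multilinear (pos_part u)"
      for u v :: "'n prol" and c
    by (simp_all add: multilinear_def comp_scale_linear prol_scale_at cc[of c] pos_part_def fun_apply
        del: split_paired_All)
  show add: "multilinear u \<Longrightarrow> multilinear v \<Longrightarrow> multilinear (u + v)" for u v :: "'n prol"
    by (simp add: multilinear_def comp_scale_linear fun_apply del: split_paired_All)
  show "multilinear (nonneg_act u X)" if "multilinear u"
    unfolding nonneg_act_def using that
    by (intro add multilinear_ev) (simp add: multilinear_def of_neg_def comp_scale_linear fun_apply del: split_paired_All)
qed

lemma multilinear_zero_letter: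
  fixes u :: "('n::finite) prol" shows "multilinear u \<Longrightarrow> zero_letter u"
  unfolding zero_letter_def
proof (intro allI impI)
  fix w :: "'n neg list" assume u: "multilinear u" and "0 \<in> set w"
  then obtain w1 w2 where w: "w = w1 @ 0 # w2" by (meson split_list)
  have "u (w1 @ neg_scale 0 0 # w2) = comp_scale 0 (u (w1 @ 0 # w2))"
    using u unfolding multilinear_def by blast
  then show "u w = 0"
    by (simp add: w) (simp add: comp_scale_def neg_scale_def mat_scale_def prod_eq_iff vec_eq_iff)
qed

context symplectic
begin

abbreviation brk :: "'n prol \<Rightarrow> 'n prol \<Rightarrow> 'n prol" where "brk \<equiv> bracket \<Omega>"

lemma neg_bracket_linear:
  "neg_bracket \<Omega> (X + Y) Z = neg_bracket \<Omega> X Z + neg_bracket \<Omega> Y Z"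
  "neg_bracket \<Omega> Z (X + Y) = neg_bracket \<Omega> Z X + neg_bracket \<Omega> Z Y"
  "neg_bracket \<Omega> (neg_scale c X) Z = neg_scale c (neg_bracket \<Omega> X Z)"
  "neg_bracket \<Omega> Z (neg_scale c X) = neg_scale c (neg_bracket \<Omega> Z X)"
  by (simp_all add: neg_bracket_def form_linear neg_scale_def)

lemma neg_bracket_swap: "neg_bracket \<Omega> X Y = - neg_bracket \<Omega> Y X"
  using form_swap[of "snd X" "snd Y"] by (simp add: neg_bracket_def)

lemma zer_bracket_linear:
  "zer_bracket (a + b) c = zer_bracket a c + zer_bracket b c"
  "zer_bracket c (a + b) = zer_bracket c a + zer_bracket c b"
  "zer_bracket (mat_scale k (fst a), k * snd a) c = (mat_scale k (fst (zer_bracket a c)), 0)"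
  "zer_bracket c (mat_scale k (fst a), k * snd a) = (mat_scale k (fst (zer_bracket c a)), 0)"
  "zer_bracket a b = - zer_bracket b a" for a b c :: "'n zer"
  using commutator_swap[of "fst a" "fst b"] by (simp_all add: zer_bracket_def commutator_linear)

lemma bracket_nil:
  "brk u v [] =
     (neg_bracket \<Omega> (neg_part u) (neg_part v)
        + zer_act (zer_part u) (neg_part v) - zer_act (zer_part v) (neg_part u),
      zer_bracket (zer_part u) (zer_part v))
     + ev u (neg_part v) [] - ev v (neg_part u) []"
  by (simp add: bracket_def)

lemma ev_bracket:
  "ev (brk u v) X = ev (ev u (neg_part v)) X - ev (ev v (neg_part u)) X
     + brk (ev u X) (of_zer (zer_part v) + pos_part v) + brk (pos_part u) (nonneg_act v X)
     - brk (ev v X) (of_zer (zer_part u)) - brk (pos_part v) (of_neg (zer_act (zer_part u) X))"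
  by (rule ext) (simp add: ev_def[of "brk u v"] bracket_def fun_apply ev_def[of "\<lambda>w. bracket_at \<Omega> w u v"]
      ev_def[of "ev u _"] ev_def[of "ev v _"])

lemma bracket_at_add:
  assumes "multilinear u" "multilinear u'" "multilinear v"
  shows "bracket_at \<Omega> w (u + u') v = bracket_at \<Omega> w u v + bracket_at \<Omega> w u' v"
    "bracket_at \<Omega> w v (u + u') = bracket_at \<Omega> w v u + bracket_at \<Omega> w v u'"
proof -
  have "bracket_at \<Omega> w (u + u') v = bracket_at \<Omega> w u v + bracket_at \<Omega> w u' v
    \<and> bracket_at \<Omega> w v (u + u') = bracket_at \<Omega> w v u + bracket_at \<Omega> w v u'"
    using assms
  proof (induction w arbitrary: u u' v)
    case Nil
    then show ?case
      by (simp add: part_linear ev_linear multilinear_ev neg_bracket_linear zer_bracket_linear(1,2)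
          zer_act_linear fun_apply_list prod_eq_iff)
  next
    case (Cons X w)
    have IH: "bracket_at \<Omega> w (a + b) c = bracket_at \<Omega> w a c + bracket_at \<Omega> w b c"
      "bracket_at \<Omega> w c (a + b) = bracket_at \<Omega> w c a + bracket_at \<Omega> w c b"
      if "multilinear a" "multilinear b" "multilinear c" for a b c
      using Cons.IH[OF that] by auto
    show ?case
      using Cons.prems
      by (simp add: part_linear ev_linear multilinear_ev zer_act_linear nonneg_act_linear of_neg_linear
          of_zer_linear IH multilinear_closed fun_apply_list)
  qed
  then show "bracket_at \<Omega> w (u + u') v = bracket_at \<Omega> w u v + bracket_at \<Omega> w u' v"
    "bracket_at \<Omega> w v (u + u') = bracket_at \<Omega> w v u + bracket_at \<Omega> w v u'" by auto
qed

lemma bracket_at_scale: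
  assumes "multilinear u" "multilinear v"
  shows "bracket_at \<Omega> w (prol_scale c u) v = comp_scale c (bracket_at \<Omega> w u v)"
    "bracket_at \<Omega> w v (prol_scale c u) = comp_scale c (bracket_at \<Omega> w v u)"
proof -
  have "bracket_at \<Omega> w (prol_scale c u) v = comp_scale c (bracket_at \<Omega> w u v)
    \<and> bracket_at \<Omega> w v (prol_scale c u) = comp_scale c (bracket_at \<Omega> w v u)"
    using assms
  proof (induction w arbitrary: u v)
    case Nil
    then show ?case
      by (simp add: part_linear ev_linear multilinear_ev neg_bracket_linear zer_bracket_linear(3,4)
          zer_act_linear prol_scale_at[of _ _ "[]"] comp_scale_linear fun_apply_list)
        (simp add: comp_scale_def zer_bracket_def neg_scale_def prod_eq_iff algebra_simps vec_eq_iff)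
  next
    case (Cons X w)
    have IH: "bracket_at \<Omega> w (prol_scale c a) b = comp_scale c (bracket_at \<Omega> w a b)"
      "bracket_at \<Omega> w b (prol_scale c a) = comp_scale c (bracket_at \<Omega> w b a)"
      if "multilinear a" "multilinear b" for a b
      using Cons.IH[OF that] by auto
    show ?case
      using Cons.prems
      by (simp add: part_linear ev_linear multilinear_ev zer_act_linear nonneg_act_linear of_neg_linear
          of_zer_linear IH multilinear_closed comp_scale_linear prol_scale_at[of _ _ "_ # _"]
          flip: prol.scale_right_distrib)
  qed
  then show "bracket_at \<Omega> w (prol_scale c u) v = comp_scale c (bracket_at \<Omega> w u v)"
    "bracket_at \<Omega> w v (prol_scale c u) = comp_scale c (bracket_at \<Omega> w v u)" by auto
qed

lemma bracket_add:
  assumes "multilinear u" "multilinear u'" "multilinear v"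
  shows "brk (u + u') v = brk u v + brk u' v" "brk v (u + u') = brk v u + brk v u'"
  using bracket_at_add[OF assms] by (simp_all add: bracket_def fun_eq_iff fun_apply)

lemma bracket_scale:
  assumes "multilinear u" "multilinear v"
  shows "brk (prol_scale c u) v = prol_scale c (brk u v)" "brk v (prol_scale c u) = prol_scale c (brk v u)"
  using bracket_at_scale[OF assms] by (simp_all add: bracket_def fun_eq_iff fun_apply prol_scale_at)

lemma bracket_minus:
  assumes "multilinear u" "multilinear v"
  shows "brk (- u) v = - brk u v" "brk v (- u) = - brk v u"
  using bracket_scale[OF assms, of "- 1"] by simp_all

lemma bracket_diff:
  assumes "multilinear u" "multilinear u'" "multilinear v"
  shows "brk (u - u') v = brk u v - brk u' v" "brk v (u - u') = brk v u - brk v u'"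
  using bracket_add[OF assms(1) multilinear_closed(6)[OF assms(2)] assms(3)] bracket_minus[OF assms(2,3)]
  by simp_all

lemma bracket_zero: "multilinear v \<Longrightarrow> brk 0 v = 0" "multilinear v \<Longrightarrow> brk v 0 = 0"
  using bracket_scale[of v v 0] bracket_scale[of 0 v 0] by (simp_all add: multilinear_closed)

lemma multilinear_bracket:
  assumes "multilinear u" "multilinear v"
  shows "multilinear (brk u v)"
proof -
  have main: "u (w @ (X + Y) # w') = u (w @ X # w') + u (w @ Y # w') \<and>
    u (w @ neg_scale c X # w') = comp_scale c (u (w @ X # w'))"
    if "u = brk a b" "multilinear a" "multilinear b" for w X Y w' c u a b
    using that
  proof (induction w arbitrary: u a b)
    case Nil
    have "ev (brk a b) (X + Y) = ev (brk a b) X + ev (brk a b) Y"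
      using Nil by (simp add: ev_bracket multilinear_ev multilinear_closed zer_act_linear of_neg_linear
          bracket_add nonneg_act_def algebra_simps)
    moreover have "ev (brk a b) (neg_scale c X) = prol_scale c (ev (brk a b) X)"
      using Nil by (simp add: ev_bracket multilinear_ev multilinear_closed zer_act_linear of_neg_linear
          bracket_scale bracket_add nonneg_act_def prol.scale_right_distrib prol.scale_right_diff_distrib)
    ultimately show ?case using Nil(1) by (simp add: ev_def fun_eq_iff fun_apply prol_scale_at)
  next
    case (Cons Z w)
    have IH: "brk a b (w @ (X + Y) # w') = brk a b (w @ X # w') + brk a b (w @ Y # w')"
      "brk a b (w @ neg_scale c X # w') = comp_scale c (brk a b (w @ X # w'))"
      if "multilinear a" "multilinear b" for a b
      using Cons.IH[OF refl that] by auto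
    have m: "t (w @ (X + Y) # w') = t (w @ X # w') + t (w @ Y # w')"
      "t (w @ neg_scale c X # w') = comp_scale c (t (w @ X # w'))" if "multilinear t" for t
      using that unfolding multilinear_def by blast+
    have *: "u (Z # t) = ev (brk a b) Z t" for t using Cons.prems(1) by (simp add: ev_def)
    show ?case
      using Cons.prems(2,3)
      by (simp add: * ev_bracket fun_apply IH m multilinear_ev multilinear_closed comp_scale_linear)
  qed
  show ?thesis unfolding multilinear_def[of "brk u v"] using main[OF refl assms] by blast
qed

lemma bracket_swap:
  assumes "multilinear u" "multilinear v"
  shows "brk u v = - brk v u"
proof -
  have "bracket_at \<Omega> w u v = - bracket_at \<Omega> w v u" for w
    using assms
  proof (induction w arbitrary: u v)
    case Nil
    show ?case using neg_bracket_swap[of "neg_part u" "neg_part v"] zer_bracket_linear(5)[of "zer_part u" "zer_part v"]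
      by (simp add: prod_eq_iff)
  next
    case (Cons X w)
    note swap = Cons.IH
    have "bracket_at \<Omega> w (ev u X) (pos_part v) = - bracket_at \<Omega> w (pos_part v) (ev u X)"
      "bracket_at \<Omega> w (ev v X) (pos_part u) = - bracket_at \<Omega> w (pos_part u) (ev v X)"
      using Cons.prems by (intro swap multilinear_ev multilinear_closed; simp)+
    then show ?case
      using Cons.prems by (simp add: bracket_at_add multilinear_ev multilinear_closed nonneg_act_def)
  qed
  then show ?thesis by (simp add: bracket_def fun_eq_iff fun_apply)
qed

lemma zer_act_bracket:
  "zer_act (zer_bracket a b) X = zer_act a (zer_act b X) - zer_act b (zer_act a X)"
  by (simp add: zer_act_def zer_bracket_def prod_eq_iff mat_vec_simps)

lemma bracket_neg:
  assumes "multilinear u" "neg_part u = 0"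
  shows "brk u (of_neg X) = nonneg_act u X" "brk (of_neg X) u = - nonneg_act u X"
proof -
  show "brk u (of_neg X) = nonneg_act u X"
    by (rule bracket_nonneg_neg[OF symplectic assms(2) multilinear_zero_letter[OF assms(1)]])
  then show "brk (of_neg X) u = - nonneg_act u X"
    using bracket_swap[OF multilinear_closed(2) assms(1)] by simp
qed

lemma nonneg_bracket_parts:
  assumes "multilinear u" "multilinear v" "neg_part u = 0" "neg_part v = 0"
  shows "neg_part (brk u v) = 0" "zer_part (brk u v) = zer_bracket (zer_part u) (zer_part v)"
proof -
  have "brk u v [] = (0, zer_bracket (zer_part u) (zer_part v))"
    unfolding bracket_nil using assms
    by (simp add: multilinear_ev neg_bracket_zero[OF symplectic])
  then show "neg_part (brk u v) = 0" "zer_part (brk u v) = zer_bracket (zer_part u) (zer_part v)"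
    by (simp_all add: neg_part_def zer_part_def)
qed

text \<open>The defining rule of the bracket requires one factor of positive degree. Splitting off
  the parts of degree 0 extends it to all elements without negative part.\<close>

lemma derivation_neg:
  assumes u: "multilinear u" "neg_part u = 0" and v: "multilinear v" "neg_part v = 0"
  shows "brk (brk u v) (of_neg X) = brk (brk u (of_neg X)) v + brk u (brk v (of_neg X))"
proof -
  let ?u0 = "of_zer (zer_part u)" and ?v0 = "of_zer (zer_part v)"
    and ?up = "pos_part u" and ?vp = "pos_part v"
  have u_eq: "u = ?u0 + ?up" and v_eq: "v = ?v0 + ?vp" using nonneg_parts u v by metis+
  note m = multilinear_closed multilinear_ev u(1) v(1)
  let ?ux = "of_neg (zer_act (zer_part u) X)" and ?vx = "of_neg (zer_act (zer_part v) X)"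
  have "brk (brk u v) (of_neg X) = nonneg_act (brk u v) X"
    using nonneg_bracket_parts[OF u(1) v(1) u(2) v(2)] by (intro bracket_neg multilinear_bracket u v)
  also have "\<dots> = of_neg (zer_act (zer_bracket (zer_part u) (zer_part v)) X) + ev (brk u v) X"
    using nonneg_bracket_parts[OF u(1) v(1) u(2) v(2)] by (simp add: nonneg_act_def)
  also have "ev (brk u v) X = brk (ev u X) v + brk ?up (nonneg_act v X) - brk (ev v X) ?u0 - brk ?vp ?ux"
    unfolding ev_bracket by (simp add: u v m nonneg_parts)
  also have "of_neg (zer_act (zer_bracket (zer_part u) (zer_part v)) X) = brk ?ux ?v0 + brk ?u0 ?vx"
    by (simp add: bracket_nonpos[OF symplectic] zer_act_bracket of_neg_linear)
  also have "brk ?ux ?v0 + brk ?u0 ?vx + (brk (ev u X) v + brk ?up (nonneg_act v X) - brk (ev v X) ?u0 - brk ?vp ?ux)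
      = brk (?ux + ev u X) v + brk u (?vx + ev v X)"
  proof -
    have 1: "brk ?ux v = brk ?ux ?v0 - brk ?vp ?ux"
    proof -
      have "brk ?ux v = brk ?ux (?v0 + ?vp)" by (rule arg_cong[OF v_eq])
      also have "\<dots> = brk ?ux ?v0 + brk ?ux ?vp" by (intro bracket_add m)
      also have "brk ?ux ?vp = - brk ?vp ?ux" by (intro bracket_swap m)
      finally show ?thesis by simp
    qed
    have 2: "brk u (?vx + ev v X) = brk ?u0 ?vx - brk (ev v X) ?u0 + brk ?up (nonneg_act v X)"
    proof -
      have "brk u (?vx + ev v X) = brk (?u0 + ?up) (?vx + ev v X)"
        by (rule arg_cong[OF u_eq, of "\<lambda>t. brk t (?vx + ev v X)"])
      also have "\<dots> = brk ?u0 (?vx + ev v X) + brk ?up (?vx + ev v X)" by (intro bracket_add m)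
      also have "brk ?u0 (?vx + ev v X) = brk ?u0 ?vx + brk ?u0 (ev v X)" by (intro bracket_add m)
      also have "brk ?u0 (ev v X) = - brk (ev v X) ?u0" by (intro bracket_swap m)
      finally show ?thesis by (simp add: nonneg_act_def)
    qed
    have "brk (?ux + ev u X) v = brk ?ux v + brk (ev u X) v" by (intro bracket_add m)
    then show ?thesis unfolding 1 2 by simp
  qed
  also have "\<dots> = brk (brk u (of_neg X)) v + brk u (brk v (of_neg X))"
    by (simp add: bracket_neg u v nonneg_act_def)
  finally show ?thesis .
qed

end

subsection \<open>The graded bracket\<close>

text \<open>Kept apart from \<open>irreducible_sp\<close> because the first statement concerns
  arbitrary subalgebras; the primed names avoid clashes once \<open>irreducible_sp\<close> becomes a
  sublocale.\<close>

locale symplectic_algebra = symplectic \<Omega> for \<Omega> :: "complex^'n \<Rightarrow> complex^'n \<Rightarrow> complex" +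
  fixes K :: "(complex^'n^'n) set"
  assumes K_sp': "K \<subseteq> sp \<Omega>" and K_sub': "lie_subalgebra mat_scale commutator K"
begin

abbreviation g :: "nat \<Rightarrow> 'n prol set" where "g \<equiv> grade \<Omega> K"

lemma subspace_K': "gl.subspace K" and commutator_K': "A \<in> K \<Longrightarrow> B \<in> K \<Longrightarrow> commutator A B \<in> K"
  using K_sub' by (auto simp: lie_subalgebra_def)

lemma grade_multilinear: "u \<in> grade \<Omega> J n \<Longrightarrow> multilinear u"
proof (induction \<Omega> J n arbitrary: u rule: grade.induct)
  case (4 \<Omega> J n)
  interpret Vector_Spaces.linear neg_scale prol_scale "ev u" using 4(3) by simp
  show ?case
  proof (rule multilinearI)
    fix X
    have "ev u X = ev u (fst X, 0) + ev u (0, snd X)" using add[of "(fst X, 0)" "(0, snd X)"] by simp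
    then show "multilinear (ev u X)" using 4 by (auto intro!: multilinear_closed(4))
  qed (fact add scale)+
qed (auto simp: multilinear_closed)

lemma grade_pos_iff:
  "u \<in> g (Suc (Suc (Suc n))) \<longleftrightarrow> u [] = 0 \<and> multilinear u \<and> (\<forall>a. ev u (a, 0) \<in> g (Suc n)) \<and>
     (\<forall>x. ev u (0, x) \<in> g (Suc (Suc n))) \<and>
     (\<forall>X Y. ev u (neg_bracket \<Omega> X Y) = brk (ev u X) (of_neg Y) + brk (of_neg X) (ev u Y))"
  (is "?l \<longleftrightarrow> ?r")
proof
  show "?l \<Longrightarrow> ?r" using grade_multilinear[of u K "Suc (Suc (Suc n))"] by simp
  assume r: ?r
  then have "Vector_Spaces.linear neg_scale prol_scale (ev u)"
    by (auto simp: Vector_Spaces.linear_iff neg.vector_space_axioms prol.vector_space_axioms multilinear_ev)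
  with r show ?l by simp
qed

lemma grade_neg_part: "u \<in> g (Suc (Suc n)) \<Longrightarrow> neg_part u = 0"
  by (rule grade_nil(2))

lemma subspace_range:
  assumes "f z = 0" "\<And>x y. f x + f y = f (x + y)" "\<And>c x. prol_scale c (f x) = f (h c x)"
  shows "prol.subspace (range f)"
proof (rule prol.subspaceI)
  show "0 \<in> range f" using assms(1) by (metis rangeI)
qed (use assms(2,3) in auto)

lemma subspace_grade: "prol.subspace (g n)"
proof (induction n rule: less_induct)
  case (less n)
  consider "n = 0" | "n = 1" | "n = 2" | k where "n = Suc (Suc (Suc k))"
    by (metis One_nat_def Suc_1 not0_implies_Suc)
  then show ?case
  proof cases
    case 1
    show ?thesis unfolding 1 grade.simps
      by (rule subspace_range[of _ 0 "\<lambda>c a. c * a"])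
        (simp_all add: neg_scale_def flip: of_neg_linear zero_prod_def)
  next
    case 2
    show ?thesis unfolding 2 One_nat_def grade.simps
      by (rule subspace_range[of _ 0 "\<lambda>c a. c *s a"])
        (simp_all add: neg_scale_def flip: of_neg_linear zero_prod_def)
  next
    case 3
    have add: "of_zer (A, h) + of_zer (B, k) = of_zer (A + B, h + k)" for A B :: "complex^'n^'n" and h k
      by (simp flip: of_zer_linear)
    have scale: "prol_scale c (of_zer (A, h)) = of_zer (mat_scale c A, c * h)" for A :: "complex^'n^'n" and h c
      using of_zer_linear(4)[of c "(A, h)"] by simp
    have zero: "0 = of_zer (0, 0)" by (simp flip: zero_prod_def)
    show ?thesis unfolding 3 numeral_2_eq_2 grade.simps
    proof (rule prol.subspaceI)
      show "0 \<in> {of_zer (A, h) |A h. A \<in> K}" using zero gl.subspace_0[OF subspace_K'] by blast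
      show "u + v \<in> {of_zer (A, h) |A h. A \<in> K}"
        if uv: "u \<in> {of_zer (A, h) |A h. A \<in> K}" "v \<in> {of_zer (A, h) |A h. A \<in> K}" for u v
      proof -
        obtain A h B k where "u = of_zer (A, h)" "v = of_zer (B, k)" "A \<in> K" "B \<in> K" using uv by blast
        then show ?thesis using add gl.subspace_add[OF subspace_K'] by blast
      qed
      show "prol_scale c u \<in> {of_zer (A, h) |A h. A \<in> K}" if u: "u \<in> {of_zer (A, h) |A h. A \<in> K}" for u c
      proof -
        obtain A h where "u = of_zer (A, h)" "A \<in> K" using u by blast
        then show ?thesis using scale gl.subspace_scale[OF subspace_K'] by blast
      qed
    qed
  next
    case (4 k)
    have S: "prol.subspace (g (Suc k))" "prol.subspace (g (Suc (Suc k)))" using less 4 by auto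
    have scale_at: "prol_scale c u [] = 0" if "u [] = 0" for c and u :: "'n prol"
      using that by (simp add: prol_scale_at comp_scale_linear)
    note ml = multilinear_closed multilinear_ev
    show ?thesis unfolding 4
      by (rule prol.subspaceI; unfold grade_pos_iff)
        (auto simp: fun_apply_list ml ev_linear prol.subspace_0[OF S(1)] prol.subspace_0[OF S(2)]
          prol.subspace_add[OF S(1)] prol.subspace_add[OF S(2)]
          prol.subspace_scale[OF S(1)] prol.subspace_scale[OF S(2)] bracket_zero bracket_add bracket_scale
          scale_at prol.scale_right_distrib)
  qed
qed

lemma elF_grade: "elF a \<in> g 0" and elV_grade: "elV x \<in> g 1"
  by simp_all

lemma grade_brk_neg:
  assumes "u \<in> g (Suc (Suc n))"
  shows "brk u (elF a) \<in> g n" "brk u (elV x) \<in> g (Suc n)" "brk u (of_neg X) = nonneg_act u X"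
proof -
  show eq: "brk u (of_neg X) = nonneg_act u X" for X
    using bracket_neg(1) grade_multilinear[OF assms] grade_neg_part[OF assms] by blast
  have "nonneg_act u (a, 0) \<in> g n \<and> nonneg_act u (0, x) \<in> g (Suc n)"
  proof (cases n)
    case 0
    then obtain A h where "u = of_zer (A, h)" using assms by auto
    then show ?thesis using 0 by (auto simp: nonneg_act_def zer_act_def)
  next
    case (Suc m)
    then have "nonneg_act u X = ev u X" for X
      using assms pos_parts[of u] by (simp add: nonneg_act_def grade_pos_iff)
    then show ?thesis using assms Suc by (simp add: grade_pos_iff)
  qed
  then show "brk u (elF a) \<in> g n" "brk u (elV x) \<in> g (Suc n)" by (simp_all add: eq)
qed

text \<open>In degree 0 this says that \<open>K\<close> preserves \<Omega> and that \<open>H\<close>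
  scales \<open>F\<close> by twice its factor on g_{-1}; in positive degree it is the defining
  condition.\<close>

lemma derivation_neg_neg:
  assumes u: "u \<in> g (Suc (Suc n))"
  shows "brk u (brk (of_neg X) (of_neg Y)) = brk (brk u (of_neg X)) (of_neg Y) + brk (of_neg X) (brk u (of_neg Y))"
proof (cases n)
  case 0
  then obtain A h where A: "u = of_zer (A, h)" "A \<in> K" using u by auto
  have "\<Omega> (A *v x) y = - \<Omega> x (A *v y)" for x y using A(2) K_sp' spD by blast
  then show ?thesis
    by (simp add: A(1) bracket_nonpos[OF symplectic] flip: of_neg_linear)
      (simp add: neg_bracket_def zer_act_def form_linear mult_ac)
next
  case (Suc m)
  have "brk u (of_neg X) = ev u X" for X
    using u pos_parts[of u] unfolding grade_brk_neg(3)[OF u] Suc by (simp add: nonneg_act_def grade_pos_iff)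
  then show ?thesis using u[unfolded Suc grade_pos_iff] by (simp add: bracket_nonpos[OF symplectic] del: split_paired_All)
qed

lemma multilinear_split:
  assumes "multilinear u"
  obtains X v where "u = of_neg X + v" "multilinear v" "neg_part v = 0"
  by (rule that[of "neg_part u" "u - of_neg (neg_part u)"])
    (simp_all add: multilinear_closed assms part_linear)

text \<open>Jacobi identity with one entry of negative degree and one homogeneous entry of
  nonnegative degree. The third entry is split into negative and nonnegative parts.\<close>

lemma derivation:
  assumes u: "multilinear u" and b: "b \<in> g (Suc (Suc n))"
  shows "brk (brk u b) (of_neg Y) = brk (brk u (of_neg Y)) b + brk u (brk b (of_neg Y))"
proof -
  note bm = grade_multilinear[OF b] and b0 = grade_neg_part[OF b]
  note m = multilinear_closed multilinear_bracket bm
  obtain X v where v: "u = of_neg X + v" "multilinear v" "neg_part v = 0"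
    by (rule multilinear_split[OF u])
  have 1: "brk (brk (of_neg X) b) (of_neg Y) = brk (brk (of_neg X) (of_neg Y)) b + brk (of_neg X) (brk b (of_neg Y))"
  proof -
    have "brk (brk (of_neg X) b) (of_neg Y) = - brk (brk b (of_neg X)) (of_neg Y)"
      by (simp add: bracket_swap[of "of_neg X" b] bracket_minus m)
    moreover have "brk (brk (of_neg X) (of_neg Y)) b = - brk b (brk (of_neg X) (of_neg Y))"
      by (rule bracket_swap) (intro m)+
    ultimately show ?thesis using derivation_neg_neg[OF b, of X Y] by simp
  qed
  have 2: "brk (brk v b) (of_neg Y) = brk (brk v (of_neg Y)) b + brk v (brk b (of_neg Y))"
    by (rule derivation_neg[OF v(2,3) bm b0])
  show ?thesis
    unfolding v(1) using 1 2 by (simp add: bracket_add m v(2))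
qed

lemma brk_neg_grade:
  assumes "u \<in> g i" "i < 2" "b \<in> g (Suc (Suc j))"
  shows "brk u b \<in> g (i + j)"
proof -
  obtain X where X: "u = of_neg X" "(\<exists>a. X = (a, 0) \<and> i = 0) \<or> (\<exists>x. X = (0, x) \<and> i = 1)"
    using assms(1,2) less_2_cases[OF assms(2)] by auto
  have "brk u b = - brk b u"
    by (rule bracket_swap) (use assms grade_multilinear in blast)+
  moreover have "brk b u \<in> g (i + j)" using grade_brk_neg[OF assms(3)] X by auto
  ultimately show ?thesis using prol.subspace_neg[OF subspace_grade] by simp
qed

text \<open>Induction on the total degree: the values of the bracket on negative elements are sums
  of brackets of smaller total degree. The defining condition of the prolongation remains to be
  checked.\<close>

lemma brk_grade_nonneg:
  assumes "a \<in> g (Suc (Suc i))" "b \<in> g (Suc (Suc j))"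
  shows "brk a b \<in> g (Suc (Suc (i + j)))"
  using assms
proof (induction "i + j" arbitrary: a b i j rule: less_induct)
  case less
  note a = less.prems(1) and b = less.prems(2)
  note am = grade_multilinear[OF a] and bm = grade_multilinear[OF b]
  note m = multilinear_closed multilinear_bracket am bm
  let ?D = "brk a b"
  show ?case
  proof (cases "i + j")
    case 0
    then obtain A h B k where "a = of_zer (A, h)" "b = of_zer (B, k)" "A \<in> K" "B \<in> K" using a b by auto
    then show ?thesis using 0 commutator_K' by (auto simp: bracket_nonpos[OF symplectic] zer_bracket_def)
  next
    case (Suc k)
    have zer: "zer_part a = 0 \<or> zer_part b = 0"
      using Suc a b pos_parts[of a] pos_parts[of b]
      by (cases i; cases j) (auto simp: grade_pos_iff simp del: grade.simps)
    have parts: "neg_part ?D = 0" "zer_part ?D = 0"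
      using nonneg_bracket_parts[OF am bm grade_neg_part[OF a] grade_neg_part[OF b]] zer by auto
    then have nil: "?D [] = 0" by (simp add: neg_part_def zer_part_def prod_eq_iff)
    have act: "brk ?D (of_neg X) = ev ?D X" for X
      using bracket_neg(1)[OF multilinear_bracket[OF am bm] parts(1)] parts by (simp add: nonneg_act_def)
    have ev_eq: "ev ?D X = brk (brk a (of_neg X)) b + brk a (brk b (of_neg X))" for X
      using derivation[OF am b] act by simp
    have left: "brk u b \<in> g (n + j)" if "u \<in> g n" "n < Suc (Suc i)" for u n
    proof (cases "n < 2")
      case True
      then show ?thesis using brk_neg_grade b that by blast
    next
      case False
      then obtain n' where n: "n = Suc (Suc n')" by (metis add_2_eq_Suc le_add_diff_inverse not_less)
      then show ?thesis using less.hyps[of n' j u b] that b by simp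
    qed
    have right: "brk a u \<in> g (n + i)" if u: "u \<in> g n" "n < Suc (Suc j)" for u n
    proof (cases "n < 2")
      case True
      have "brk a u = - brk u a" by (rule bracket_swap[OF am grade_multilinear[OF u(1)]])
      then show ?thesis using brk_neg_grade[OF u(1) True a] prol.subspace_neg[OF subspace_grade] by simp
    next
      case False
      then obtain n' where n: "n = Suc (Suc n')" by (metis add_2_eq_Suc le_add_diff_inverse not_less)
      then show ?thesis using less.hyps[of i n' a u] u a by (simp add: add.commute)
    qed
    have "ev ?D (c, 0) \<in> g (Suc k)" for c
      unfolding ev_eq Suc[symmetric]
      using left[OF grade_brk_neg(1)[OF a, of c]] right[OF grade_brk_neg(1)[OF b, of c]]
      by (intro prol.subspace_add[OF subspace_grade]) (simp_all add: add.commute)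
    moreover have "ev ?D (0, x) \<in> g (Suc (Suc k))" for x
      unfolding ev_eq Suc[symmetric]
      using left[OF grade_brk_neg(2)[OF a, of x]] right[OF grade_brk_neg(2)[OF b, of x]]
      by (intro prol.subspace_add[OF subspace_grade]) (simp_all add: add.commute)
    moreover have "ev ?D (neg_bracket \<Omega> X Y) = brk (ev ?D X) (of_neg Y) + brk (of_neg X) (ev ?D Y)" for X Y
    proof -
      let ?X = "of_neg X" and ?Y = "of_neg Y"
      \<comment> \<open>Leibniz rule of second order. After antisymmetrization in \<open>U\<close>
        and \<open>V\<close> the mixed terms cancel.\<close>
      have J: "brk (brk ?D (of_neg U)) (of_neg V)
          = brk (brk (brk a (of_neg U)) (of_neg V)) b + brk (brk a (of_neg U)) (brk b (of_neg V))
            + brk a (brk (brk b (of_neg U)) (of_neg V)) + brk (brk a (of_neg V)) (brk b (of_neg U))" for U V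
      proof -
        let ?U = "of_neg U" and ?V = "of_neg V"
        have 1: "brk (brk (brk a ?U) b) ?V = brk (brk (brk a ?U) ?V) b + brk (brk a ?U) (brk b ?V)"
          by (rule derivation[OF _ b]) (intro m)
        have "brk (brk a (brk b ?U)) ?V = - brk (brk (brk b ?U) a) ?V"
          using bracket_swap[of a "brk b ?U"] by (simp add: m bracket_minus)
        also have "brk (brk (brk b ?U) a) ?V = brk (brk (brk b ?U) ?V) a + brk (brk b ?U) (brk a ?V)"
          by (rule derivation[OF _ a]) (intro m)
        also have "\<dots> = - brk a (brk (brk b ?U) ?V) - brk (brk a ?V) (brk b ?U)"
          using bracket_swap[of "brk (brk b ?U) ?V" a] bracket_swap[of "brk b ?U" "brk a ?V"] by (simp add: m)
        finally have 2: "brk (brk a (brk b ?U)) ?V = brk a (brk (brk b ?U) ?V) + brk (brk a ?V) (brk b ?U)"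
          by simp
        have "brk (brk ?D ?U) ?V = brk (brk (brk a ?U) b) ?V + brk (brk a (brk b ?U)) ?V"
          unfolding derivation[OF am b] by (intro bracket_add m)
        then show ?thesis unfolding 1 2 by simp
      qed
      have "brk ?X (brk ?D ?Y) = - brk (brk ?D ?Y) ?X" by (rule bracket_swap; intro m)
      then have "brk (brk ?D ?X) ?Y + brk ?X (brk ?D ?Y)
          = brk (brk (brk a ?X) ?Y) b - brk (brk (brk a ?Y) ?X) b
            + (brk a (brk (brk b ?X) ?Y) - brk a (brk (brk b ?Y) ?X))"
        by (simp add: J)
      also have "\<dots> = brk (brk (brk a ?X) ?Y - brk (brk a ?Y) ?X) b
          + brk a (brk (brk b ?X) ?Y - brk (brk b ?Y) ?X)"
        by (simp add: bracket_diff m)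
      also have "brk (brk a ?X) ?Y - brk (brk a ?Y) ?X = brk a (brk ?X ?Y)"
        using derivation_neg_neg[OF a, of X Y] bracket_swap[of ?X "brk a ?Y"] by (simp add: m)
      also have "brk (brk b ?X) ?Y - brk (brk b ?Y) ?X = brk b (brk ?X ?Y)"
        using derivation_neg_neg[OF b, of X Y] bracket_swap[of ?X "brk b ?Y"] by (simp add: m)
      also have "brk (brk a (brk ?X ?Y)) b + brk a (brk b (brk ?X ?Y)) = ev ?D (neg_bracket \<Omega> X Y)"
        by (simp add: bracket_nonpos[OF symplectic] ev_eq)
      finally show ?thesis by (simp add: act)
    qed
    ultimately show ?thesis
      using nil unfolding Suc grade_pos_iff by (simp add: m del: grade.simps)
  qed
qed

text \<open>\<open>g i\<close> has degree \<open>i - 2\<close>, hence the shift in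
  \<open>i + j = k + 2\<close>; \<open>i + j < 2\<close> means a degree below -2.\<close>

lemma brk_grade:
  assumes a: "a \<in> g i" and b: "b \<in> g j"
  shows "i + j = k + 2 \<Longrightarrow> brk a b \<in> g k" "i + j < 2 \<Longrightarrow> brk a b = 0"
proof -
  have ge: "\<exists>n'. n = Suc (Suc n')" if "\<not> n < 2" for n using that by (metis add_2_eq_Suc le_add_diff_inverse not_less)
  have neg: "\<exists>X. u = of_neg X \<and> (n = 0 \<longrightarrow> snd X = 0)" if u: "u \<in> g n" and n: "n < 2" for u n
  proof (cases "n = 0")
    case True
    then obtain a where "u = of_neg (a, 0)" using u by auto
    then show ?thesis by (intro exI[of _ "(a, 0)"]) simp
  next
    case False
    then have "n = Suc 0" using n by simp
    then obtain x where "u = of_neg (0, x)" using u by auto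
    then show ?thesis using False by (intro exI[of _ "(0, x)"]) simp
  qed
  show "brk a b \<in> g k" if k: "i + j = k + 2"
  proof (cases "i < 2")
    case True
    show ?thesis
    proof (cases "j < 2")
      case False
      then obtain j' where "j = Suc (Suc j')" using ge by blast
      then show ?thesis using brk_neg_grade[OF a True, of b j'] b k by simp
    next
      case jl: True
      then have "k = 0" using True k by linarith
      obtain X Y where "a = of_neg X" "b = of_neg Y" using neg[OF a True] neg[OF b jl] by blast
      then show ?thesis using \<open>k = 0\<close> by (simp add: bracket_nonpos[OF symplectic] neg_bracket_def)
    qed
  next
    case False
    then obtain i' where i: "i = Suc (Suc i')" using ge by blast
    show ?thesis
    proof (cases "j < 2")
      case True
      have "brk a b = - brk b a" by (rule bracket_swap[OF grade_multilinear[OF a] grade_multilinear[OF b]])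
      moreover have "brk b a \<in> g k" using brk_neg_grade[OF b True, of a i'] a i k by (simp add: add.commute)
      ultimately show ?thesis using prol.subspace_neg[OF subspace_grade] by simp
    next
      case False
      then obtain j' where "j = Suc (Suc j')" using ge by blast
      then show ?thesis using brk_grade_nonneg[of a i' b j'] a b i k by simp
    qed
  qed
  show "brk a b = 0" if "i + j < 2"
  proof -
    have "i < 2" "j < 2" "i = 0 \<or> j = 0" using that by auto
    then obtain X Y where XY: "a = of_neg X" "b = of_neg Y" "snd X = 0 \<or> snd Y = 0"
      using neg[OF a] neg[OF b] by blast
    then have "neg_bracket \<Omega> X Y = 0" by (auto simp: neg_bracket_def form_linear zero_prod_def)
    then show ?thesis using XY by (simp add: bracket_nonpos[OF symplectic])
  qed
qed

text \<open>Induction on the total degree. With an entry of negative degree the identity is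
  \<open>derivation\<close>, or trivial; otherwise the Jacobiator is examined through its brackets
  with negative elements.\<close>

lemma jacobi_grade:
  assumes "a \<in> g i" "b \<in> g j" "c \<in> g k"
  shows "brk a (brk b c) = brk (brk a b) c + brk b (brk a c)"
  using assms
proof (induction "i + j + k" arbitrary: a b c i j k rule: less_induct)
  case less
  note a = less.prems(1) and b = less.prems(2) and c = less.prems(3)
  note am = grade_multilinear[OF a] and bm = grade_multilinear[OF b] and cm = grade_multilinear[OF c]
  note m = multilinear_closed multilinear_bracket am bm cm
  have ge: "\<exists>n'. n = Suc (Suc n')" if "\<not> n < 2" for n using that by (metis add_2_eq_Suc le_add_diff_inverse not_less)
  have neg: "\<exists>X. u = of_neg X" if "u \<in> g n" "n < 2" for u n
    using that less_2_cases[OF that(2)] by (auto simp del: split_paired_Ex)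
  have sw: "brk u v = - brk v u" if "multilinear u" "multilinear v" for u v using bracket_swap that .
  consider "i < 2" "j < 2" "k < 2" | "k < 2" "\<not> j < 2" | "k < 2" "\<not> i < 2" "j < 2"
    | "\<not> k < 2" "j < 2" | "\<not> k < 2" "i < 2" "\<not> j < 2" | "\<not> k < 2" "\<not> i < 2" "\<not> j < 2" by linarith
  then show ?case
  proof cases
    case 1
    then obtain X Y Z where "a = of_neg X" "b = of_neg Y" "c = of_neg Z" using neg a b c by metis
    then show ?thesis
      by (simp add: bracket_nonpos[OF symplectic]) (simp add: neg_bracket_def form_linear flip: zero_prod_def)
  next
    case 2
    obtain j' where j: "j = Suc (Suc j')" using ge 2 by blast
    obtain Z where Z: "c = of_neg Z" using neg[OF c] 2 by blast
    have "brk (brk a b) c = brk (brk a c) b + brk a (brk b c)"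
      using derivation[OF am, of b j' Z] b j Z by simp
    then show ?thesis using sw[of "brk a c" b] by (simp add: m)
  next
    case 3
    obtain i' where i: "i = Suc (Suc i')" using ge 3 by blast
    obtain Z where Z: "c = of_neg Z" using neg[OF c] 3 by blast
    have "brk (brk b a) c = brk (brk b c) a + brk b (brk a c)"
      using derivation[OF bm, of a i' Z] a i Z by simp
    moreover have "brk (brk b a) c = - brk (brk a b) c" "brk (brk b c) a = - brk a (brk b c)"
      using sw[of "brk b c" a] sw[of b a] by (simp_all add: m bracket_minus)
    ultimately have H: "- brk (brk a b) c = - brk a (brk b c) + brk b (brk a c)" by simp
    have "brk a (brk b c) - brk (brk a b) c = brk a (brk b c) + - brk (brk a b) c" by simp
    also have "\<dots> = brk b (brk a c)" unfolding H by simp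
    finally show ?thesis by (simp add: diff_eq_eq add.commute)
  next
    case 4
    obtain k' where k: "k = Suc (Suc k')" using ge 4 by blast
    obtain Y where Y: "b = of_neg Y" using neg[OF b] 4 by blast
    have "brk (brk a c) b = brk (brk a b) c + brk a (brk c b)"
      using derivation[OF am, of c k' Y] c k Y by simp
    moreover have "brk (brk a c) b = - brk b (brk a c)" "brk a (brk c b) = - brk a (brk b c)"
      using sw[of "brk a c" b] sw[of c b] by (simp_all add: m bracket_minus)
    ultimately have "- brk b (brk a c) = brk (brk a b) c - brk a (brk b c)" by simp
    then have "brk (brk a b) c - - brk b (brk a c) = brk (brk a b) c - (brk (brk a b) c - brk a (brk b c))"
      by (simp only:)
    then show ?thesis by simp
  next
    case 5
    obtain k' where k: "k = Suc (Suc k')" using ge 5 by blast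
    obtain X where X: "a = of_neg X" using neg[OF a] 5 by blast
    have "brk (brk b c) a = brk (brk b a) c + brk b (brk c a)"
      using derivation[OF bm, of c k' X] c k X by simp
    then have "- brk a (brk b c) = - (brk (brk a b) c + brk b (brk a c))"
      using sw[of "brk b c" a] sw[of c a] sw[of b a] by (simp add: m bracket_minus)
    then show ?thesis by (simp only: neg_equal_iff_equal)
  next
    case 6
    obtain i' j' k' where ijk: "i = Suc (Suc i')" "j = Suc (Suc j')" "k = Suc (Suc k')" using ge 6 by blast
    note nn = grade_neg_part[OF a[unfolded ijk]] grade_neg_part[OF b[unfolded ijk]] grade_neg_part[OF c[unfolded ijk]]
    \<comment> \<open>Its bracket with a negative element is a sum of Jacobiators of smaller total
      degree, and its part of degree 0 vanishes by the Jacobi identity for matrices.\<close>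
    let ?J = "brk a (brk b c) - (brk (brk a b) c + brk b (brk a c))"
    have nb: "neg_part (brk u v) = 0" "zer_part (brk u v) = zer_bracket (zer_part u) (zer_part v)"
      if "multilinear u" "multilinear v" "neg_part u = 0" "neg_part v = 0" for u v
      using nonneg_bracket_parts that by blast+
    have J0: "neg_part ?J = 0" by (simp add: part_linear nb m nn)
    have zj: "zer_bracket x (zer_bracket y z) = zer_bracket (zer_bracket x y) z + zer_bracket y (zer_bracket x z)"
      for x y z :: "'n zer"
      using commutator_jacobi[of "fst x" "fst y" "fst z"] by (simp add: zer_bracket_def)
    have Jz: "zer_part ?J = 0"
      by (simp add: part_linear nb m nn zj[of "zer_part a" "zer_part b" "zer_part c"])
    have Jm: "multilinear ?J" by (intro m)
    have D: "brk (brk u v) (of_neg X) = brk (brk u (of_neg X)) v + brk u (brk v (of_neg X))"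
      if "multilinear u" "multilinear v" "neg_part u = 0" "neg_part v = 0" for u v X
      using derivation_neg that by blast
    have "brk ?J (of_neg X) = 0" if X: "\<And>u n. u \<in> g (Suc (Suc n)) \<Longrightarrow> \<exists>l < Suc (Suc n). brk u (of_neg X) \<in> g l" for X
    proof -
      let ?a = "brk a (of_neg X)" and ?b = "brk b (of_neg X)" and ?c = "brk c (of_neg X)"
      obtain la lb lc where l: "la < i" "?a \<in> g la" "lb < j" "?b \<in> g lb" "lc < k" "?c \<in> g lc"
        using X a b c unfolding ijk by blast
      have IH: "brk ?a (brk b c) = brk (brk ?a b) c + brk b (brk ?a c)"
        "brk a (brk ?b c) = brk (brk a ?b) c + brk ?b (brk a c)"
        "brk a (brk b ?c) = brk (brk a b) ?c + brk b (brk a ?c)"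
        using less.hyps[of la j k ?a b c] less.hyps[of i lb k a ?b c] less.hyps[of i j lc a b ?c] l a b c
        by auto
      have "brk ?J (of_neg X) = brk (brk a (brk b c)) (of_neg X)
          - (brk (brk (brk a b) c) (of_neg X) + brk (brk b (brk a c)) (of_neg X))"
        by (simp add: bracket_diff bracket_add m)
      also have "\<dots> = 0"
        by (simp add: D m nn nb bracket_add IH algebra_simps)
      finally show ?thesis .
    qed
    then have F: "brk ?J (elF x) = 0" and V: "brk ?J (elV v) = 0" for x v
      using grade_brk_neg(1,2) by (meson lessI less_SucI)+
    have "brk ?J (of_neg X) = ev ?J X" for X
      using bracket_neg(1)[OF Jm J0] Jz by (simp add: nonneg_act_def)
    then have "ev ?J (x, 0) = 0" "ev ?J (0, v) = 0" for x v using F V by auto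
    then have "ev ?J X = 0" for X
      using multilinear_ev(1)[OF Jm, of "(fst X, 0)" "(0, snd X)"] by simp
    moreover have "?J [] = 0" using J0 Jz by (simp add: neg_part_def zer_part_def prod_eq_iff)
    ultimately have "?J = 0" by (intro prol_eqI[of ?J 0]) (simp_all add: fun_apply_list)
    then show ?thesis by simp
  qed
qed

end

subsection \<open>The first prolongation\<close>

context complex_space
begin

lemma fin_dim_injective:
  assumes f: "endo f" and W: "subspace W" "\<And>v. v \<in> W \<Longrightarrow> f v \<in> Z" "\<And>v. v \<in> W \<Longrightarrow> f v = 0 \<Longrightarrow> v = 0"
    and Z: "fin_dim Z"
  shows "fin_dim W" "\<exists>h. endo h \<and> (\<forall>v\<in>W. h (f v) = v)"
proof -
  have "inj_on f W"
  proof (rule inj_onI)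
    fix x y assume "x \<in> W" "y \<in> W" "f x = f y"
    then have "x - y = 0" using W(3)[of "x - y"] W(1) by (simp add: endoD[OF f] subspace_diff)
    then show "x = y" by simp
  qed
  then show h: "\<exists>h. endo h \<and> (\<forall>v\<in>W. h (f v) = v)"
    using pair.linear_exists_left_inverse_on[OF f W(1)] by blast
  then obtain h where h: "endo h" "\<And>v. v \<in> W \<Longrightarrow> h (f v) = v" by blast
  obtain F where F: "finite F" "Z \<subseteq> span F" using Z unfolding fin_dim_def by blast
  interpret h: Vector_Spaces.linear scale scale h by (fact h(1))
  have "W \<subseteq> span (h ` F)" using W(2) F(2) h(2) unfolding h.span_image by (metis imageI subset_iff)
  then show "fin_dim W" using F(1) unfolding fin_dim_def by blast
qed

end

lemma zer_pair_eq: "of_zer (A, h) = of_zer (B, k) \<longleftrightarrow> A = B \<and> h = k"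
  by (metis part_of(6) prod.inject)

lemma of_neg_eq: "of_neg X = of_neg Y \<longleftrightarrow> X = Y"
  by (metis part_of(1))

context symplectic_algebra
begin

lemmas grade_add = prol.subspace_add[OF subspace_grade] and grade_diff = prol.subspace_diff[OF subspace_grade]
  and grade_scale = prol.subspace_scale[OF subspace_grade] and grade_zero = prol.subspace_0[OF subspace_grade]

lemma grade_ev:
  assumes "u \<in> g (Suc (Suc (Suc n)))"
  shows "ev u (a, 0) \<in> g (Suc n)" "ev u (0, x) \<in> g (Suc (Suc n))"
  using assms by (auto simp only: grade.simps mem_Collect_eq)

lemma grade_pos_act: "u \<in> g (Suc (Suc (Suc n))) \<Longrightarrow> brk u (of_neg X) = ev u X"
  using bracket_pos_neg[OF symplectic] multilinear_zero_letter grade_multilinear grade_nil(1) by metis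

lemma brk_neg_left: "u \<in> g (Suc (Suc n)) \<Longrightarrow> brk (of_neg X) u = - brk u (of_neg X)"
  using bracket_swap multilinear_closed(2) grade_multilinear by blast

lemma grade_ev_eq_zero:
  assumes u: "u \<in> g (Suc (Suc (Suc n)))" and F: "ev u (1, 0) = 0" and V: "\<And>x. ev u (0, x) = 0"
  shows "u = 0"
proof (rule prol_eqI)
  note m = grade_multilinear[OF u]
  show "u [] = 0 []" using grade_nil(1)[OF u] by (simp add: zero_fun_apply)
  fix X
  have "ev u X = ev u (neg_scale (fst X) (1, 0)) + ev u (0, snd X)"
    using multilinear_ev(1)[OF m, of "(fst X, 0)" "(0, snd X)"] by (simp add: neg_scale_def)
  then show "ev u X = ev 0 X" using F V by (simp add: multilinear_ev(2)[OF m])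
qed

lemma brk_mixed:
  assumes u: "u \<in> g (Suc (Suc (Suc n)))"
  shows "brk (ev u (1, 0)) (elV x) = brk (ev u (0, x)) (elF 1)"
    and "ev u (\<Omega> x y, 0) = brk (ev u (0, x)) (elV y) - brk (ev u (0, y)) (elV x)"
proof -
  have V: "ev u (0, x) \<in> g (Suc (Suc n))" for x
    using u unfolding grade_pos_iff by blast
  have D: "ev u (neg_bracket \<Omega> X Y) = brk (ev u X) (of_neg Y) + brk (of_neg X) (ev u Y)" for X Y
    using u unfolding grade_pos_iff by blast
  have "ev u (neg_bracket \<Omega> (1, 0) (0, x)) = 0"
    using multilinear_ev(4)[OF grade_multilinear[OF u]]
    by (simp add: neg_bracket_def form_linear flip: zero_prod_def)
  then show "brk (ev u (1, 0)) (elV x) = brk (ev u (0, x)) (elF 1)"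
    using D[of "(1, 0)" "(0, x)"] brk_neg_left[OF V, of "(1, 0)" x] by simp
  show "ev u (\<Omega> x y, 0) = brk (ev u (0, x)) (elV y) - brk (ev u (0, y)) (elV x)"
    using D[of "(0, x)" "(0, y)"] brk_neg_left[OF V, of "(0, x)" y] by (simp add: neg_bracket_def)
qed

lemma form_nonzero: obtains x y where "\<Omega> x y = 1"
proof -
  have "axis undefined (1 :: complex) \<noteq> (0 :: complex^'n)" by (simp add: axis_eq_0_iff)
  then obtain y where y: "\<Omega> (axis undefined 1) y \<noteq> 0" using form_nondegenerate by blast
  show thesis
    by (rule that[of "axis undefined 1" "(1 / \<Omega> (axis undefined 1) y) *s y"]) (use y in \<open>simp add: form_linear\<close>)
qed

text \<open>\<open>F\<close> is a bracket of two elements of g_{-1}, so the value at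
  \<open>F\<close> is determined by the values on g_{-1}.\<close>

lemma grade_ev_V_eq_zero:
  assumes u: "u \<in> g (Suc (Suc (Suc n)))" and V: "\<And>x. ev u (0, x) = 0"
  shows "u = 0"
proof -
  obtain x y where "\<Omega> x y = 1" by (rule form_nonzero)
  then have "ev u (1, 0) = 0"
    using brk_mixed(2)[OF u, of x y] V by (simp add: bracket_zero multilinear_closed)
  then show ?thesis using grade_ev_eq_zero u V by blast
qed

definition g1_elem :: "complex^'n \<Rightarrow> (complex^'n \<Rightarrow> complex^'n^'n) \<Rightarrow> (complex^'n \<Rightarrow> complex) \<Rightarrow> 'n prol" where
  "g1_elem A Q h = (\<lambda>w. case w of [] \<Rightarrow> 0
     | X # w' \<Rightarrow> (elV (fst X *s A) + of_zer (Q (snd X), h (snd X))) w')"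

lemma ev_g1_elem: "ev (g1_elem A Q h) X = elV (fst X *s A) + of_zer (Q (snd X), h (snd X))"
  by (simp add: g1_elem_def ev_def)

text \<open>The assumption \<open>h\<close> is the defining condition on pairs of \<open>F\<close>
  and a vector, the assumption \<open>eq\<close> the one on pairs of vectors.\<close>

lemma g1_elem_grade:
  assumes Q: "\<And>x. Q x \<in> K" "\<And>x y. Q (x + y) = Q x + Q y" "\<And>c x. Q (c *s x) = mat_scale c (Q x)"
    and h: "\<And>x. h x = - (1 / 2) * \<Omega> A x"
    and eq: "\<And>x y. Q x *v y - h x *s y - (Q y *v x - h y *s x) = \<Omega> x y *s A"
  shows "g1_elem A Q h \<in> g (Suc (Suc (Suc 0)))"
  unfolding grade_pos_iff
proof (intro conjI allI)
  let ?u = "g1_elem A Q h"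
  have add: "elV (x + y) = elV x + elV y" and scale: "elV (c *s x) = prol_scale c (elV x)"
    for x y :: "complex^'n" and c
    by (simp_all add: neg_scale_def flip: of_neg_linear)
  have zadd: "of_zer (M + N, a + b) = of_zer (M, a) + of_zer (N, b)" for M N :: "complex^'n^'n" and a b
    by (simp flip: of_zer_linear)
  have zscale: "of_zer (mat_scale c M, c * a) = prol_scale c (of_zer (M, a))" for M :: "complex^'n^'n" and a c
    using of_zer_linear(4)[of c "(M, a)"] by simp
  have hl: "h (x + y) = h x + h y" "h (c *s x) = c * h x" for x y c
    by (simp_all add: h form_linear algebra_simps)
  have z: "Q 0 = 0" "h 0 = 0" using Q(3)[of 0 0] hl(2)[of 0 0] by simp_all
  have e0: "elV (0 :: complex^'n) = 0" "of_zer (0 :: complex^'n^'n, 0) = 0" by (simp_all flip: zero_prod_def)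
  show "?u [] = 0" by (simp add: g1_elem_def)
  show "multilinear ?u"
  proof (rule multilinearI)
    show "ev ?u (X + Y) = ev ?u X + ev ?u Y" for X Y
      by (simp add: ev_g1_elem Q(2) hl add zadd vec.scale_left_distrib)
    show "ev ?u (neg_scale c X) = prol_scale c (ev ?u X)" for c X
      using scale[of c "fst X *s A"]
      by (simp add: ev_g1_elem neg_scale_def Q(3) hl zscale prol.scale_right_distrib)
    show "multilinear (ev ?u X)" for X
      unfolding ev_g1_elem by (intro multilinear_closed)
  qed
  show "ev ?u (a, 0) \<in> g (Suc 0)" for a by (simp add: ev_g1_elem z e0)
  show "ev ?u (0, x) \<in> g (Suc (Suc 0))" for x using Q(1) by (auto simp: ev_g1_elem e0)
  fix X Y :: "'n neg"
  obtain a x b y where XY: "X = (a, x)" "Y = (b, y)" by (metis prod.collapse)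
  have "neg_bracket \<Omega> (0, a *s A) (b, y) + zer_act (Q x, h x) (b, y)
      + (neg_bracket \<Omega> (a, x) (0, b *s A) - zer_act (Q y, h y) (a, x)) = (0, \<Omega> x y *s A)"
    using eq[of x y] form_swap[of x A]
    by (simp add: neg_bracket_def zer_act_def h form_linear algebra_simps)
  then have "of_neg (0, \<Omega> x y *s A) = of_neg (neg_bracket \<Omega> (0, a *s A) (b, y)) + of_neg (zer_act (Q x, h x) (b, y))
      + (of_neg (neg_bracket \<Omega> (a, x) (0, b *s A)) + - of_neg (zer_act (Q y, h y) (a, x)))"
    by (simp flip: of_neg_linear)
  then show "ev ?u (neg_bracket \<Omega> X Y) = brk (ev ?u X) (of_neg Y) + brk (of_neg X) (ev ?u Y)"
    unfolding XY ev_g1_elem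
    by (simp add: neg_bracket_def[of \<Omega> "(a, x)" "(b, y)"] z e0 bracket_add multilinear_closed
        bracket_nonpos[OF symplectic] add.assoc)
qed

lemma g1_data:
  assumes u: "u \<in> g (Suc (Suc (Suc 0)))"
  obtains A Q h where "ev u (1, 0) = elV A" "\<And>x. ev u (0, x) = of_zer (Q x, h x)"
    "\<And>x. Q x \<in> K" "\<And>x y. Q (x + y) = Q x + Q y" "\<And>c x. Q (c *s x) = mat_scale c (Q x)"
    "\<And>x y. h (x + y) = h x + h y" "\<And>c x. h (c *s x) = c * h x"
    "\<And>x y. Q x *v y - h x *s y - (Q y *v x - h y *s x) = \<Omega> x y *s A"
    "\<And>x. h x = - (1 / 2) * \<Omega> A x"
proof -
  note m = grade_multilinear[OF u]
  have "ev u (1, 0) \<in> g (Suc 0)" using u unfolding grade_pos_iff by blast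
  then obtain A where A: "ev u (1, 0) = elV A" by auto
  have "\<forall>x. \<exists>M a. ev u (0, x) = of_zer (M, a) \<and> M \<in> K" using u by auto
  then obtain Q h where Qh: "\<And>x. ev u (0, x) = of_zer (Q x, h x)" "\<And>x. Q x \<in> K" by metis
  have add: "Q (x + y) = Q x + Q y \<and> h (x + y) = h x + h y" for x y
  proof -
    have "of_zer (Q (x + y), h (x + y)) = of_zer (Q x + Q y, h x + h y)"
      using multilinear_ev(1)[OF m, of "(0, x)" "(0, y)"] by (simp add: Qh flip: of_zer_linear)
    then show ?thesis by (simp add: zer_pair_eq)
  qed
  have scale: "Q (c *s x) = mat_scale c (Q x) \<and> h (c *s x) = c * h x" for c x
  proof -
    have "of_zer (Q (c *s x), h (c *s x)) = of_zer (mat_scale c (Q x), c * h x)"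
      using multilinear_ev(2)[OF m, of c "(0, x)"] of_zer_linear(4)[of c "(Q x, h x)"]
      by (simp add: Qh neg_scale_def)
    then show ?thesis by (simp add: zer_pair_eq)
  qed
  have eq: "Q x *v y - h x *s y - (Q y *v x - h y *s x) = \<Omega> x y *s A" for x y
  proof -
    have "ev u (\<Omega> x y, 0) = of_neg (neg_scale (\<Omega> x y) (0, A))"
      using multilinear_ev(2)[OF m, of "\<Omega> x y" "(1, 0)"] by (simp add: neg_scale_def[of _ "(1, 0)"] A of_neg_linear)
    then have "of_neg (neg_scale (\<Omega> x y) (0, A)) = of_neg (zer_act (Q x, h x) (0, y) - zer_act (Q y, h y) (0, x))"
      using brk_mixed(2)[OF u, of x y] by (simp add: Qh bracket_nonpos[OF symplectic] of_neg_linear)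
    then show ?thesis by (simp add: of_neg_eq neg_scale_def zer_act_def)
  qed
  have h: "h x = - (1 / 2) * \<Omega> A x" for x
  proof -
    \<comment> \<open>The factor -1/2 originates here: \<open>H\<close> acts on \<open>F\<close> by
      -2.\<close>
    have "brk (elV A) (elV x) = brk (of_zer (Q x, h x)) (elF 1)"
      using brk_mixed(1)[OF u, of x] by (simp add: A Qh)
    then have "\<Omega> A x = - 2 * h x"
      by (simp add: bracket_nonpos[OF symplectic] of_neg_eq neg_bracket_def zer_act_def)
    then show ?thesis by simp
  qed
  show thesis by (rule that[OF A Qh conjunct1[OF add] conjunct1[OF scale] conjunct2[OF add] conjunct2[OF scale] eq h])
qed

text \<open>Wedging with \<Omega> is injective on linear forms in dimension at least 3: if
  \<open>\<alpha> x\<close> is nonzero, a nonzero \<open>y\<close> in the common kernel of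
  \<open>\<alpha>\<close> and \<open>\<Omega> x\<close> would lie in the radical of
  \<Omega>.\<close>

lemma wedge_zero:
  assumes dim: "CARD('n) \<ge> 3" and \<alpha>: "\<And>x y. \<alpha> (x + y) = \<alpha> x + \<alpha> y" "\<And>c x. \<alpha> (c *s x) = c * \<alpha> x"
    and wedge: "\<And>x y z. \<alpha> x * \<Omega> y z + \<alpha> y * \<Omega> z x + \<alpha> z * \<Omega> x y = 0"
  shows "\<alpha> x = 0"
proof (rule ccontr)
  assume x: "\<alpha> x \<noteq> 0"
  obtain i j :: 'n where ij: "i \<noteq> j"
  proof -
    have "\<exists>j. j \<noteq> (undefined :: 'n)"
    proof (rule ccontr)
      assume "\<not> ?thesis"
      then have "(UNIV :: 'n set) \<subseteq> {undefined}" by auto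
      then have "CARD('n) \<le> 1" by (metis card.empty card_insert_if card_mono empty_iff finite.emptyI finite.insertI One_nat_def)
      then show False using dim by simp
    qed
    then show thesis using that by blast
  qed
  \<comment> \<open>Combines two functionals into a map to a plane; by dimension it has a nonzero
    kernel.\<close>
  let ?f = "\<lambda>y. \<alpha> y *s axis i 1 + \<Omega> x y *s axis j 1 :: complex^'n"
  have "\<exists>y. y \<noteq> 0 \<and> ?f y = 0"
  proof (rule ccontr)
    assume n: "\<not> ?thesis"
    have "card (cart_basis :: (complex^'n) set) \<le> card {axis i 1, axis j (1 :: complex)}"
    proof (rule vs.injective_on_span(1)[OF finite_cart_basis independent_cart_basis, where f = ?f])
      show "vs.endo ?f"
        by (rule vs.endoI) (simp_all add: \<alpha> form_linear vec.scale_left_distrib vec.scale_right_distrib)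
      show "?f y \<in> vec.span {axis i 1, axis j 1}" for y
        by (intro vec.span_add vec.span_scale vec.span_base) auto
    qed (use n in auto)
    also have "\<dots> \<le> 2" by (simp add: card_insert_if)
    finally show False using dim by (simp add: card_cart_basis)
  qed
  then obtain y where y: "y \<noteq> 0" "?f y = 0" by blast
  have "?f y $ i = \<alpha> y" "?f y $ j = \<Omega> x y" using ij by (simp_all add: axis_def)
  then have "\<alpha> y = 0" "\<Omega> x y = 0" using y(2) by simp_all
  then have "\<Omega> y z = 0" for z using wedge[of x y z] x by simp
  then show False using form_nondegenerate y(1) by blast
qed

text \<open>In the cyclic sum of the paired equation the terms with \<open>Q\<close> cancel, because
  \<open>Q x\<close> lies in \<open>sp\<close>. What remains is the wedge of
  \<open>2 * h + \<Omega> A\<close> with \<Omega>.\<close>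

lemma h_determined:
  assumes dim: "CARD('n) \<ge> 3" and Q: "\<And>x. Q x \<in> K" and h: "\<And>x y. h (x + y) = h x + h y" "\<And>c x. h (c *s x) = c * h x"
    and eq: "\<And>x y. Q x *v y - h x *s y - (Q y *v x - h y *s x) = \<Omega> x y *s A"
  shows "h x = - (1 / 2) * \<Omega> A x"
proof -
  have sym: "\<Omega> (Q x *v y) z = \<Omega> (Q x *v z) y" for x y z
  proof -
    have "\<Omega> (Q x *v y) z = - \<Omega> y (Q x *v z)" using Q K_sp' by (intro spD) auto
    then show ?thesis using form_swap[of y "Q x *v z"] by simp
  qed
  have E: "\<Omega> (Q x *v y) z - h x * \<Omega> y z - (\<Omega> (Q y *v x) z - h y * \<Omega> x z) = \<Omega> x y * \<Omega> A z" for x y z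
    using arg_cong[OF eq[of x y], of "\<lambda>v. \<Omega> v z"] by (simp add: form_linear)
  have "2 * h x + \<Omega> A x = 0"
  proof (rule wedge_zero[OF dim, of "\<lambda>x. 2 * h x + \<Omega> A x"])
    fix x y z
    show "(2 * h x + \<Omega> A x) * \<Omega> y z + (2 * h y + \<Omega> A y) * \<Omega> z x + (2 * h z + \<Omega> A z) * \<Omega> x y = 0"
      using E[of x y z] E[of y z x] E[of z x y] sym[of x y z] sym[of y z x] sym[of z x y]
        form_swap[of x z] form_swap[of y x] form_swap[of z y]
      by algebra
  qed (simp_all add: h form_linear algebra_simps)
  then show ?thesis by (simp add: field_simps add_eq_0_iff)
qed

theorem first_prolongation:
  assumes dim: "CARD('n) \<ge> 3"
  shows "bij_betw (\<lambda>u x. ev u (0, x)) (g (Suc (Suc (Suc 0))))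
     {\<phi>. Vector_Spaces.linear (*s) prol_scale \<phi> \<and> range \<phi> \<subseteq> g (Suc (Suc 0)) \<and>
         (\<exists>A. \<forall>x y. brk (\<phi> x) (elV y) - brk (\<phi> y) (elV x) = prol_scale (\<Omega> x y) (elV A))}"
  (is "bij_betw ?e ?G ?R")
proof (rule bij_betwI')
  fix u v assume u: "u \<in> ?G" and v: "v \<in> ?G"
  have "u = v" if e: "?e u = ?e v"
  proof -
    have "ev u (0, x) = ev v (0, x)" for x using fun_cong[OF e] .
    then have "u - v = 0"
      using grade_ev_V_eq_zero[of "u - v" 0] grade_diff[OF u v] by (simp add: ev_linear del: grade.simps)
    then show ?thesis by simp
  qed
  then show "(?e u = ?e v) = (u = v)" by blast
next
  fix u assume u: "u \<in> ?G"
  note m = grade_multilinear[OF u]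
  have "Vector_Spaces.linear (*s) prol_scale (?e u)"
    using multilinear_ev(1)[OF m, of "(0, _)" "(0, _)"] multilinear_ev(2)[OF m, of _ "(0, _)"]
    by (simp add: Vector_Spaces.linear_iff vec.vector_space_axioms prol.vector_space_axioms neg_scale_def)
  moreover have "range (?e u) \<subseteq> g (Suc (Suc 0))" using u unfolding grade_pos_iff by blast
  moreover have "\<exists>A. \<forall>x y. brk (?e u x) (elV y) - brk (?e u y) (elV x) = prol_scale (\<Omega> x y) (elV A)"
  proof -
    have "ev u (1, 0) \<in> g (Suc 0)" using u unfolding grade_pos_iff by blast
    then obtain A where "ev u (1, 0) = elV A" by auto
    then have "ev u (\<Omega> x y, 0) = prol_scale (\<Omega> x y) (elV A)" for x y
      using multilinear_ev(2)[OF m, of "\<Omega> x y" "(1, 0)"] by (simp add: neg_scale_def)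
    then show ?thesis using brk_mixed(2)[OF u] by metis
  qed
  ultimately show "?e u \<in> ?R" by blast
next
  fix \<phi> assume "\<phi> \<in> ?R"
  then obtain A where lin: "Vector_Spaces.linear (*s) prol_scale \<phi>" and ran: "range \<phi> \<subseteq> g (Suc (Suc 0))"
    and A: "\<And>x y. brk (\<phi> x) (elV y) - brk (\<phi> y) (elV x) = prol_scale (\<Omega> x y) (elV A)" by blast
  interpret Vector_Spaces.linear "(*s)" prol_scale \<phi> by (fact lin)
  have "\<exists>M a. \<phi> x = of_zer (M, a) \<and> M \<in> K" for x
  proof -
    have "\<phi> x \<in> g (Suc (Suc 0))" using ran by blast
    then show ?thesis by auto
  qed
  then obtain Q h where Qh: "\<And>x. \<phi> x = of_zer (Q x, h x)" "\<And>x. Q x \<in> K" by metis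
  have add': "Q (x + y) = Q x + Q y \<and> h (x + y) = h x + h y" for x y
  proof -
    have "of_zer (Q (x + y), h (x + y)) = of_zer (Q x + Q y, h x + h y)"
      using add[of x y] by (simp add: Qh flip: of_zer_linear)
    then show ?thesis by (simp add: zer_pair_eq)
  qed
  have scale': "Q (c *s x) = mat_scale c (Q x) \<and> h (c *s x) = c * h x" for c x
  proof -
    have "of_zer (Q (c *s x), h (c *s x)) = of_zer (mat_scale c (Q x), c * h x)"
      using scale[of c x] of_zer_linear(4)[of c "(Q x, h x)"] by (simp add: Qh)
    then show ?thesis by (simp add: zer_pair_eq)
  qed
  have eq: "Q x *v y - h x *s y - (Q y *v x - h y *s x) = \<Omega> x y *s A" for x y
  proof -
    have "of_neg (zer_act (Q x, h x) (0, y) - zer_act (Q y, h y) (0, x)) = of_neg (neg_scale (\<Omega> x y) (0, A))"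
      using A[of x y] by (simp add: Qh bracket_nonpos[OF symplectic] of_neg_linear)
    then show ?thesis by (simp add: of_neg_eq neg_scale_def zer_act_def)
  qed
  \<comment> \<open>The right-hand set imposes nothing on pairs with \<open>F\<close>; that part of
    the defining condition follows from the one on pairs of vectors.\<close>
  have h: "h x = - (1 / 2) * \<Omega> A x" for x
    using h_determined[OF dim Qh(2) conjunct2[OF add'] conjunct2[OF scale'] eq] .
  have "g1_elem A Q h \<in> ?G"
    by (rule g1_elem_grade[OF Qh(2) conjunct1[OF add'] conjunct1[OF scale'] h eq])
  moreover have "\<phi> = ?e (g1_elem A Q h)"
  proof
    have "elV (0 :: complex^'n) = 0" by (simp flip: zero_prod_def)
    then show "\<phi> x = ?e (g1_elem A Q h) x" for x by (simp add: Qh ev_g1_elem)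
  qed
  ultimately show "\<exists>u\<in>?G. \<phi> = ?e u" by blast
qed

end

sublocale irreducible_sp \<subseteq> symplectic_algebra
  by unfold_locales (fact K_sp K_sub)+

section \<open>The irreducible proper case with nonzero first prolongation\<close>

locale special_sp = irreducible_sp \<Omega> K
  for \<Omega> :: "complex^'n \<Rightarrow> complex^'n \<Rightarrow> complex" and K +
  assumes dim: "CARD('n) \<ge> 3" and proper: "K \<noteq> sp \<Omega>"
    and nontrivial: "grade \<Omega> K (Suc (Suc (Suc 0))) \<noteq> {0}"
begin

text \<open>Shifted indices: \<open>g2\<close>, \<open>g3\<close>, \<open>g4\<close>,
  \<open>g5\<close> have degrees 0, 1, 2, 3.\<close>

abbreviation "g2 \<equiv> g (Suc (Suc 0))"
abbreviation "g3 \<equiv> g (Suc (Suc (Suc 0)))"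
abbreviation "g4 \<equiv> g (Suc (Suc (Suc (Suc 0))))"
abbreviation "g5 \<equiv> g (Suc (Suc (Suc (Suc (Suc 0)))))"

lemma elV_zero: "elV x = 0 \<longleftrightarrow> x = (0 :: complex^'n)"
  by (metis of_neg_eq of_zero(1) prod.inject zero_prod_def)

text \<open>In degree 1, \<open>A = 0\<close> forces \<open>h = 0\<close> and puts \<open>Q\<close>
  into the classical prolongation, which vanishes. In higher degree, \<open>u x\<close> is zero at
  \<open>F\<close> because \<open>[u x, F] = [u F, x]\<close>.\<close>

lemma ev_F_injective:
  "u \<in> g (Suc (Suc (Suc n))) \<Longrightarrow> ev u (1, 0) = 0 \<Longrightarrow> u = 0"
proof (induction n arbitrary: u)
  case 0
  obtain A Q h where d: "ev u (1, 0) = elV A" "\<And>x. ev u (0, x) = of_zer (Q x, h x)"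
    "\<And>x. Q x \<in> K" "\<And>x y. Q (x + y) = Q x + Q y" "\<And>c x. Q (c *s x) = mat_scale c (Q x)"
    "\<And>x y. h (x + y) = h x + h y" "\<And>c x. h (c *s x) = c * h x"
    "\<And>x y. Q x *v y - h x *s y - (Q y *v x - h y *s x) = \<Omega> x y *s A"
    "\<And>x. h x = - (1 / 2) * \<Omega> A x"
    by (rule g1_data[OF 0(1)]) (rule that)
  have "A = 0" using d(1) 0(2) elV_zero by metis
  then have h: "h x = 0" for x using d(9) by (simp add: form_linear)
  have "prolongs Q" using d(3-5,8) by (simp add: prolongs_def h \<open>A = 0\<close>)
  then have "Q x = 0" for x by (rule prolongation_zero[OF proper])
  then have "ev u (0, x) = 0" for x by (simp add: d(2) h flip: zero_prod_def)
  then show ?case by (rule grade_ev_V_eq_zero[OF 0(1)])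
next
  case (Suc n)
  have "ev u (0, x) = 0" for x
  proof (rule Suc.IH)
    show V: "ev u (0, x) \<in> g (Suc (Suc (Suc n)))" by (rule grade_ev[OF Suc.prems(1)])
    have "brk (ev u (0, x)) (elF 1) = 0"
      using brk_mixed(1)[OF Suc.prems(1), of x] Suc.prems(2) by (simp add: bracket_zero multilinear_closed)
    then show "ev (ev u (0, x)) (1, 0) = 0" using grade_pos_act[OF V, of "(1, 0)"] by simp
  qed
  then show ?case by (rule grade_ev_V_eq_zero[OF Suc.prems(1)])
qed

lemma elK_grade: "B \<in> K \<Longrightarrow> elK B \<in> g2"
  by auto

lemma elK_act_F:
  assumes B: "B \<in> K" and u: "u \<in> g (Suc (Suc (Suc n)))"
  shows "brk (elK B) u \<in> g (Suc (Suc (Suc n)))" "ev (brk (elK B) u) (1, 0) = brk (elK B) (ev u (1, 0))"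
proof -
  show mem: "brk (elK B) u \<in> g (Suc (Suc (Suc n)))"
    using brk_grade(1)[OF elK_grade[OF B] u] by simp
  have "zer_act (B, 0) (1, 0) = 0" by (simp add: zer_act_def zero_prod_def)
  then have "brk (elK B) (elF 1) = 0" by (simp add: bracket_nonpos[OF symplectic])
  then show "ev (brk (elK B) u) (1, 0) = brk (elK B) (ev u (1, 0))"
    using derivation[OF multilinear_closed(3) u, of "(B, 0)" "(1, 0)"] grade_pos_act[OF mem, of "(1, 0)"]
      grade_pos_act[OF u, of "(1, 0)"] bracket_zero(1)[OF grade_multilinear[OF u]] by simp
qed

lemma elK_elV: "brk (elK B) (elV x) = elV (B *v x)"
  by (simp add: bracket_nonpos[OF symplectic] zer_act_def)

lemma ex_g3: "\<exists>u\<in>g3. ev u (1, 0) = elV A"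
proof -
  let ?W = "{A. \<exists>u\<in>g3. ev u (1, 0) = elV A}"
  have add: "elV (x + y) = elV x + elV y" and scale: "elV (c *s x) = prol_scale c (elV x)"
    for x y :: "complex^'n" and c
    by (simp_all add: neg_scale_def flip: of_neg_linear)
  obtain u where u: "u \<in> g3" "u \<noteq> 0" using nontrivial grade_zero by blast
  have "ev u (1, 0) \<in> g (Suc 0)" by (rule grade_ev[OF u(1)])
  then obtain A0 where A0: "ev u (1, 0) = elV A0" by auto
  have "?W = UNIV"
  proof (rule irreducible)
    show "vec.subspace ?W"
    proof (rule vec.subspaceI)
      have "ev 0 (1, 0) = (elV 0 :: 'n prol)" using elV_zero[of 0] by simp
      then show "0 \<in> ?W" using grade_zero[of "Suc (Suc (Suc 0))"] by blast
      show "x + y \<in> ?W" if xy: "x \<in> ?W" "y \<in> ?W" for x y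
      proof -
        obtain u v where "u \<in> g3" "v \<in> g3" "ev u (1, 0) = elV x" "ev v (1, 0) = elV y" using xy by blast
        then have "u + v \<in> g3" "ev (u + v) (1, 0) = elV (x + y)" using grade_add add by (simp_all add: ev_linear del: grade.simps)
        then show ?thesis by blast
      qed
      show "c *s x \<in> ?W" if x: "x \<in> ?W" for c x
      proof -
        obtain u where "u \<in> g3" "ev u (1, 0) = elV x" using x by blast
        then have "prol_scale c u \<in> g3" "ev (prol_scale c u) (1, 0) = elV (c *s x)"
          using grade_scale scale by (simp_all add: ev_linear del: grade.simps)
        then show ?thesis by blast
      qed
    qed
    show "B *v x \<in> ?W" if "B \<in> K" and x: "x \<in> ?W" for B x
    proof -
      obtain u where u: "u \<in> g3" "ev u (1, 0) = elV x" using x by blast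
      have "ev (brk (elK B) u) (1, 0) = elV (B *v x)"
        using elK_act_F(2)[OF \<open>B \<in> K\<close> u(1)] by (simp only: u(2) elK_elV)
      then show ?thesis using elK_act_F(1)[OF \<open>B \<in> K\<close> u(1)] by blast
    qed
    show "A0 \<in> ?W" using u(1) A0 by blast
    show "A0 \<noteq> 0" using ev_F_injective[OF u(1)] u(2) A0 elV_zero by metis
  qed
  then show ?thesis by blast
qed

text \<open>The inverse of evaluation at \<open>F\<close> on \<open>g3\<close>.\<close>

definition U :: "complex^'n \<Rightarrow> 'n prol" where
  "U A = (SOME u. u \<in> g3 \<and> ev u (1, 0) = elV A)"

lemma U: "U A \<in> g3" "ev (U A) (1, 0) = elV A"
proof -
  have "U A \<in> g3 \<and> ev (U A) (1, 0) = elV A"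
    unfolding U_def by (rule someI_ex[of "\<lambda>u. u \<in> g3 \<and> ev u (1, 0) = elV A"]) (use ex_g3 in blast)
  then show "U A \<in> g3" "ev (U A) (1, 0) = elV A" by blast+
qed

lemma U_eqI: "u \<in> g3 \<Longrightarrow> ev u (1, 0) = elV A \<Longrightarrow> u = U A"
  using ev_F_injective[of "u - U A" 0] grade_diff[of u _ "U A"] U[of A]
  by (simp add: ev_linear del: grade.simps)

lemma U_linear:
  "U (A + B) = U A + U B" "U (c *s A) = prol_scale c (U A)" "U (A - B) = U A - U B" "U 0 = 0"
proof -
  have add: "elV (x + y) = elV x + elV y" and scale: "elV (c *s x) = prol_scale c (elV x)"
    for x y :: "complex^'n" and c
    by (simp_all add: neg_scale_def flip: of_neg_linear)
  show 1: "U (A + B) = U A + U B" for A B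
    by (rule U_eqI[symmetric]) (simp_all add: grade_add U ev_linear add del: grade.simps)
  show 2: "U (c *s A) = prol_scale c (U A)" for c A
    by (rule U_eqI[symmetric]) (simp_all add: grade_scale U ev_linear scale del: grade.simps)
  show "U (A - B) = U A - U B" using 1[of "A - B" B] by simp
  show "U 0 = 0" using 2[of 0 0] by simp
qed

lemma U_surj: "u \<in> g3 \<Longrightarrow> \<exists>A. u = U A"
proof -
  assume u: "u \<in> g3"
  then have "ev u (1, 0) \<in> g (Suc 0)" by (rule grade_ev)
  then obtain A where "ev u (1, 0) = elV A" by auto
  then show ?thesis using U_eqI[OF u] by blast
qed

lemma U_inj: "U A = U B \<Longrightarrow> A = B"
  using U(2) by (metis of_neg_eq prod.inject)

lemma U_act: "B \<in> K \<Longrightarrow> brk (elK B) (U A) = U (B *v A)"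
  by (rule U_eqI) (use elK_act_F[of B "U A" 0] U elK_elV in \<open>auto simp del: grade.simps\<close>)

definition Q :: "complex^'n \<Rightarrow> complex^'n \<Rightarrow> complex^'n^'n" where
  "Q A x = fst (zer_part (ev (U A) (0, x)))"

lemma Q:
  "ev (U A) (0, x) = of_zer (Q A x, - (1 / 2) * \<Omega> A x)" "Q A x \<in> K"
  "Q A x *v y - Q A y *v x = \<Omega> x y *s A - (1 / 2 * \<Omega> A x) *s y + (1 / 2 * \<Omega> A y) *s x"
proof -
  obtain A' Q' h where d: "ev (U A) (1, 0) = elV A'" "\<And>x. ev (U A) (0, x) = of_zer (Q' x, h x)"
    "\<And>x. Q' x \<in> K" "\<And>x y. Q' (x + y) = Q' x + Q' y" "\<And>c x. Q' (c *s x) = mat_scale c (Q' x)"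
    "\<And>x y. h (x + y) = h x + h y" "\<And>c x. h (c *s x) = c * h x"
    "\<And>x y. Q' x *v y - h x *s y - (Q' y *v x - h y *s x) = \<Omega> x y *s A'"
    "\<And>x. h x = - (1 / 2) * \<Omega> A' x"
    by (rule g1_data[OF U(1)[of A]]) (rule that)
  have A': "A' = A" using d(1) U(2)[of A] of_neg_eq by (metis prod.inject)
  have Q': "Q A x = Q' x" for x by (simp add: Q_def d(2))
  show "ev (U A) (0, x) = of_zer (Q A x, - (1 / 2) * \<Omega> A x)" "Q A x \<in> K"
    by (simp_all add: d(2,3,9) Q' A')
  show "Q A x *v y - Q A y *v x = \<Omega> x y *s A - (1 / 2 * \<Omega> A x) *s y + (1 / 2 * \<Omega> A y) *s x"
    using d(8)[of x y] unfolding A' Q' d(9) by (simp add: algebra_simps)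
qed

text \<open>An element of \<open>g3\<close> is known from its bracket with \<open>F\<close>, and
  \<open>[w x, F] = [w F, x]\<close>.\<close>

lemma g4_ev:
  assumes w: "w \<in> g4" and C: "ev w (1, 0) = of_zer (C, c)"
  shows "ev w (0, x) = U (C *v x - c *s x)"
proof (rule U_eqI)
  show V: "ev w (0, x) \<in> g3" by (rule grade_ev[OF w])
  show "ev (ev w (0, x)) (1, 0) = elV (C *v x - c *s x)"
    using brk_mixed(1)[OF w, of x] grade_pos_act[OF V, of "(1, 0)"]
    by (simp add: C bracket_nonpos[OF symplectic] zer_act_def)
qed

subsection \<open>Vanishing of the third prolongation\<close>

lemma fin_dim_nil: "prol.fin_dim {u :: 'n prol. \<forall>w. w \<noteq> [] \<longrightarrow> u w = 0}" (is "prol.fin_dim ?W")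
proof (rule prol.fin_dim_functionals)
  let ?I = "{\<lambda>u. fst (fst (u []))} \<union> range (\<lambda>i u. snd (fst (u [])) $ i)
    \<union> range (\<lambda>(i, j) u. fst (snd (u [])) $ i $ j) \<union> {\<lambda>u. snd (snd (u []))} :: ('n prol \<Rightarrow> complex) set"
  show "finite ?I" by simp
  show "prol.subspace ?W"
    by (rule prol.subspaceI) (auto simp: fun_apply prol_scale_at comp_scale_linear)
  show "Vector_Spaces.linear prol_scale (*) (id f)" if "f \<in> ?I" for f
    using that
    by (auto simp: Vector_Spaces.linear_iff prol.vector_space_axioms vector_space_over_itself.vector_space_axioms
        fun_apply prol_scale_def neg_scale_def mat_scale_def)
  fix u assume u: "u \<in> ?W" "\<And>f. f \<in> ?I \<Longrightarrow> id f u = 0"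
  have "fst (fst (u [])) = 0" "snd (snd (u [])) = 0" using u(2) by auto
  moreover have "snd (fst (u [])) $ i = 0" "fst (snd (u [])) $ i $ j = 0" for i j
  proof -
    have "(\<lambda>u. snd (fst (u [])) $ i) \<in> ?I" by blast
    from u(2)[OF this] show "snd (fst (u [])) $ i = 0" by simp
    have "(\<lambda>(i, j) u. fst (snd (u [])) $ i $ j) (i, j) \<in> ?I" by blast
    from u(2)[OF this] show "fst (snd (u [])) $ i $ j = 0" by simp
  qed
  ultimately have "u [] = 0" by (simp add: prod_eq_iff vec_eq_iff)
  then have "u w = 0" for w using u(1) by (cases w) auto
  then show "u = 0" by (simp add: fun_eq_iff fun_apply)
qed

lemma fin_dim_low: "prol.fin_dim (g (Suc 0))" "prol.fin_dim g2"
  by (rule prol.fin_dim_subset[OF fin_dim_nil]; auto simp: of_neg_def of_zer_def)+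

lemma F_injective:
  assumes "prol.fin_dim (g (Suc n))"
  shows "prol.fin_dim (g (Suc (Suc (Suc n))))"
    "\<exists>h. prol.endo h \<and> (\<forall>v\<in>g (Suc (Suc (Suc n))). h (ev v (1, 0)) = v)"
proof -
  have 1: "ev v (1, 0) \<in> g (Suc n)" if "v \<in> g (Suc (Suc (Suc n)))" for v
    by (rule grade_ev[OF that])
  have 2: "v = 0" if "v \<in> g (Suc (Suc (Suc n)))" "ev v (1, 0) = 0" for v
    using ev_F_injective that by blast
  show "prol.fin_dim (g (Suc (Suc (Suc n))))"
    by (rule prol.fin_dim_injective(1)[where f = "\<lambda>u. ev u (1, 0)" and Z = "g (Suc n)"])
      (fact endo_ev subspace_grade 1 2 assms)+
  show "\<exists>h. prol.endo h \<and> (\<forall>v\<in>g (Suc (Suc (Suc n))). h (ev v (1, 0)) = v)"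
    by (rule prol.fin_dim_injective(2)[where f = "\<lambda>u. ev u (1, 0)" and Z = "g (Suc n)"])
      (fact endo_ev subspace_grade 1 2 assms)+
qed

text \<open>A nonzero \<open>g5\<close> would be identified with \<open>g3\<close> by the bracket with \<open>F\<close>, and then the brackets
  with \<open>elV x\<close> would represent the Heisenberg relation on the finite-dimensional space \<open>g5 + g4\<close>.\<close>

lemma g5_zero: "g5 = {0}"
proof (rule ccontr)
  assume ne: "g5 \<noteq> {0}"
  let ?W = "{A. \<exists>v\<in>g5. ev v (1, 0) = U A}"
  have F5: "ev v (1, 0) \<in> g3" and V5: "ev v (0, x) \<in> g4" if "v \<in> g5" for v x
    using grade_ev[OF that] by blast+
  have V4: "ev w (0, x) \<in> g3" and F4: "ev w (1, 0) \<in> g2" if "w \<in> g4" for w x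
    using grade_ev[OF that] by blast+
  obtain v0 where v0: "v0 \<in> g5" "v0 \<noteq> 0" using ne grade_zero by blast
  obtain A0 where A0: "ev v0 (1, 0) = U A0" using U_surj[OF F5[OF v0(1)]] by blast
  \<comment> \<open>Evaluation at \<open>F\<close> maps \<open>g5\<close> to a nonzero
    \<open>K\<close>-invariant part of \<open>g3\<close>, which irreducibility makes all of
    \<open>g3\<close>; so it is invertible, with inverse \<open>h\<close>.\<close>
  have "?W = UNIV"
  proof (rule irreducible)
    show "vec.subspace ?W"
    proof (rule vec.subspaceI)
      have "ev 0 (1, 0) = U 0" using U_linear(4) by simp
      then show "0 \<in> ?W" using grade_zero[of "Suc (Suc (Suc (Suc (Suc 0))))"] by blast
      show "x + y \<in> ?W" if xy: "x \<in> ?W" "y \<in> ?W" for x y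
      proof -
        obtain u v where "u \<in> g5" "v \<in> g5" "ev u (1, 0) = U x" "ev v (1, 0) = U y" using xy by blast
        then have "u + v \<in> g5" "ev (u + v) (1, 0) = U (x + y)"
          using grade_add by (simp_all add: ev_linear U_linear del: grade.simps)
        then show ?thesis by blast
      qed
      show "c *s x \<in> ?W" if x: "x \<in> ?W" for c x
      proof -
        obtain u where "u \<in> g5" "ev u (1, 0) = U x" using x by blast
        then have "prol_scale c u \<in> g5" "ev (prol_scale c u) (1, 0) = U (c *s x)"
          using grade_scale by (simp_all add: ev_linear U_linear del: grade.simps)
        then show ?thesis by blast
      qed
    qed
    show "B *v x \<in> ?W" if "B \<in> K" and x: "x \<in> ?W" for B x
    proof -
      obtain u where u: "u \<in> g5" "ev u (1, 0) = U x" using x by blast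
      have "ev (brk (elK B) u) (1, 0) = U (B *v x)"
        using elK_act_F(2)[OF \<open>B \<in> K\<close> u(1)] by (simp only: u(2) U_act[OF \<open>B \<in> K\<close>])
      then show ?thesis using elK_act_F(1)[OF \<open>B \<in> K\<close> u(1)] by blast
    qed
    show "A0 \<in> ?W" using v0(1) A0 by blast
    show "A0 \<noteq> 0" using ev_F_injective[OF v0(1)] v0(2) A0 U_linear(4) by metis
  qed
  then have surj: "\<exists>v\<in>g5. ev v (1, 0) = u" if "u \<in> g3" for u using U_surj[OF that] by blast
  have fd: "prol.fin_dim g4" "prol.fin_dim g3" "prol.fin_dim g5"
    using F_injective(1) fin_dim_low by blast+
  obtain h where h: "prol.endo h" "\<And>v. v \<in> g5 \<Longrightarrow> h (ev v (1, 0)) = v"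
    using F_injective(2)[OF fd(2)] by blast
  have h5: "h u \<in> g5" "ev (h u) (1, 0) = u" if "u \<in> g3" for u using surj[OF that] h(2) by force+
  \<comment> \<open>\<open>f\<close> lowers \<open>g5\<close> to \<open>g4\<close> by the bracket
    with \<open>x\<close>. \<open>k\<close> goes back up: it brackets \<open>g4\<close> down to
    \<open>g3\<close> and then inverts evaluation at \<open>F\<close>.\<close>
  define f where "f x v = ev v (0, x)" for x :: "complex^'n" and v
  define k where "k x w = h (ev w (0, x))" for x :: "complex^'n" and w
  have endo: "prol.endo (f x)" "prol.endo (k x)" for x
    unfolding f_def k_def
    by (rule endo_ev) (rule prol.endoI; simp add: ev_linear prol.endoD[OF h(1)])
  have f: "f x v \<in> g4" if "v \<in> g5" for x v using V5[OF that] by (simp add: f_def del: grade.simps)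
  have k: "k x w \<in> g5" if "w \<in> g4" for x w using h5 V4[OF that] by (simp add: k_def del: grade.simps)
  have scaleF: "ev u (c, 0) = prol_scale c (ev u (1, 0))" if "multilinear u" for u c
    using multilinear_ev(2)[OF that, of c "(1, 0)"] by (simp add: neg_scale_def)
  have rel: "ev (ev u (0, x)) (0, y) - ev (ev u (0, y)) (0, x) = prol_scale (\<Omega> x y) (ev u (1, 0))"
    if u: "u \<in> g (Suc (Suc (Suc (Suc n))))" for u x y n
  proof -
    have V: "ev u (0, x) \<in> g (Suc (Suc (Suc n)))" for x by (rule grade_ev[OF u])
    show ?thesis
      using brk_mixed(2)[OF u, of x y] grade_pos_act[OF V, of x "(0, y)"] grade_pos_act[OF V, of y "(0, x)"]
        scaleF[OF grade_multilinear[OF u], of "\<Omega> x y"] by simp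
  qed
  have rel5: "k y (f x v) - k x (f y v) = prol_scale (\<Omega> x y) v" if v: "v \<in> g5" for x y v
  proof -
    have "k y (f x v) - k x (f y v) = h (ev (ev v (0, x)) (0, y) - ev (ev v (0, y)) (0, x))"
      by (simp add: k_def f_def prol.endoD[OF h(1)])
    then show ?thesis using rel[OF v] h(2)[OF v] by (simp add: prol.endoD[OF h(1)])
  qed
  have swap: "ev (ev v (0, x)) (1, 0) = ev (ev v (1, 0)) (0, x)" if v: "v \<in> g5" for v x
    using brk_mixed(1)[OF v, of x] grade_pos_act[OF F5[OF v], of "(0, x)"] grade_pos_act[OF V5[OF v], of x "(1, 0)"]
    by simp
  have rel4: "f y (k x w) - f x (k y w) = prol_scale (\<Omega> x y) w" if w: "w \<in> g4" for x y w
  proof -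
    have F: "ev (f y (k x w)) (1, 0) = ev (ev w (0, x)) (0, y)" for x y
    proof -
      have "ev (f y (k x w)) (1, 0) = ev (ev (k x w) (1, 0)) (0, y)"
        unfolding f_def by (rule swap[OF k[OF w]])
      also have "ev (k x w) (1, 0) = ev w (0, x)" unfolding k_def by (rule h5(2)[OF V4[OF w]])
      finally show ?thesis .
    qed
    have "f y (k x w) - f x (k y w) - prol_scale (\<Omega> x y) w = 0"
    proof (rule ev_F_injective)
      show "f y (k x w) - f x (k y w) - prol_scale (\<Omega> x y) w \<in> g4"
        by (intro grade_diff grade_scale f k w)
      show "ev (f y (k x w) - f x (k y w) - prol_scale (\<Omega> x y) w) (1, 0) = 0"
        using rel[OF w, of x y] by (simp add: ev_linear F)
    qed
    then show ?thesis by simp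
  qed
  obtain B5 where B5: "finite B5" "prol.independent B5" "prol.span B5 = g5"
    using prol.fin_dim_basis[OF fd(3) subspace_grade] by blast
  obtain B4 where B4: "finite B4" "prol.independent B4" "prol.span B4 = g4"
    using prol.fin_dim_basis[OF fd(1) subspace_grade] by blast
  have in5: "b \<in> g5" if "b \<in> B5" for b using that B5(3) prol.span_base by blast
  have in4: "b \<in> g4" if "b \<in> B4" for b using that B4(3) prol.span_base by blast
  obtain x y where xy: "\<Omega> x y = 1" by (rule form_nonzero)
  \<comment> \<open>Cyclicity identifies the four traces in pairs with opposite signs, so the
    identity has trace zero on \<open>g5 + g4\<close> together.\<close>
  have comm: "prol.tr B5 (\<lambda>v. k y (f x v)) = prol.tr B4 (\<lambda>w. f x (k y w))" for x y
    by (rule prol.tr_comm) (use B5 B4 endo f k in \<open>auto simp del: grade.simps\<close>)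
  have 5: "prol.tr B5 (\<lambda>v. k y (f x v)) - prol.tr B5 (\<lambda>v. k x (f y v)) = of_nat (card B5)"
  proof -
    have "prol.tr B5 (\<lambda>v. k y (f x v)) - prol.tr B5 (\<lambda>v. k x (f y v)) = prol.tr B5 (\<lambda>v. k y (f x v) - k x (f y v))"
      by (rule prol.tr_diff[symmetric]) (use B5 in5 f k in \<open>auto simp del: grade.simps\<close>)
    also have "\<dots> = (\<Sum>b\<in>B5. 1)"
      by (rule prol.tr_eigen[OF B5(2)]) (simp only: rel5[OF in5] xy)
    finally show ?thesis by simp
  qed
  have 4: "prol.tr B4 (\<lambda>w. f y (k x w)) - prol.tr B4 (\<lambda>w. f x (k y w)) = of_nat (card B4)"
  proof -
    have "prol.tr B4 (\<lambda>w. f y (k x w)) - prol.tr B4 (\<lambda>w. f x (k y w)) = prol.tr B4 (\<lambda>w. f y (k x w) - f x (k y w))"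
      by (rule prol.tr_diff[symmetric]) (use B4 in4 f k in \<open>auto simp del: grade.simps\<close>)
    also have "\<dots> = (\<Sum>b\<in>B4. 1)"
      by (rule prol.tr_eigen[OF B4(2)]) (simp only: rel4[OF in4] xy)
    finally show ?thesis by simp
  qed
  have "of_nat (card B5 + card B4) = (0 :: complex)"
    unfolding of_nat_add 4[symmetric] 5[symmetric] comm by simp
  then have "card B5 = 0" by (simp only: of_nat_eq_0_iff)
  then have "B5 = {}" using B5(1) by simp
  then show False using B5(3) ne by (simp add: prol.span_empty)
qed

subsection \<open>The second prolongation\<close>

text \<open>Evaluate at \<open>F\<close>: \<open>H\<close> has weight -1 on \<open>A\<close> and -2
  on \<open>F\<close>, hence +1 on \<open>U A\<close>.\<close>

lemma zer_U: "C \<in> K \<Longrightarrow> brk (of_zer (C, c)) (U A) = U (C *v A + c *s A)"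
proof (rule U_eqI)
  assume "C \<in> K"
  then have z: "of_zer (C, c) \<in> g2" by auto
  show mem: "brk (of_zer (C, c)) (U A) \<in> g3" by (rule brk_grade(1)[OF z U(1)]) simp
  have "brk (elF (- 2 * c)) (U A) = prol_scale (2 * c) (elV A)"
  proof -
    have "brk (elF (- 2 * c)) (U A) = - ev (U A) (neg_scale (- 2 * c) (1, 0))"
      using brk_neg_left[OF U(1)] grade_pos_act[OF U(1)] by (simp add: neg_scale_def)
    also have "\<dots> = - prol_scale (- 2 * c) (elV A)"
      by (simp only: multilinear_ev(2)[OF grade_multilinear[OF U(1)]] U(2))
    finally show ?thesis by simp
  qed
  moreover have "brk (of_zer (C, c)) (elF 1) = elF (- 2 * c)" "brk (of_zer (C, c)) (elV A) = elV (C *v A - c *s A)"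
    by (simp_all add: bracket_nonpos[OF symplectic] zer_act_def)
  ultimately have "ev (brk (of_zer (C, c)) (U A)) (1, 0) = prol_scale (2 * c) (elV A) + elV (C *v A - c *s A)"
    using derivation[OF multilinear_closed(3) U(1), of "(C, c)" A "(1, 0)"] grade_pos_act[OF mem, of "(1, 0)"]
      grade_pos_act[OF U(1), of A "(1, 0)"] U(2)[of A] by simp
  also have "\<dots> = elV ((2 * c) *s A + (C *v A - c *s A))"
    by (simp add: neg_scale_def flip: of_neg_linear)
  also have "(2 * c) *s A + (C *v A - c *s A) = C *v A + c *s A"
    by (simp add: vec_eq_iff algebra_simps)
  finally show "ev (brk (of_zer (C, c)) (U A)) (1, 0) = elV (C *v A + c *s A)" .
qed

text \<open>\<open>[w, U A]\<close> lies in \<open>g5\<close> and is zero. Its value at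
  \<open>F\<close> is \<open>U\<close> of \<open>(C A + c A) + (C A - c A)\<close>, so
  \<open>C\<close> vanishes.\<close>

lemma g4_data:
  assumes w: "w \<in> g4" obtains c where "ev w (1, 0) = of_zer (0, c)"
proof -
  have "ev w (1, 0) \<in> g2" by (rule grade_ev[OF w])
  then obtain C c where C: "ev w (1, 0) = of_zer (C, c)" "C \<in> K" by auto
  have "C *v A = 0" for A
  proof -
    have "brk w (U A) \<in> g5" by (rule brk_grade(1)[OF w U(1)]) simp
    then have "brk w (U A) = 0" using g5_zero by blast
    then have "0 = brk (brk w (elF 1)) (U A) + brk w (brk (U A) (elF 1))"
      using derivation[OF grade_multilinear[OF w] U(1), of A "(1, 0)"] by (simp add: bracket_zero multilinear_closed)
    also have "brk w (elF 1) = of_zer (C, c)" using grade_pos_act[OF w] C(1) by simp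
    also have "brk (U A) (elF 1) = elV A" using grade_pos_act[OF U(1)] U(2) by simp
    also have "brk w (elV A) = U (C *v A - c *s A)" using grade_pos_act[OF w] g4_ev[OF w C(1)] by simp
    also have "brk (of_zer (C, c)) (U A) = U (C *v A + c *s A)" by (rule zer_U[OF C(2)])
    finally have "U (C *v A + c *s A + (C *v A - c *s A)) = U 0" by (simp only: U_linear)
    then have "C *v A + c *s A + (C *v A - c *s A) = 0" by (rule U_inj)
    then show ?thesis by (simp add: vec_eq_iff)
  qed
  then have "C = 0" by (simp add: matrix_eq)
  then show thesis using that C(1) by simp
qed

lemma UU: "brk (U A) (U B) \<in> g4" "ev (brk (U A) (U B)) (1, 0) = of_zer (Q A B - Q B A, - \<Omega> A B)"
proof -
  show mem: "brk (U A) (U B) \<in> g4" by (rule brk_grade(1)[OF U(1) U(1)]) simp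
  have "ev (brk (U A) (U B)) (1, 0) = brk (elV A) (U B) + brk (U A) (elV B)"
    using derivation[OF grade_multilinear[OF U(1)] U(1), of A B "(1, 0)"] grade_pos_act[OF mem, of "(1, 0)"]
      grade_pos_act[OF U(1), of _ "(1, 0)"] U(2) by simp
  also have "\<dots> = of_zer (Q A B, - (1 / 2) * \<Omega> A B) - of_zer (Q B A, - (1 / 2) * \<Omega> B A)"
    using brk_neg_left[OF U(1)] grade_pos_act[OF U(1)] Q(1) by simp
  also have "\<dots> = of_zer (Q A B - Q B A, - \<Omega> A B)"
    using form_swap[of B A] by (simp flip: of_zer_linear)
  finally show "ev (brk (U A) (U B)) (1, 0) = of_zer (Q A B - Q B A, - \<Omega> A B)" .
qed

text \<open>The difference is the \<open>K\<close>-component of \<open>[U A, U B]\<close> at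
  \<open>F\<close>, which is zero by \<open>g4_data\<close>.\<close>

lemma Q_sym: "Q A B = Q B A"
proof -
  obtain c where "ev (brk (U A) (U B)) (1, 0) = of_zer (0, c)" by (rule g4_data[OF UU(1)])
  then show ?thesis using UU(2)[of A B] by (simp add: zer_pair_eq)
qed

text \<open>The generator of \<open>g4\<close>, normalized by \<open>[W0, F] = H\<close>; it is
  realized as a bracket of two elements of \<open>g3\<close>.\<close>

definition W0 :: "'n prol" where
  "W0 = (SOME w. w \<in> g4 \<and> ev w (1, 0) = of_zer (0, 1))"

lemma W0: "W0 \<in> g4" "ev W0 (1, 0) = of_zer (0, 1)"
proof -
  obtain x y where xy: "\<Omega> x y = 1" by (rule form_nonzero)
  have "ev (brk (U y) (U x)) (1, 0) = of_zer (0, 1)"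
    using UU(2)[of y x] xy form_swap[of y x] Q_sym[of x y] by simp
  then have "\<exists>w. w \<in> g4 \<and> ev w (1, 0) = of_zer (0, 1)" using UU(1) by blast
  then have "W0 \<in> g4 \<and> ev W0 (1, 0) = of_zer (0, 1)" unfolding W0_def by (rule someI_ex)
  then show "W0 \<in> g4" "ev W0 (1, 0) = of_zer (0, 1)" by blast+
qed

lemma g4_eq: "w \<in> g4 \<Longrightarrow> \<exists>c. w = prol_scale c W0"
proof -
  assume w: "w \<in> g4"
  obtain c where c: "ev w (1, 0) = of_zer (0, c)" by (rule g4_data[OF w])
  have "prol_scale c (of_zer (0, 1)) = (of_zer (0, c) :: 'n prol)" using of_zer_linear(4)[of c "(0, 1) :: 'n zer"] by simp
  then have "ev (w - prol_scale c W0) (1, 0) = 0" by (simp add: ev_linear c W0)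
  then have "w - prol_scale c W0 = 0"
    by (rule ev_F_injective[OF grade_diff[OF w grade_scale[OF W0(1)]]])
  then show ?thesis by (intro exI[of _ c]) simp
qed

lemma elK_W0: "B \<in> K \<Longrightarrow> brk (elK B) W0 = 0"
proof (rule ev_F_injective)
  assume B: "B \<in> K"
  show "brk (elK B) W0 \<in> g4" by (rule elK_act_F(1)[OF B W0(1)])
  have "zer_bracket (B, 0) (0, 1) = 0" by (simp add: zer_bracket_def commutator_linear zero_prod_def)
  then show "ev (brk (elK B) W0) (1, 0) = 0"
    using elK_act_F(2)[OF B W0(1)] by (simp add: W0 bracket_nonpos[OF symplectic])
qed

lemma zer_act_elK: "zer_act (B, 0) (0, x) = (0, B *v x)"
  by (simp add: zer_act_def)

lemma Q_equivariant: "B \<in> K \<Longrightarrow> commutator B (Q A x) = Q (B *v A) x + Q A (B *v x)"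
proof -
  assume B: "B \<in> K"
  have "brk (elK B) (brk (U A) (elV x)) = brk (brk (elK B) (U A)) (elV x) + brk (U A) (brk (elK B) (elV x))"
    by (rule jacobi_grade[OF elK_grade[OF B] U(1)]) (rule elV_grade)
  then have "of_zer (zer_bracket (B, 0) (Q A x, - (1 / 2) * \<Omega> A x))
      = of_zer (Q (B *v A) x, - (1 / 2) * \<Omega> (B *v A) x) + of_zer (Q A (B *v x), - (1 / 2) * \<Omega> A (B *v x))"
    by (simp only: U_act[OF B] zer_act_elK grade_pos_act[OF U(1)] Q(1) bracket_nonpos[OF symplectic])
  then have "zer_bracket (B, 0) (Q A x, - (1 / 2) * \<Omega> A x)
      = (Q (B *v A) x, - (1 / 2) * \<Omega> (B *v A) x) + (Q A (B *v x), - (1 / 2) * \<Omega> A (B *v x))"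
    unfolding of_zer_linear(1)[symmetric] by (metis part_of(6))
  then show "commutator B (Q A x) = Q (B *v A) x + Q A (B *v x)" by (simp add: zer_bracket_def)
qed

subsection \<open>The ideal generated by the first prolongation\<close>

definition Q_ideal :: "(complex^'n^'n) set" where
  "Q_ideal = gl.span {Q A x | A x. True}"

lemma ideal_Q_ideal: "ideal Q_ideal"
  unfolding Q_ideal_def
proof (rule ideal_span)
  let ?E = "{Q A x | A x. True}"
  show "?E \<subseteq> K" using Q(2) by blast
  fix B C assume B: "B \<in> K" and "C \<in> ?E"
  then obtain A x where C: "C = Q A x" by blast
  show "commutator B C \<in> gl.span ?E"
    unfolding C Q_equivariant[OF B] by (intro gl.span_add gl.span_base) blast+
qed

definition centralizer :: "(complex^'n^'n) set" where
  "centralizer = {X \<in> K. \<forall>A x. commutator X (Q A x) = 0}"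

text \<open>\<open>X\<close> commutes with all \<open>Q A z\<close>, so equivariance gives
  \<open>Q (X x) y = - Q x (X y)\<close>. Together with the symmetry of \<open>Q\<close> and the
  skew part of \<open>Q A x *v y\<close> from \<open>Q(3)\<close>, these relations determine
  \<open>X *v (Q x x *v y)\<close>.\<close>

lemma centralizer_formula:
  assumes X: "X \<in> centralizer"
  shows "2 *s (X *v (Q x x *v y)) = (2 * \<Omega> x (X *v y)) *s x + \<Omega> x (X *v x) *s y + (2 * \<Omega> x y) *s (X *v x)"
proof -
  have XK: "X \<in> K" and comm: "X *v (Q A z *v v) = Q A z *v (X *v v)" for A z v
  proof -
    show "X \<in> K" using X by (simp add: centralizer_def)
    have "commutator X (Q A z) *v v = 0" using X by (simp add: centralizer_def)
    then show "X *v (Q A z *v v) = Q A z *v (X *v v)" by (simp add: mat_vec_simps)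
  qed
  have inv: "Q (X *v x) y *v x = - (Q x (X *v y) *v x)"
  proof -
    have "Q (X *v x) y + Q x (X *v y) = 0"
      using Q_equivariant[OF XK, of x y] X by (simp add: centralizer_def)
    then show ?thesis by (metis eq_neg_iff_add_eq_0 minus_mat_vec)
  qed
  have X1: "\<Omega> y (X *v x) = \<Omega> x (X *v y)" and X2: "\<Omega> (X *v x) x = - \<Omega> x (X *v x)"
    using spD[of X x y] spD[of X x x] XK K_sp form_swap[of y "X *v x"] by auto
  have e1: "Q x x *v (X *v y) - Q x (X *v y) *v x = (3 / 2 * \<Omega> x (X *v y)) *s x"
    unfolding Q(3)[of x x "X *v y"] by (simp add: vec_eq_iff algebra_simps)
  have e2: "Q y (X *v x) *v x - Q y x *v (X *v x)
      = - \<Omega> x (X *v x) *s y - (1 / 2 * \<Omega> x (X *v y)) *s x - (1 / 2 * \<Omega> x y) *s (X *v x)"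
    unfolding Q(3)[of y "X *v x" x] X1 X2 form_swap[of y x] by (simp add: vec_eq_iff algebra_simps)
  have e3: "X *v (Q x x *v y) - X *v (Q x y *v x) = (3 / 2 * \<Omega> x y) *s (X *v x)"
    unfolding matrix_vector_mult_diff_distrib[symmetric] Q(3)[of x x y]
    by (simp add: vec_eq_iff mat_vec_simps algebra_simps)
  have e4: "X *v (Q x y *v x) = Q y x *v (X *v x)" using comm[of y x x] Q_sym[of x y] by simp
  have e5: "Q y (X *v x) *v x = - (Q x (X *v y) *v x)" using inv Q_sym[of y "X *v x"] by simp
  show ?thesis
    unfolding vec_eq_iff
  proof
    fix i
    show "(2 *s (X *v (Q x x *v y))) $ i
        = ((2 * \<Omega> x (X *v y)) *s x + \<Omega> x (X *v x) *s y + (2 * \<Omega> x y) *s (X *v x)) $ i"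
      using arg_cong[OF e1, of "\<lambda>v. v $ i"] arg_cong[OF e2, of "\<lambda>v. v $ i"]
        arg_cong[OF e3, of "\<lambda>v. v $ i"] arg_cong[OF e4, of "\<lambda>v. v $ i"]
        arg_cong[OF e5, of "\<lambda>v. v $ i"] arg_cong[OF comm[of x x y], of "\<lambda>v. v $ i"]
      by (simp add: field_simps) algebra
  qed
qed

text \<open>Two polynomials with zero product cannot both be nonzero. The constant coefficient of
  one is paired with the leading coefficient of the other so that the conclusion concerns
  independent vectors \<open>u\<close> and \<open>v\<close>.\<close>

lemma quadratic_product_zero:
  fixes a b c d e f :: complex
  assumes "\<And>t. (a + b * t + c * t\<^sup>2) * (d + e * t + f * t\<^sup>2) = 0"
  shows "a = 0 \<or> f = 0"
proof (rule ccontr)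
  assume n: "\<not> ?thesis"
  then have "[:a, b, c:] \<noteq> 0" "[:d, e, f:] \<noteq> 0" by auto
  then have "finite {t. poly ([:a, b, c:] * [:d, e, f:]) t = 0}"
    by (intro poly_roots_finite) (simp only: mult_eq_0_iff, simp)
  moreover have "poly ([:a, b, c:] * [:d, e, f:]) t = 0" for t
    using assms[of t] by (simp add: power2_eq_square algebra_simps)
  ultimately show False using infinite_UNIV_char_0[where 'a = complex] by simp
qed

text \<open>The product of the quadratic forms \<open>?q\<close> and \<open>?p\<close> is zero, so
  one of them vanishes identically: \<open>?q = 0\<close> gives \<open>X = 0\<close>, and
  \<open>?p = 0\<close> gives \<open>[X, Y] = 0\<close>.\<close>

lemma centralizer_abelian:
  assumes X: "X \<in> centralizer" and Y: "Y \<in> centralizer"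
  shows "commutator X Y = 0"
proof -
  have XK: "X \<in> K" "Y \<in> K" using X Y by (simp_all add: centralizer_def)
  note spX = spD[OF subsetD[OF K_sp XK(1)]] and spY = spD[OF subsetD[OF K_sp XK(2)]]
  let ?q = "\<lambda>x. \<Omega> x (X *v x)" and ?p = "\<lambda>x. \<Omega> x (X *v (Y *v x))"
  \<comment> \<open>The vector \<open>X Y Q x x x\<close> is computed twice, by the formula for
    \<open>Y\<close> at \<open>y = x\<close> and by the one for \<open>X\<close> at
    \<open>Y x\<close>. Pairing the results with \<open>X x\<close> leaves three times the
    product.\<close>
  have prod: "?q x * ?p x = 0" for x
  proof -
    have comm: "Q x x *v (Y *v x) = Y *v (Q x x *v x)"
    proof -
      have "commutator Y (Q x x) *v x = 0" using Y by (simp add: centralizer_def)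
      then show ?thesis by (simp add: mat_vec_simps)
    qed
    have "2 *s (Y *v (Q x x *v x)) = (3 * \<Omega> x (Y *v x)) *s x"
      unfolding centralizer_formula[OF Y] by (simp add: vec_eq_iff algebra_simps)
    then have "X *v (2 *s (Y *v (Q x x *v x))) = (3 * \<Omega> x (Y *v x)) *s (X *v x)" by (simp add: matrix_vec_scale)
    then have "(2 * ?p x) *s x + ?q x *s (Y *v x) + (2 * \<Omega> x (Y *v x)) *s (X *v x)
        = (3 * \<Omega> x (Y *v x)) *s (X *v x)"
      using centralizer_formula[OF X, of x "Y *v x"] by (simp add: comm matrix_vec_scale)
    then have "\<Omega> (X *v x) ((2 * ?p x) *s x + ?q x *s (Y *v x) + (2 * \<Omega> x (Y *v x)) *s (X *v x))
        = \<Omega> (X *v x) ((3 * \<Omega> x (Y *v x)) *s (X *v x))" by simp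
    then have "3 * (?q x * ?p x) = 0" by (simp add: form_linear spX)
    then show ?thesis by simp
  qed
  have expand: "\<Omega> (u + t *s v) (X *v (M *v (u + t *s v)))
      = \<Omega> u (X *v (M *v u)) + (\<Omega> u (X *v (M *v v)) + \<Omega> v (X *v (M *v u))) * t + \<Omega> v (X *v (M *v v)) * t\<^sup>2"
    for u v t and M :: "complex^'n^'n"
    by (simp add: mat_vec_simps form_linear power2_eq_square algebra_simps)
  have alt: "?q u = 0 \<or> ?p v = 0" for u v
  proof (rule quadratic_product_zero)
    fix t
    show "(?q u + (\<Omega> u (X *v v) + \<Omega> v (X *v u)) * t + \<Omega> v (X *v v) * t\<^sup>2)
        * (?p u + (\<Omega> u (X *v (Y *v v)) + \<Omega> v (X *v (Y *v u))) * t + ?p v * t\<^sup>2) = 0"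
      using prod[of "u + t *s v"] expand[of u t v Y] expand[of u t v "mat 1"] by simp
  qed
  show ?thesis
  proof (cases "\<forall>u. ?q u = 0")
    case True
    then have "X = 0" using spX by (intro quadratic_zero) auto
    then show ?thesis by (simp add: commutator_linear)
  next
    case False
    then have p: "?p v = 0" for v using alt by blast
    have "\<Omega> v (commutator X Y *v v) = 0" for v
    proof -
      have "\<Omega> v (Y *v (X *v v)) = - ?p v"
        using spY[of v "X *v v"] spX[of "Y *v v" v] form_swap[of v "X *v (Y *v v)"] by algebra
      then show ?thesis using p[of v] by (simp add: commutator_vec form_linear)
    qed
    moreover have "commutator X Y \<in> sp \<Omega>" using commutator_K[OF XK] K_sp by blast
    ultimately show ?thesis using spD by (intro quadratic_zero) auto
  qed
qed

text \<open>Projection by the trace form splits \<open>K\<close> into \<open>Q_ideal\<close> and the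
  centralizer. The centralizer commutes with both summands, so it is central, hence zero.\<close>

lemma K_subset_Q_ideal: "K \<subseteq> Q_ideal"
proof -
  note I = ideal_Q_ideal
  have split: "\<exists>s\<in>Q_ideal. B - s \<in> centralizer" if B: "B \<in> K" for B
  proof -
    obtain s where s: "s \<in> Q_ideal" "\<And>C. C \<in> Q_ideal \<Longrightarrow> trace (s ** C) = trace (B ** C)"
      by (rule ideal_functional[OF I, of "\<lambda>C. trace (B ** C)"])
        (simp_all add: mat_scale_mult matrix_mult_distrib trace_add trace_mat_scale that)
    have BK: "B - s \<in> K" using B s(1) idealD(2)[OF I] K_closed by blast
    have "commutator (B - s) C = 0" if C: "C \<in> Q_ideal" for C
    proof (rule trace_form_nondegenerate[OF I])
      show "commutator (B - s) C \<in> Q_ideal" by (rule idealD(3)[OF I BK C])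
      fix D assume D: "D \<in> Q_ideal"
      have "commutator C D \<in> Q_ideal" using idealD(3)[OF I idealD(2)[OF I C] D] .
      then show "trace (commutator (B - s) C ** D) = 0"
        unfolding trace_commutator using s(2) by (simp add: matrix_mult_distrib trace_sub)
    qed
    then have "B - s \<in> centralizer"
      using BK by (auto simp: centralizer_def Q_ideal_def intro: gl.span_base)
    then show ?thesis using s(1) by blast
  qed
  have "X = 0" if X: "X \<in> centralizer" for X
  proof (rule central_zero)
    show "X \<in> K" using X by (simp add: centralizer_def)
    fix B assume "B \<in> K"
    then obtain s where s: "s \<in> Q_ideal" "B - s \<in> centralizer" using split by blast
    have "commutator X s = 0"
      using s(1) unfolding Q_ideal_def
    proof (induction rule: gl.span_induct_alt)
      case (step c x y)
      then show ?case using X by (auto simp: centralizer_def commutator_linear)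
    qed (simp add: commutator_linear)
    then show "commutator X B = 0"
      using centralizer_abelian[OF X s(2)] by (simp add: commutator_linear)
  qed
  then show ?thesis using split by fastforce
qed

subsection \<open>Simplicity\<close>

abbreviation "T \<equiv> tanaka_total \<Omega> K"

lemma grade_high: "g (Suc (Suc (Suc (Suc (Suc n))))) = {0}"
proof (induction n)
  case 0
  then show ?case by (rule g5_zero)
next
  case (Suc n)
  have "u = 0" if u: "u \<in> g (Suc (Suc (Suc (Suc (Suc (Suc n))))))" for u
  proof (rule grade_ev_V_eq_zero[OF u])
    show "ev u (0, x) = 0" for x using grade_ev(2)[OF u, of x] unfolding Suc by blast
  qed
  then show ?case using grade_zero by blast
qed

lemma total_iff:
  "u \<in> T \<longleftrightarrow> (\<exists>u0\<in>g 0. \<exists>u1\<in>g (Suc 0). \<exists>u2\<in>g2. \<exists>u3\<in>g3. \<exists>u4\<in>g4. u = u0 + u1 + u2 + u3 + u4)"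
proof -
  have ints: "{-2..2} = {-2, -1, 0, 1, 2 :: int}" by auto
  have tan: "tanaka \<Omega> K (-2) = g 0" "tanaka \<Omega> K (-1) = g (Suc 0)" "tanaka \<Omega> K 0 = g2"
    "tanaka \<Omega> K 1 = g3" "tanaka \<Omega> K 2 = g4"
    by (simp_all add: tanaka_def eval_nat_numeral del: grade.simps)
  show ?thesis
  proof
    assume "u \<in> T"
    then obtain v where v: "u = (\<Sum>k\<in>{-2..2}. v k)" "\<forall>k\<in>{-2..2}. v k \<in> tanaka \<Omega> K k"
      unfolding tanaka_total_def by blast
    have "u = v (-2) + v (-1) + v 0 + v 1 + v 2" unfolding v(1) ints by (simp add: add.assoc)
    moreover have "v (-2) \<in> g 0" "v (-1) \<in> g (Suc 0)" "v 0 \<in> g2" "v 1 \<in> g3" "v 2 \<in> g4"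
      using v(2) unfolding ints tan[symmetric] by simp_all
    ultimately show "\<exists>u0\<in>g 0. \<exists>u1\<in>g (Suc 0). \<exists>u2\<in>g2. \<exists>u3\<in>g3. \<exists>u4\<in>g4. u = u0 + u1 + u2 + u3 + u4"
      by blast
  next
    assume "\<exists>u0\<in>g 0. \<exists>u1\<in>g (Suc 0). \<exists>u2\<in>g2. \<exists>u3\<in>g3. \<exists>u4\<in>g4. u = u0 + u1 + u2 + u3 + u4"
    then obtain u0 u1 u2 u3 u4 where u: "u0 \<in> g 0" "u1 \<in> g (Suc 0)" "u2 \<in> g2" "u3 \<in> g3" "u4 \<in> g4"
      "u = u0 + u1 + u2 + u3 + u4" by blast
    define v where "v = (\<lambda>k :: int. if k = -2 then u0 else if k = -1 then u1 else if k = 0 then u2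
      else if k = 1 then u3 else u4)"
    have vs: "v (-2) = u0" "v (-1) = u1" "v 0 = u2" "v 1 = u3" "v 2 = u4" by (simp_all add: v_def)
    have "u = (\<Sum>k\<in>{-2..2}. v k)" unfolding ints by (simp add: vs u(6) add.assoc)
    moreover have "\<forall>k\<in>{-2..2}. v k \<in> tanaka \<Omega> K k" unfolding ints using u(1-5) by (simp add: vs tan del: grade.simps)
    ultimately show "u \<in> T" unfolding tanaka_total_def by blast
  qed
qed

lemma grade_total: "u \<in> g n \<Longrightarrow> u \<in> T"
proof -
  assume u: "u \<in> g n"
  have z: "0 \<in> g k" for k by (rule grade_zero)
  consider "n = 0" | "n = Suc 0" | "n = Suc (Suc 0)" | "n = Suc (Suc (Suc 0))" | "n = Suc (Suc (Suc (Suc 0)))"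
    | k where "n = Suc (Suc (Suc (Suc (Suc k))))"
    by (metis not0_implies_Suc)
  then show "u \<in> T"
  proof cases
    case 1
    have "u = u + 0 + 0 + 0 + 0" by simp
    then show ?thesis unfolding total_iff using u z 1 by blast
  next
    case 2
    have "u = 0 + u + 0 + 0 + 0" by simp
    then show ?thesis unfolding total_iff using u z 2 by blast
  next
    case 3
    have "u = 0 + 0 + u + 0 + 0" by simp
    then show ?thesis unfolding total_iff using u z 3 by blast
  next
    case 4
    have "u = 0 + 0 + 0 + u + 0" by simp
    then show ?thesis unfolding total_iff using u z 4 by blast
  next
    case 5
    have "u = 0 + 0 + 0 + 0 + u" by simp
    then show ?thesis unfolding total_iff using u z 5 by blast
  next
    case 6
    then have "u = 0 + 0 + 0 + 0 + 0" using u grade_high by (simp del: grade.simps)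
    then show ?thesis unfolding total_iff using z by blast
  qed
qed

lemma subspace_total: "prol.subspace T"
proof (rule prol.subspaceI)
  show "0 \<in> T" using grade_total grade_zero by blast
next
  fix u v assume "u \<in> T" "v \<in> T"
  then obtain u0 u1 u2 u3 u4 v0 v1 v2 v3 v4
    where u: "u0 \<in> g 0" "u1 \<in> g (Suc 0)" "u2 \<in> g2" "u3 \<in> g3" "u4 \<in> g4" "u = u0 + u1 + u2 + u3 + u4"
      and v: "v0 \<in> g 0" "v1 \<in> g (Suc 0)" "v2 \<in> g2" "v3 \<in> g3" "v4 \<in> g4" "v = v0 + v1 + v2 + v3 + v4"
    unfolding total_iff by blast
  have "u + v = (u0 + v0) + (u1 + v1) + (u2 + v2) + (u3 + v3) + (u4 + v4)"
    unfolding u(6) v(6) by (simp only: ac_simps)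
  then show "u + v \<in> T" 
    unfolding total_iff using grade_add[OF u(1) v(1)] grade_add[OF u(2) v(2)] grade_add[OF u(3) v(3)]
      grade_add[OF u(4) v(4)] grade_add[OF u(5) v(5)] by blast
next
  fix c u assume "u \<in> T"
  then obtain u0 u1 u2 u3 u4
    where u: "u0 \<in> g 0" "u1 \<in> g (Suc 0)" "u2 \<in> g2" "u3 \<in> g3" "u4 \<in> g4" "u = u0 + u1 + u2 + u3 + u4"
    unfolding total_iff by blast
  have "prol_scale c u = prol_scale c u0 + prol_scale c u1 + prol_scale c u2 + prol_scale c u3 + prol_scale c u4"
    unfolding u(6) by (simp only: prol.scale_right_distrib)
  then show "prol_scale c u \<in> T" 
    unfolding total_iff using u(1-5)[THEN grade_scale, of c] by blast
qed

lemma total_induct [consumes 1, case_names grade add]: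
  assumes "u \<in> T" and grade: "\<And>n v. v \<in> g n \<Longrightarrow> P v"
    and add: "\<And>v w. v \<in> T \<Longrightarrow> w \<in> T \<Longrightarrow> P v \<Longrightarrow> P w \<Longrightarrow> P (v + w)"
  shows "P u"
proof -
  obtain u0 u1 u2 u3 u4
    where u: "u0 \<in> g 0" "u1 \<in> g (Suc 0)" "u2 \<in> g2" "u3 \<in> g3" "u4 \<in> g4" "u = u0 + u1 + u2 + u3 + u4"
    using assms(1) unfolding total_iff by blast
  have s: "v + w \<in> T \<and> P (v + w)" if vw: "v \<in> T \<and> P v" "w \<in> T \<and> P w" for v w
    using vw add[of v w] prol.subspace_add[OF subspace_total, of v w] by simp
  have gr: "v \<in> T \<and> P v" if v: "v \<in> g n" for v n using grade_total[OF v] grade[OF v] ..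
  show ?thesis
    unfolding u(6) by (rule s[OF s[OF s[OF s[OF gr[OF u(1)] gr[OF u(2)]] gr[OF u(3)]] gr[OF u(4)]] gr[OF u(5)], THEN conjunct2])
qed

lemma total_multilinear: "u \<in> T \<Longrightarrow> multilinear u"
  by (induction rule: total_induct) (rule grade_multilinear, assumption, rule multilinear_closed(4))

lemma brk_total: "u \<in> T \<Longrightarrow> v \<in> T \<Longrightarrow> brk u v \<in> T"
proof (induction rule: total_induct)
  case (grade i u)
  from grade(2,1) show ?case
  proof (induction rule: total_induct)
    case (grade j v)
    show ?case
    proof (cases "i + j < 2")
      case True
      then show ?thesis using brk_grade(2)[OF grade(2,1)] grade_total[OF grade_zero] by simp
    next
      case False
      then have "i + j = i + j - 2 + 2" by simp
      then show ?thesis by (rule grade_total[OF brk_grade(1)[OF grade(2,1)]])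
    qed
  next
    case (add v w)
    then show ?case
      using bracket_add(2)[OF total_multilinear total_multilinear grade_multilinear[OF grade(1)], of v w]
        prol.subspace_add[OF subspace_total] by simp
  qed
next
  case (add w w')
  then show ?case
    using bracket_add(1)[OF total_multilinear total_multilinear total_multilinear, of w w' v]
      prol.subspace_add[OF subspace_total] by simp
qed

lemma jacobi_total:
  assumes "u \<in> T" "v \<in> T" "w \<in> T"
  shows "brk u (brk v w) = brk (brk u v) w + brk v (brk u w)"
proof -
  note m = total_multilinear multilinear_bracket
  have 1: "brk u (brk v w) = brk (brk u v) w + brk v (brk u w)" if u: "u \<in> g i" and v: "v \<in> g j" and w: "w \<in> T"
    for u v w i j
    using w
  proof (induction rule: total_induct)
    case (grade k w)
    show ?case by (rule jacobi_grade[OF u v grade])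
  next
    case (add w w')
    have "multilinear u" "multilinear v" using u v grade_multilinear by blast+
    then show ?case using add m by (simp add: bracket_add)
  qed
  have 2: "brk u (brk v w) = brk (brk u v) w + brk v (brk u w)" if u: "u \<in> g i" and v: "v \<in> T" and w: "w \<in> T"
    for u v w i
    using v
  proof (induction rule: total_induct)
    case (grade k v)
    show ?case by (rule 1[OF u grade w])
  next
    case (add v v')
    have "multilinear u" using u grade_multilinear by blast
    then show ?case using add m w by (simp add: bracket_add)
  qed
  show ?thesis
    using assms(1)
  proof (induction rule: total_induct)
    case (grade k v)
    show ?case by (rule 2[OF grade assms(2,3)])
  next
    case (add u u')
    then show ?case using m assms by (simp add: bracket_add)
  qed
qed

lemma lie_algebra_total: "lie_algebra_on prol_scale brk T"
  unfolding lie_algebra_on_def lie_subalgebra_def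
proof (intro conjI ballI allI)
  show "vector_space (prol_scale :: complex \<Rightarrow> 'n prol \<Rightarrow> 'n prol)" by (rule prol_scale_vector_space)
  show "prol.subspace T" by (rule subspace_total)
  show "brk x y \<in> T" if "x \<in> T" "y \<in> T" for x y by (rule brk_total[OF that])
  show "brk (x + y) z = brk x z + brk y z" "brk z (x + y) = brk z x + brk z y" if "x \<in> T" "y \<in> T" "z \<in> T" for x y z
    using that by (simp_all add: bracket_add total_multilinear)
  show "brk (prol_scale c x) y = prol_scale c (brk x y)" "brk x (prol_scale c y) = prol_scale c (brk x y)"
    if "x \<in> T" "y \<in> T" for c x y
    using that by (simp_all add: bracket_scale total_multilinear)
  show self: "brk x x = 0" if "x \<in> T" for x
  proof -
    have "brk x x = - brk x x" using bracket_swap total_multilinear[OF that] by blast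
    then have "prol_scale 2 (brk x x) = 0"
      using prol.scale_left_distrib[of 1 1 "brk x x"] by (metis eq_neg_iff_add_eq_0 one_add_one prol.scale_one)
    then show ?thesis using prol.scale_eq_0_iff by fastforce
  qed
  show "brk x (brk y z) + brk y (brk z x) + brk z (brk x y) = 0" if xyz: "x \<in> T" "y \<in> T" "z \<in> T" for x y z
  proof -
    note m = total_multilinear[OF xyz(1)] total_multilinear[OF xyz(2)] total_multilinear[OF xyz(3)]
    have "brk z (brk x y) = - brk (brk x y) z" by (rule bracket_swap[OF m(3) multilinear_bracket[OF m(1,2)]])
    moreover have "brk y (brk z x) = - brk y (brk x z)"
      unfolding bracket_swap[OF m(3,1)] by (rule bracket_minus(2)[OF multilinear_bracket[OF m(1,3)] m(2)])
    ultimately show ?thesis using jacobi_total[OF xyz] by simp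
  qed
qed

lemma W0_eq: "\<Omega> x y = 1 \<Longrightarrow> brk (U y) (U x) = W0"
proof -
  assume xy: "\<Omega> x y = 1"
  have e: "ev (brk (U y) (U x)) (1, 0) = of_zer (0, 1)"
    using UU(2)[of y x] xy form_swap[of y x] Q_sym[of x y] by simp
  have "ev (brk (U y) (U x) - W0) (1, 0) = 0" by (simp only: ev_linear e W0 diff_self)
  then have "brk (U y) (U x) - W0 = 0" by (rule ev_F_injective[OF grade_diff[OF UU(1) W0(1)]])
  then show ?thesis by simp
qed

section \<open>Nonzero ideals of the total algebra\<close>

context
  fixes I assumes I: "lie_ideal prol_scale brk I T"
begin

lemma total_ideal:
  shows "u \<in> g n \<Longrightarrow> v \<in> I \<Longrightarrow> brk u v \<in> I" and "prol.subspace I" and "I \<subseteq> T"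
  using I grade_total by (auto simp: lie_ideal_def)

lemmas I_scale = prol.subspace_scale[OF total_ideal(2)]
lemmas I_add = prol.subspace_add[OF total_ideal(2)]

lemma elF_scale: "prol_scale c (elF a) = (elF (c * a) :: 'n prol)"
  by (simp add: neg_scale_def flip: of_neg_linear)

lemma elF_of_neg:
  assumes "of_neg (a, x) \<in> I" "(a, x) \<noteq> 0"
  shows "elF 1 \<in> I"
proof -
  have "elF 1 \<in> I" if "elF c \<in> I" "c \<noteq> 0" for c
    using I_scale[OF that(1), of "1 / c"] that(2) by (simp add: elF_scale)
  moreover have "\<exists>c. elF c \<in> I \<and> c \<noteq> 0"
  proof (cases "x = 0")
    case True
    then show ?thesis using assms by (auto simp: zero_prod_def)
  next
    case False
    then obtain y where "\<Omega> y x \<noteq> 0" using form_nondegenerate_right by blast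
    moreover have "brk (elV y) (of_neg (a, x)) = elF (\<Omega> y x)"
      by (simp add: bracket_nonpos[OF symplectic] neg_bracket_def)
    ultimately show ?thesis using total_ideal(1)[OF elV_grade assms(1), of y] by metis
  qed
  ultimately show ?thesis by blast
qed

text \<open>\<open>A - h\<close> kills g_{-1} only if \<open>A\<close> is a scalar, and
  \<open>sp\<close> contains no nonzero scalars: degree 0 acts faithfully.\<close>

lemma zer_faithful:
  assumes A: "A \<in> K" and z: "\<And>x. A *v x = h *s x"
  shows "A = 0" "h = 0"
proof -
  obtain x y where xy: "\<Omega> x y = 1" by (rule form_nonzero)
  have "\<Omega> (A *v x) y = - \<Omega> x (A *v y)" using spD A K_sp by blast
  then have "h = - h" unfolding z form_linear xy by simp
  then show h: "h = 0" by simp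
  show "A = 0" using z by (simp add: matrix_eq h)
qed

lemma elF_of_zer:
  assumes u: "of_neg X + of_zer (A, h) \<in> I" and A: "A \<in> K" and nz: "(A, h) \<noteq> 0"
  shows "elF 1 \<in> I"
proof -
  obtain x where x: "A *v x \<noteq> h *s x" using zer_faithful[OF A] nz by (metis zero_prod_def)
  have "brk (elV x) (of_neg X + of_zer (A, h)) = of_neg (neg_bracket \<Omega> (0, x) X) - of_neg (zer_act (A, h) (0, x))"
    by (simp add: bracket_add multilinear_closed bracket_nonpos[OF symplectic])
  also have "\<dots> = of_neg (\<Omega> x (snd X), h *s x - A *v x)"
    by (simp add: neg_bracket_def zer_act_def flip: of_neg_linear)
  finally have "of_neg (\<Omega> x (snd X), h *s x - A *v x) \<in> I" using total_ideal(1)[OF elV_grade u, of x] by metis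
  then show ?thesis by (rule elF_of_neg) (use x in \<open>auto simp: zero_prod_def\<close>)
qed

text \<open>Bracketing with \<open>F\<close> lowers the degree by two and is injective on positive
  degrees. A nonzero \<open>u4\<close> leaves a nonzero component of degree 0, a nonzero
  \<open>u3\<close> a nonzero negative element; otherwise \<open>u\<close> itself already has no
  positive part.\<close>

lemma elF_ideal:
  assumes "I \<noteq> {0}"
  shows "elF 1 \<in> I"
proof -
  obtain u where u: "u \<in> I" "u \<noteq> 0" using assms prol.subspace_0[OF total_ideal(2)] by blast
  then have "u \<in> T" using total_ideal(3) by blast
  then obtain u0 u1 u2 u3 u4
    where c: "u0 \<in> g 0" "u1 \<in> g (Suc 0)" "u2 \<in> g2" "u3 \<in> g3" "u4 \<in> g4" and sum: "u = u0 + u1 + u2 + u3 + u4"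
    unfolding total_iff by blast
  obtain a where a: "u0 = elF a" using c(1) by auto
  obtain x where x: "u1 = elV x" using c(2) by auto
  obtain A h where A: "u2 = of_zer (A, h)" "A \<in> K" using c(3) by auto
  have lo: "u0 + u1 = of_neg (a, x)" unfolding a x by (simp flip: of_neg_linear)
  note m = c[THEN grade_multilinear]
  have "brk (elF 1) u = - of_neg (zer_act (A, h) (1, 0)) - ev u3 (1, 0) - ev u4 (1, 0)"
  proof -
    have "brk (elF 1) u0 = 0" "brk (elF 1) u1 = 0" "brk (elF 1) u2 = - of_neg (zer_act (A, h) (1, 0))"
      unfolding a x A by (simp_all add: bracket_nonpos[OF symplectic] neg_bracket_def form_linear flip: zero_prod_def)
    moreover have "brk (elF 1) u3 = - ev u3 (1, 0)" "brk (elF 1) u4 = - ev u4 (1, 0)"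
      using brk_neg_left[OF c(4)] brk_neg_left[OF c(5)] grade_pos_act[OF c(4)] grade_pos_act[OF c(5)] by simp_all
    ultimately show ?thesis unfolding sum using m by (simp add: bracket_add multilinear_closed)
  qed
  then have low: "- of_neg (zer_act (A, h) (1, 0)) - ev u3 (1, 0) - ev u4 (1, 0) \<in> I"
    using total_ideal(1)[OF elF_grade u(1), of 1] by simp
  obtain y where y: "ev u3 (1, 0) = elV y" using grade_ev(1)[OF c(4), of 1] by auto
  obtain C k where C: "ev u4 (1, 0) = of_zer (C, k)" "C \<in> K" using grade_ev(1)[OF c(5), of 1] by auto
  show ?thesis
  proof (cases "u4 = 0")
    case False
    have "- of_neg (zer_act (A, h) (1, 0)) - ev u3 (1, 0) - ev u4 (1, 0)
        = of_neg (- zer_act (A, h) (1, 0) - (0, y)) + of_zer (- C, - k)"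
      unfolding y C using of_zer_linear(3)[of "(C, k)"] by (simp add: of_neg_linear)
    then have "of_neg (- zer_act (A, h) (1, 0) - (0, y)) + of_zer (- C, - k) \<in> I" using low by simp
    then show ?thesis
    proof (rule elF_of_zer)
      show "- C \<in> K" using gl.subspace_neg[OF subspace_K C(2)] .
      show "(- C, - k) \<noteq> 0"
        using ev_F_injective[OF c(5)] False C(1) by (metis neg_equal_0_iff_equal of_zero(2) prod.inject zero_prod_def)
    qed
  next
    case u4: True
    show ?thesis
    proof (cases "u3 = 0")
      case False
      have "- of_neg (zer_act (A, h) (1, 0)) - ev u3 (1, 0) - ev u4 (1, 0) = of_neg (2 * h, - y)"
        unfolding y u4 by (simp add: zer_act_def flip: of_neg_linear)
      then have "of_neg (2 * h, - y) \<in> I" using low by simp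
      then show ?thesis
      proof (rule elF_of_neg)
        show "(2 * h, - y) \<noteq> 0" using ev_F_injective[OF c(4)] False y elV_zero by (auto simp: zero_prod_def)
      qed
    next
      case u3: True
      have ue: "u = of_neg (a, x) + of_zer (A, h)" unfolding sum u3 u4 lo A by simp
      show ?thesis
      proof (cases "(A, h) = 0")
        case False
        show ?thesis by (rule elF_of_zer[OF _ A(2) False]) (rule u(1)[unfolded ue])
      next
        case True
        then have "u = of_neg (a, x)" unfolding ue by (simp add: True)
        then show ?thesis using u elF_of_neg of_zero(1) by metis
      qed
    qed
  qed
qed

lemma total_ideal_eq:
  assumes "I \<noteq> {0}"
  shows "I = T"
proof -
  have F: "elF 1 \<in> I" by (rule elF_ideal[OF assms])
  have V: "elV x \<in> I" for x
    using total_ideal(1)[OF U(1) F, of x] grade_pos_act[OF U(1)] U(2) by simp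
  have H: "of_zer (0, 1) \<in> I"
    using total_ideal(1)[OF W0(1) F] grade_pos_act[OF W0(1)] W0(2) by simp
  have cH: "of_zer (0, c) \<in> I" for c
    using I_scale[OF H, of c] of_zer_linear(4)[of c "(0, 1) :: 'n zer"] by simp
  have QI: "elK (Q A x) \<in> I" for A x
  proof -
    \<comment> \<open>The bracket with \<open>elV x\<close> has a component along \<open>H\<close>,
      which is removed since \<open>H\<close> already lies in the ideal.\<close>
    have "of_zer (Q A x, - (1 / 2) * \<Omega> A x) \<in> I"
      using total_ideal(1)[OF U(1) V, of A x] grade_pos_act[OF U(1)] Q(1) by simp
    then have "of_zer (Q A x, - (1 / 2) * \<Omega> A x) + of_zer (0, 1 / 2 * \<Omega> A x) \<in> I" by (rule I_add[OF _ cH])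
    then show ?thesis by (simp flip: of_zer_linear)
  qed
  have span: "elK B \<in> I" if "B \<in> Q_ideal" for B
    using that unfolding Q_ideal_def
  proof (induction rule: gl.span_induct_alt)
    case base
    then show ?case using cH[of 0] by simp
  next
    case (step c B C)
    have "elK (mat_scale c B + C) = prol_scale c (elK B) + elK C"
      using of_zer_linear(4)[of c "(B, 0)"] by (simp flip: of_zer_linear)
    then show ?case using step QI I_add I_scale by auto
  qed
  have zer: "of_zer (B, h) \<in> I" if "B \<in> K" for B h
  proof -
    have "of_zer (B, h) = elK B + of_zer (0, h)" by (simp flip: of_zer_linear)
    then show ?thesis using I_add[OF span cH, of B h] that K_subset_Q_ideal by auto
  qed
  \<comment> \<open>\<open>H\<close> acts as the identity on \<open>g3\<close>, so \<open>H\<close>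
    in the ideal brings in all of \<open>g3\<close>.\<close>
  have UI: "U A \<in> I" for A
  proof -
    have "brk (U A) (of_zer (0, 1)) = - brk (of_zer (0, 1)) (U A)"
      by (rule bracket_swap[OF grade_multilinear[OF U(1)] multilinear_closed(3)])
    also have "\<dots> = - U A" using zer_U[of 0 1 A] gl.subspace_0[OF subspace_K] by simp
    finally have "- U A \<in> I" using total_ideal(1)[OF U(1) H, of A] by simp
    then show ?thesis using prol.subspace_neg[OF total_ideal(2)] by fastforce
  qed
  have W: "W0 \<in> I"
  proof -
    obtain x y where "\<Omega> x y = 1" by (rule form_nonzero)
    then show ?thesis using total_ideal(1)[OF U(1) UI, of y x] W0_eq by simp
  qed
  have gI: "u \<in> I" if u: "u \<in> g n" for u n
  proof -
    consider "n = 0" | "n = Suc 0" | "n = Suc (Suc 0)" | "n = Suc (Suc (Suc 0))" | "n = Suc (Suc (Suc (Suc 0)))"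
      | k where "n = Suc (Suc (Suc (Suc (Suc k))))"
      by (metis not0_implies_Suc)
    then show ?thesis
    proof cases
      case 1
      then obtain a where "u = elF a" using u by auto
      then show ?thesis using I_scale[OF F, of a] by (simp add: elF_scale)
    next
      case 2
      then show ?thesis using u V by auto
    next
      case 3
      then show ?thesis using u zer by auto
    next
      case 4
      then show ?thesis using u U_surj UI by blast
    next
      case 5
      then show ?thesis using u g4_eq W I_scale by blast
    next
      case 6
      then show ?thesis using u grade_high prol.subspace_0[OF total_ideal(2)] by (simp del: grade.simps)
    qed
  qed
  have "u \<in> I" if "u \<in> T" for u
    using that by (induction rule: total_induct) (blast intro: gI I_add)+
  then show ?thesis using total_ideal(3) by blast
qed

end

lemma simple_total: "simple_lie_algebra prol_scale brk T"
  unfolding simple_lie_algebra_def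
proof (intro conjI allI impI)
  show "lie_algebra_on prol_scale brk T" by (rule lie_algebra_total)
  obtain x y where xy: "\<Omega> x y = 1" by (rule form_nonzero)
  have "brk (elV x) (elV y) = elF 1" by (simp add: bracket_nonpos[OF symplectic] neg_bracket_def xy)
  moreover have "elF 1 \<noteq> (0 :: 'n prol)"
  proof
    assume "elF 1 = (0 :: 'n prol)"
    then have "neg_part (elF 1 :: 'n prol) = neg_part 0" by (rule arg_cong)
    then show False by (simp add: zero_prod_def)
  qed
  ultimately show "\<exists>x\<in>T. \<exists>y\<in>T. brk x y \<noteq> 0" using grade_total[OF elV_grade] by metis
  show "I = {0} \<or> I = T" if "lie_ideal prol_scale brk I T" for I
    using total_ideal_eq[OF that] by blast
qed

section \<open>The module isomorphisms\<close>

lemma U_iso: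
  "Vector_Spaces.linear (*s) prol_scale U" "bij_betw U UNIV g3"
proof -
  show "Vector_Spaces.linear (*s) prol_scale U"
    by (simp add: Vector_Spaces.linear_iff vec.vector_space_axioms prol.vector_space_axioms U_linear)
  have "range U = g3" using U(1) U_surj by blast
  then show "bij_betw U UNIV g3" unfolding bij_betw_def using U_inj by (simp add: inj_def del: grade.simps)
qed

lemma W0_iso:
  "Vector_Spaces.linear (*) prol_scale (\<lambda>c. prol_scale c W0)" "bij_betw (\<lambda>c. prol_scale c W0) UNIV g4"
proof -
  show "Vector_Spaces.linear (*) prol_scale (\<lambda>c. prol_scale c W0)"
    by (simp add: Vector_Spaces.linear_iff vector_space_over_itself.vector_space_axioms prol.vector_space_axioms
        prol.scale_left_distrib)
  have "W0 \<noteq> 0"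
  proof
    assume "W0 = 0"
    then have "zer_part (of_zer (0, 1) :: 'n prol) = zer_part 0" using W0(2) ev_zero by metis
    then show False by (simp add: zero_prod_def)
  qed
  then have "inj (\<lambda>c. prol_scale c W0)" by (simp add: inj_def)
  moreover have "range (\<lambda>c. prol_scale c W0) = g4" using g4_eq grade_scale[OF W0(1)] by blast
  ultimately show "bij_betw (\<lambda>c. prol_scale c W0) UNIV g4" unfolding bij_betw_def by blast
qed

end

theorem lemma1:
  fixes \<Omega> :: "complex^'n \<Rightarrow> complex^'n \<Rightarrow> complex"
    and K :: "(complex^'n^'n) set"
    and m :: nat
  assumes "m \<ge> 2" and "CARD('n) = 2 * m"
    and "symplectic_form \<Omega>"
    and "K \<subseteq> sp \<Omega>" and "lie_subalgebra mat_scale commutator K"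
  shows
    "bij_betw (\<lambda>u x. ev u (0, x)) (tanaka \<Omega> K 1)
       {\<phi>. Vector_Spaces.linear (*s) prol_scale \<phi> \<and> range \<phi> \<subseteq> tanaka \<Omega> K 0 \<and>
           (\<exists>A. \<forall>x y. bracket \<Omega> (\<phi> x) (elV y) - bracket \<Omega> (\<phi> y) (elV x)
                        = prol_scale (\<Omega> x y) (elV A))}
     \<and>
     (K \<noteq> sp \<Omega> \<and> acts_irreducibly K \<and> tanaka \<Omega> K 1 \<noteq> {0} \<longrightarrow>
       (\<exists>f :: complex^'n \<Rightarrow> 'n prol.
          Vector_Spaces.linear (*s) prol_scale f \<and> bij_betw f UNIV (tanaka \<Omega> K 1) \<and>
          (\<forall>A\<in>K. \<forall>x. f (A *v x) = bracket \<Omega> (elK A) (f x))) \<and>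
       (\<exists>f :: complex \<Rightarrow> 'n prol.
          Vector_Spaces.linear (*) prol_scale f \<and> bij_betw f UNIV (tanaka \<Omega> K 2) \<and>
          (\<forall>A\<in>K. \<forall>c. bracket \<Omega> (elK A) (f c) = 0)) \<and>
       tanaka \<Omega> K 3 = {0} \<and>
       simple_lie_algebra prol_scale (bracket \<Omega>) (tanaka_total \<Omega> K))"
proof -
  \<comment> \<open>The dimension bound required by \<open>wedge_zero\<close>.\<close>
  have dim: "CARD('n) \<ge> 3" using assms(1,2) by simp
  have tan: "tanaka \<Omega> K 0 = grade \<Omega> K (Suc (Suc 0))" "tanaka \<Omega> K 1 = grade \<Omega> K (Suc (Suc (Suc 0)))"
    "tanaka \<Omega> K 2 = grade \<Omega> K (Suc (Suc (Suc (Suc 0))))" "tanaka \<Omega> K 3 = grade \<Omega> K (Suc (Suc (Suc (Suc (Suc 0)))))"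
    by (simp_all add: tanaka_def eval_nat_numeral del: grade.simps)
  interpret symplectic_algebra \<Omega> K using assms(3-5) by unfold_locales
  show ?thesis
    unfolding tan
  proof (intro conjI[OF first_prolongation[OF dim]] impI, elim conjE)
    assume h: "K \<noteq> sp \<Omega>" "acts_irreducibly K" "grade \<Omega> K (Suc (Suc (Suc 0))) \<noteq> {0}"
    interpret special_sp \<Omega> K
      using h dim assms(4,5) by unfold_locales
    have "brk (elK A) (prol_scale c W0) = 0" if "A \<in> K" for A c
      using that bracket_scale(2)[OF grade_multilinear[OF W0(1)] multilinear_closed(3)] by (simp add: elK_W0)
    then have "\<forall>A\<in>K. \<forall>c. brk (elK A) (prol_scale c W0) = 0" by blast
    moreover have "\<forall>A\<in>K. \<forall>x. U (A *v x) = brk (elK A) (U x)" using U_act by simp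
    ultimately show "(\<exists>f :: complex^'n \<Rightarrow> 'n prol.
          Vector_Spaces.linear (*s) prol_scale f \<and> bij_betw f UNIV g3 \<and>
          (\<forall>A\<in>K. \<forall>x. f (A *v x) = brk (elK A) (f x))) \<and>
       (\<exists>f :: complex \<Rightarrow> 'n prol.
          Vector_Spaces.linear (*) prol_scale f \<and> bij_betw f UNIV g4 \<and>
          (\<forall>A\<in>K. \<forall>c. brk (elK A) (f c) = 0)) \<and>
       g5 = {0} \<and> simple_lie_algebra prol_scale brk (tanaka_total \<Omega> K)"
      using U_iso W0_iso g5_zero simple_total by blast
  qed
qed

end
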